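(* Let $D\subset\subset\mathbb{C}^n$ be a bounded strongly pseudoconvex domain, $1-\frac{1}{n+1}<\theta<2$, and $\Gamma=\{z_j\}_{j\in\mathbb{N}}$ a sequence in $D$. Then $\Gamma$ is a finite union of uniformly discrete sequences (for the distance $\rho_D=\tanh k_D$) if and only if $\sum_j\delta(z_j)^{(n+1)\theta}\delta_{z_j}$ is a $\theta$-Carleson measure, where $\delta_{z_j}$ is the Dirac measure at $z_j$.
   Context: $\nu$ is Lebesgue measure, $\delta(z)=d(z,\partial D)$. $k_D$ is the Kobayashi distance of $D$ and $\rho_D=\tanh k_D$. A sequence $\{x_j\}$ is uniformly discrete if there is $\varepsilon>0$ with $\rho_D(x_j,x_k)\ge\varepsilon$ for all $j\ne k$. For $z_0\in D$, $r\in(0,1)$, $B_D(z_0,r)$ is the $k_D$-ball of center $z_0$ and radius $\frac12\log\frac{1+r}{1-r}$. A finite positive Borel measure $\mu$ is $\theta$-Carleson if for every $r\in(0,1)$ there is $C_r>0$ with $\mu(B_D(z,r))\le C_r\,\nu(B_D(z,r))^\theta$ for all $z\in D$ (in particular the measure is required to be finite). *)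

theory Defs
  imports "HOL-Analysis.Analysis"
begin

definition imul :: "complex ^ 'n \<Rightarrow> complex ^ 'n" where
  "imul w = (\<chi> k. \<i> * w $ k)"

text \<open>Bounded strongly pseudoconvex domain: a bounded domain D with a C^2 defining
  function r on an open neighbourhood U of the closure, D = {r < 0}, dr nonzero on the
  boundary, and Levi form positive definite on the complex tangent space at boundary
  points.  For a real C^2 function with second (real Frechet) derivative D2r, the Levi
  form satisfies  sum_{j,k} r_{z_j zbar_k}(p) w_j conj(w_k) = (D2r p w w + D2r p (i w) (i w))/4,
  and the complex tangent space is {w. Dr p w = 0 and Dr p (i w) = 0}.\<close>

definition strongly_pseudoconvex_domain :: "(complex ^ 'n) set \<Rightarrow> bool" where
  "strongly_pseudoconvex_domain D \<longleftrightarrow>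
     open D \<and> connected D \<and> D \<noteq> {} \<and> bounded D \<and>
     (\<exists>U r Dr D2r.
        open U \<and> closure D \<subseteq> U \<and>
        (\<forall>x\<in>U. (r has_derivative blinfun_apply (Dr x)) (at x)) \<and>
        (\<forall>x\<in>U. (Dr has_derivative blinfun_apply (D2r x)) (at x)) \<and>
        continuous_on U D2r \<and>
        D = {x\<in>U. r x < (0::real)} \<and>
        (\<forall>p\<in>frontier D. Dr p \<noteq> 0 \<and>
           (\<forall>w. w \<noteq> 0 \<and> Dr p w = 0 \<and> Dr p (imul w) = 0 \<longrightarrow>
                 D2r p w w + D2r p (imul w) (imul w) > 0)))"

text \<open>Poincare distance on the unit disc (curvature -4 normalisation):
  omega(a,b) = artanh |(a-b)/(1 - conj b a)| = (1/2) log((1+t)/(1-t)).\<close>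

definition poincare_dist :: "complex \<Rightarrow> complex \<Rightarrow> real" where
  "poincare_dist a b = artanh (cmod ((a - b) / (1 - cnj b * a)))"

definition holo_disc :: "(complex ^ 'n) set \<Rightarrow> (complex \<Rightarrow> complex ^ 'n) \<Rightarrow> bool" where
  "holo_disc D f \<longleftrightarrow> (\<forall>k. (\<lambda>\<zeta>. f \<zeta> $ k) holomorphic_on ball 0 1) \<and> f ` ball 0 1 \<subseteq> D"

definition kobayashi_chain ::
  "(complex ^ 'n) set \<Rightarrow> complex ^ 'n \<Rightarrow> complex ^ 'n \<Rightarrow>
     ((complex \<Rightarrow> complex ^ 'n) \<times> complex \<times> complex) list \<Rightarrow> bool" where
  "kobayashi_chain D z w cs \<longleftrightarrow>
     cs \<noteq> [] \<and>
     (\<forall>(f, a, b) \<in> set cs. holo_disc D f \<and> a \<in> ball 0 1 \<and> b \<in> ball 0 1) \<and>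
     (case hd cs of (f, a, b) \<Rightarrow> f a = z) \<and>
     (case last cs of (f, a, b) \<Rightarrow> f b = w) \<and>
     (\<forall>i. Suc i < length cs \<longrightarrow>
        (case cs ! i of (f, a, b) \<Rightarrow> f b) = (case cs ! Suc i of (g, c, d) \<Rightarrow> g c))"

definition kobayashi_dist :: "(complex ^ 'n) set \<Rightarrow> complex ^ 'n \<Rightarrow> complex ^ 'n \<Rightarrow> real" where
  "kobayashi_dist D z w =
     Inf {(\<Sum>(f, a, b) \<leftarrow> cs. poincare_dist a b) | cs. kobayashi_chain D z w cs}"

definition rho :: "(complex ^ 'n) set \<Rightarrow> complex ^ 'n \<Rightarrow> complex ^ 'n \<Rightarrow> real" where
  "rho D z w = tanh (kobayashi_dist D z w)"

definition kob_ball :: "(complex ^ 'n) set \<Rightarrow> complex ^ 'n \<Rightarrow> real \<Rightarrow> (complex ^ 'n) set" where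
  "kob_ball D z0 r = {z\<in>D. kobayashi_dist D z0 z < ln ((1 + r) / (1 - r)) / 2}"

definition uniformly_discrete :: "(complex ^ 'n) set \<Rightarrow> (nat \<Rightarrow> complex ^ 'n) \<Rightarrow> nat set \<Rightarrow> bool" where
  "uniformly_discrete D x I \<longleftrightarrow>
     (\<exists>\<epsilon>>0. \<forall>j\<in>I. \<forall>k\<in>I. j \<noteq> k \<longrightarrow> rho D (x j) (x k) \<ge> \<epsilon>)"

definition finite_union_unif_discrete :: "(complex ^ 'n) set \<Rightarrow> (nat \<Rightarrow> complex ^ 'n) \<Rightarrow> bool" where
  "finite_union_unif_discrete D x \<longleftrightarrow>
     (\<exists>\<I>. finite \<I> \<and> \<Union>\<I> = UNIV \<and> (\<forall>I\<in>\<I>. uniformly_discrete D x I))"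

definition theta_carleson :: "(complex ^ 'n) set \<Rightarrow> real \<Rightarrow> (complex ^ 'n) measure \<Rightarrow> bool" where
  "theta_carleson D \<theta> \<mu> \<longleftrightarrow>
     sets \<mu> = sets borel \<and> finite_measure \<mu> \<and>
     (\<forall>r. 0 < r \<and> r < 1 \<longrightarrow> (\<exists>C>0. \<forall>z\<in>D.
        measure \<mu> (kob_ball D z r) \<le> C * (measure lborel (kob_ball D z r)) powr \<theta>))"

definition dirac_sum :: "(nat \<Rightarrow> 'a::topological_space) \<Rightarrow> (nat \<Rightarrow> real) \<Rightarrow> 'a measure" where
  "dirac_sum x c = measure_of (space borel) (sets borel)
      (\<lambda>A. \<Sum>j. ennreal (c j) * indicator A (x j))"

definition bdist :: "(complex ^ 'n) set \<Rightarrow> complex ^ 'n \<Rightarrow> real" where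
  "bdist D z = infdist z (frontier D)"

end

theory Submission
  imports Defs "HOL-Complex_Analysis.Riemann_Mapping"
begin

text \<open>Let \<open>g = - r\<close>, which is comparable to the distance to the boundary. A holomorphic disc \<open>f\<close>
  through \<open>z = f 0\<close> is composed with a corrected Levi polynomial of \<open>r\<close> at \<open>z\<close>; the real part of the
  composition is at most \<open>2 * g z - c * \<bar>f - z\<bar>\<^sup>2\<close> near \<open>0\<close>, so the Borel-Caratheodory inequality
  and the Schwarz lemma bound the displacement of \<open>f\<close> by a multiple of \<open>sqrt (g z)\<close>, and of \<open>g z\<close> in
  the complex normal direction. Subdividing chains of discs, these bounds show that a Kobayashi
  ball lies in a slab of size \<open>g z\<close> in the normal and \<open>sqrt (g z)\<close> in the tangential directions,
  and linear discs show that it contains a similar slab. Hence its volume is comparable to the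
  \<open>n + 1\<close>-st power of the distance to the boundary, which is itself nearly constant on the ball.

  A packing argument now bounds the number of points of a uniformly discrete sequence in a ball, and,
  since the layer \<open>{g < t}\<close> has volume \<open>O(t)\<close>, there are \<open>O(2^(k * n))\<close> points in the \<open>k\<close>-th
  dyadic layer; the sum converges because \<open>(n + 1) * \<theta> > n\<close>. Conversely the Carleson condition
  bounds the number of points in each ball, and a greedy colouring splits the sequence.\<close>

subsection \<open>The Kobayashi distance\<close>

text \<open>The sizes \<open>g\<close> and \<open>sqrt g\<close> are compatible: moving the base
  point by O(sqrt g) changes \<open>ell\<close> by O(sqrt g), so on a further displacement of O(sqrt
  g) the error is O(g), just what the normal direction allows. The volume exponent n + 1 arises from
  one complex direction of size g, with area g^2, and n - 1 complex directions of size sqrt g, with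
  volume g^(n-1). The disc estimates are uniform on a small disc of parameters only, whereas a chain
  may use discs with arbitrary endpoints; hence the subdivision. The number of pieces is harmless: a
  piece of length a changes g by a factor of at most exp(2 C a), and these factors multiply to exp(2
  C d). Boundedness of D keeps every disc, for small parameters, in the neighbourhood where the Levi
  polynomial is controlled, so the Kobayashi distance needs no separate localisation. Gradient and
  Levi form are controlled only where \<open>g < \<eta>\<close>. Where
  \<open>g \<ge> \<eta>\<close>, powers of g are comparable to constants and crude bounds suffice;
  this explains the recurring case split.\<close>

lemma Schwarz_bound:
  assumes hol: "h holomorphic_on ball 0 R" and "h 0 = 0" "R > 0"
    and bd: "\<And>\<zeta>. cmod \<zeta> < R \<Longrightarrow> cmod (h \<zeta>) < M" and \<zeta>: "cmod \<zeta> < R"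
  shows "cmod (h \<zeta>) \<le> M * cmod \<zeta> / R"
proof -
  have M: "M > 0" using bd[of 0] assms by simp
  define \<phi> where "\<phi> = (\<lambda>x. h (of_real R * x) / of_real M)"
  have im: "(\<lambda>x. of_real R * x) ` ball 0 1 \<subseteq> ball (0::complex) R"
    using \<open>R > 0\<close> by (auto simp: norm_mult)
  have "\<phi> holomorphic_on ball 0 1" unfolding \<phi>_def
    using holomorphic_on_compose_gen[OF _ hol im] M
    by (auto intro!: holomorphic_intros simp: o_def)
  moreover have "\<phi> 0 = 0" using assms by (simp add: \<phi>_def)
  moreover have "norm (\<phi> x) < 1" if "norm x < 1" for x
    using bd[of "of_real R * x"] that \<open>R > 0\<close> M by (simp add: \<phi>_def norm_mult norm_divide)
  moreover have "cmod (\<zeta> / of_real R) < 1" using \<zeta> \<open>R > 0\<close> by (simp add: norm_divide)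
  ultimately have "norm (\<phi> (\<zeta> / of_real R)) \<le> norm (\<zeta> / of_real R)"
    using Schwarz_Lemma(1) by blast
  then show ?thesis using \<open>R > 0\<close> M by (simp add: \<phi>_def norm_divide field_simps)
qed

text \<open>The map \<open>w / (2 * A - w)\<close> sends the half-plane Re w < A into the unit disc
  and fixes 0, so the Schwarz lemma applies to \<open>\<phi>\<close>. On the disc of half the radius
  \<open>\<phi>\<close> has modulus at most 1/2, and h = 2 A \<phi> / (1 + \<phi>) has a denominator
  of modulus at least 1/2.\<close>

lemma Borel_Caratheodory_half:
  assumes hol: "h holomorphic_on ball 0 R" and "h 0 = 0" "R > 0" "A > 0"
    and bd: "\<And>\<zeta>. cmod \<zeta> < R \<Longrightarrow> Re (h \<zeta>) < A" and \<zeta>: "cmod \<zeta> \<le> R / 2"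
  shows "cmod (h \<zeta>) \<le> 4 * A * cmod \<zeta> / R"
proof -
  have lt: "cmod (h x) < cmod (2 * of_real A - h x)" if "cmod x < R" for x
  proof -
    have "(cmod (h x))\<^sup>2 < (cmod (2 * of_real A - h x))\<^sup>2"
      using bd[OF that] \<open>A > 0\<close> unfolding cmod_power2
      by (simp add: power2_eq_square algebra_simps)
    then show ?thesis by (rule power2_less_imp_less) simp
  qed
  then have nz: "2 * of_real A - h x \<noteq> 0" if "cmod x < R" for x using that
    by (metis norm_zero norm_not_less_zero)
  define \<phi> where "\<phi> = (\<lambda>x. h x / (2 * of_real A - h x))"
  have "\<phi> holomorphic_on ball 0 R" unfolding \<phi>_def
    using nz by (intro holomorphic_intros hol) auto
  moreover have "\<phi> 0 = 0" using assms by (simp add: \<phi>_def)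
  moreover have "cmod (\<phi> x) < 1" if "cmod x < R" for x
    using lt[OF that] nz[OF that] by (simp add: \<phi>_def norm_divide)
  ultimately have le: "cmod (\<phi> \<zeta>) \<le> 1 * cmod \<zeta> / R"
    using \<zeta> \<open>R > 0\<close> by (intro Schwarz_bound) auto
  also have "\<dots> \<le> 1 / 2" using \<zeta> \<open>R > 0\<close> by (simp add: field_simps)
  finally have half: "cmod (\<phi> \<zeta>) \<le> 1 / 2" .
  have "h \<zeta> * (1 + \<phi> \<zeta>) = 2 * of_real A * \<phi> \<zeta>"
    using nz[of \<zeta>] \<zeta> \<open>R > 0\<close> by (simp add: \<phi>_def field_simps)
  then have "cmod (h \<zeta>) * cmod (1 + \<phi> \<zeta>) = 2 * A * cmod (\<phi> \<zeta>)"
    using \<open>A > 0\<close> by (metis norm_mult norm_of_real norm_numeral abs_of_pos)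
  moreover have "cmod (1 + \<phi> \<zeta>) \<ge> 1 / 2"
    using half norm_triangle_ineq2[of 1 "- \<phi> \<zeta>"] by simp
  ultimately have "cmod (h \<zeta>) * (1 / 2) \<le> 2 * A * (cmod \<zeta> / R)"
  proof -
    assume eq: "cmod (h \<zeta>) * cmod (1 + \<phi> \<zeta>) = 2 * A * cmod (\<phi> \<zeta>)" and ge: "1 / 2 \<le> cmod (1 + \<phi> \<zeta>)"
    have "cmod (h \<zeta>) * (1 / 2) \<le> cmod (h \<zeta>) * cmod (1 + \<phi> \<zeta>)"
      by (rule mult_left_mono[OF ge]) simp
    also have "\<dots> \<le> 2 * A * (cmod \<zeta> / R)" unfolding eq using le \<open>A > 0\<close> by (intro mult_left_mono) auto
    finally show ?thesis .
  qed
  then show ?thesis by simp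
qed

text \<open>The scalar bound is applied to each coordinate; the factor \<open>CARD('n)\<close> is
  the price of bounding the norm by the sum of the coordinates.\<close>

lemma Schwarz_bound_vec:
  fixes F :: "complex \<Rightarrow> complex ^ 'n"
  assumes hol: "\<And>k. (\<lambda>\<zeta>. F \<zeta> $ k) holomorphic_on ball 0 R" and "R > 0"
    and bd: "\<And>\<zeta>. cmod \<zeta> < R \<Longrightarrow> norm (F \<zeta> - F 0) < M" and \<zeta>: "cmod \<zeta> < R"
  shows "norm (F \<zeta> - F 0) \<le> real CARD('n) * M * cmod \<zeta> / R"
proof -
  have "cmod ((F \<zeta> - F 0) $ k) \<le> M * cmod \<zeta> / R" for k
  proof -
    have "cmod ((\<lambda>\<zeta>. (F \<zeta> - F 0) $ k) \<zeta>) \<le> M * cmod \<zeta> / R"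
    proof (rule Schwarz_bound)
      show "(\<lambda>\<zeta>. (F \<zeta> - F 0) $ k) holomorphic_on ball 0 R"
        using hol[of k] by (auto intro!: holomorphic_intros)
      show "cmod ((F \<zeta> - F 0) $ k) < M" if "cmod \<zeta> < R" for \<zeta>
        using bd[OF that] Finite_Cartesian_Product.norm_nth_le[of "F \<zeta> - F 0" k] by linarith
    qed (use assms in auto)
    then show ?thesis .
  qed
  then have "(\<Sum>k\<in>UNIV. cmod ((F \<zeta> - F 0) $ k)) \<le> (\<Sum>k\<in>(UNIV::'n set). M * cmod \<zeta> / R)"
    by (intro sum_mono)
  moreover have "norm (F \<zeta> - F 0) \<le> (\<Sum>k\<in>UNIV. cmod ((F \<zeta> - F 0) $ k))"
    unfolding norm_vec_def by (rule L2_set_le_sum) auto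
  ultimately show ?thesis by simp
qed

section \<open>The Poincare distance and the reparametrisation of discs\<close>

lemma artanh_nonneg: "0 \<le> x \<Longrightarrow> x < 1 \<Longrightarrow> 0 \<le> artanh (x::real)"
  by (simp add: artanh_def)

lemma tanh_artanh_real: 
  assumes "-1 < x" "x < (1::real)" shows "tanh (artanh x) = x"
proof -
  have "exp (-2 * artanh x) = inverse (exp (ln ((1 + x) / (1 - x))))"
    by (simp add: artanh_def flip: exp_minus)
  also have "\<dots> = (1 - x) / (1 + x)" using assms by (simp add: exp_ln divide_simps)
  finally have e: "exp (-2 * artanh x) = (1 - x) / (1 + x)" .
  show ?thesis unfolding tanh_real_altdef e using assms by (simp add: divide_simps)
qed

lemma artanh_ge_self:
  assumes "0 \<le> x" "x < (1::real)" shows "x \<le> artanh x"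
proof -
  have "tanh y \<le> y" if "0 \<le> y" for y :: real
  proof -
    have "(\<lambda>y::real. y - tanh y) 0 \<le> (\<lambda>y. y - tanh y) y"
      by (rule deriv_nonneg_imp_mono[where g' = "\<lambda>y. (tanh y)\<^sup>2" and g = "\<lambda>y. y - tanh y"])
         (use that in \<open>auto intro!: derivative_eq_intros\<close>)
    then show ?thesis by simp
  qed
  from this[OF artanh_nonneg[OF assms]] show ?thesis using tanh_artanh_real assms by simp
qed

lemma poincare_dist_Moebius: "poincare_dist a b = artanh (cmod (Moebius_function 0 a b))"
proof -
  have "cmod (1 - cnj b * a) = cmod (cnj (1 - cnj b * a))" by (rule complex_mod_cnj[symmetric])
  also have "cnj (1 - cnj b * a) = 1 - cnj a * b" by simp
  finally show ?thesis
    by (simp add: poincare_dist_def Moebius_function_def norm_divide norm_minus_commute)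
qed

lemma poincare_dist_commute: "poincare_dist a b = poincare_dist b a"
  unfolding poincare_dist_Moebius[of a] by (simp add: poincare_dist_def Moebius_function_def)

lemma poincare_dist_nonneg: "cmod a < 1 \<Longrightarrow> cmod b < 1 \<Longrightarrow> 0 \<le> poincare_dist a b"
  unfolding poincare_dist_Moebius by (intro artanh_nonneg Moebius_function_norm_lt_1) auto

lemma poincare_dist_self [simp]: "poincare_dist a a = 0"
  by (simp add: poincare_dist_def)

lemma holo_disc_compose:
  assumes "holo_disc D f" "\<phi> holomorphic_on ball 0 1" "\<phi> ` ball 0 1 \<subseteq> ball 0 1"
  shows "holo_disc D (\<lambda>x. f (\<phi> x))"
proof -
  have "(\<lambda>\<zeta>. f (\<phi> \<zeta>) $ k) holomorphic_on ball 0 1" for k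
    using holomorphic_on_compose_gen[OF assms(2), of "\<lambda>\<zeta>. f \<zeta> $ k"] assms
    by (auto simp: holo_disc_def o_def)
  then show ?thesis using assms unfolding holo_disc_def by blast
qed

text \<open>A Moebius map carries the first parameter to 0 and a rotation carries the second to a
  nonnegative real, both without changing the Poincare distance. Every link of a chain thereby takes
  the form to which Schwarz estimates at 0 apply.\<close>

lemma holo_disc_normalize:
  assumes f: "holo_disc D f" and a: "cmod a < 1" and b: "cmod b < 1"
  obtains F where "holo_disc D F" "F 0 = f a" "F (of_real (cmod (Moebius_function 0 a b))) = f b"
proof -
  define c where "c = Moebius_function 0 a b"
  \<comment> \<open>For \<open>c = 0\<close> the quotient would be 0 and not a rotation, hence the
    value 1.\<close>
  define u where "u = (if c = 0 then 1 else c / of_real (cmod c))"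
  have u: "cmod u = 1" "u * of_real (cmod c) = c" by (auto simp: u_def norm_divide)
  have M: "Moebius_function 0 (-a) holomorphic_on ball 0 1"
    using Moebius_function_holomorphic a by simp
  have im: "(\<lambda>x. u * x) ` ball 0 1 \<subseteq> ball 0 1" using u by (auto simp: norm_mult)
  have 1: "(\<lambda>x. Moebius_function 0 (-a) (u * x)) holomorphic_on ball 0 1"
    using holomorphic_on_compose_gen[OF _ M im] by (auto simp: o_def intro!: holomorphic_intros)
  have 2: "(\<lambda>x. Moebius_function 0 (-a) (u * x)) ` ball 0 1 \<subseteq> ball 0 1"
    using u a by (auto intro!: Moebius_function_norm_lt_1 simp: norm_mult)
  show ?thesis
  proof
    show "holo_disc D (\<lambda>x. f (Moebius_function 0 (-a) (u * x)))"
      by (rule holo_disc_compose[OF f 1 2])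
    show "f (Moebius_function 0 (-a) (u * 0)) = f a" by (simp add: Moebius_function_of_zero)
    show "f (Moebius_function 0 (-a) (u * of_real (cmod (Moebius_function 0 a b)))) = f b"
      using u(2) a b by (simp add: c_def[symmetric]) (simp add: c_def Moebius_function_compose)
  qed
qed

text \<open>An inductive form of \<open>kobayashi_chain\<close> that carries the length
  \<open>d\<close> along. Concatenation and reversal of chains become rule inductions instead of
  index manipulations on lists.\<close>

inductive kreach :: "(complex ^ 'n) set \<Rightarrow> complex ^ 'n \<Rightarrow> complex ^ 'n \<Rightarrow> real \<Rightarrow> bool" for D where
  single: "holo_disc D f \<Longrightarrow> cmod a < 1 \<Longrightarrow> cmod b < 1 \<Longrightarrow> kreach D (f a) (f b) (poincare_dist a b)"
| cons: "holo_disc D f \<Longrightarrow> cmod a < 1 \<Longrightarrow> cmod b < 1 \<Longrightarrow> kreach D (f b) w d \<Longrightarrow>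
    kreach D (f a) w (poincare_dist a b + d)"

lemma kobayashi_chain_Cons:
  "kobayashi_chain D z w ((f, a, b) # cs) \<longleftrightarrow>
     holo_disc D f \<and> cmod a < 1 \<and> cmod b < 1 \<and> f a = z \<and>
     (if cs = [] then f b = w else kobayashi_chain D (f b) w cs)"
proof (cases cs)
  case Nil then show ?thesis by (auto simp: kobayashi_chain_def)
next
  case (Cons c cs')
  have all: "(\<forall>i. P i) \<longleftrightarrow> P 0 \<and> (\<forall>i. P (Suc i))" for P :: "nat \<Rightarrow> bool"
    by (metis not0_implies_Suc)
  show ?thesis unfolding kobayashi_chain_def Cons
    by (subst all) (auto simp: split_beta)
qed

lemma kobayashi_dist_eq: "kobayashi_dist D z w = Inf {d. kreach D z w d}"
proof -
  have 1: "kreach D z w (\<Sum>(f, a, b) \<leftarrow> cs. poincare_dist a b)" if "kobayashi_chain D z w cs" for cs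
    using that
  proof (induction cs arbitrary: z)
    case Nil then show ?case by (simp add: kobayashi_chain_def)
  next
    case (Cons c cs)
    obtain f a b where c: "c = (f, a, b)" by (cases c)
    show ?case
    proof (cases "cs = []")
      case True
      then show ?thesis using Cons.prems kreach.single[of D f a b]
        by (auto simp: c kobayashi_chain_Cons)
    next
      case False
      then show ?thesis using Cons.prems Cons.IH[of "f b"] kreach.cons[of D f a b w]
        by (auto simp: c kobayashi_chain_Cons)
    qed
  qed
  have 2: "\<exists>cs. kobayashi_chain D z w cs \<and> d = (\<Sum>(f, a, b) \<leftarrow> cs. poincare_dist a b)"
    if "kreach D z w d" for d
    using that
  proof induction
    case (single f a b)
    then show ?case by (intro exI[of _ "[(f, a, b)]"]) (simp add: kobayashi_chain_Cons)
  next
    case (cons f a b w d)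
    then obtain cs where cs: "kobayashi_chain D (f b) w cs"
      "d = (\<Sum>(f, a, b) \<leftarrow> cs. poincare_dist a b)" by blast
    then have "cs \<noteq> []" by (auto simp: kobayashi_chain_def)
    then show ?case using cons cs
      by (intro exI[of _ "(f, a, b) # cs"]) (simp add: kobayashi_chain_Cons)
  qed
  have "{(\<Sum>(f, a, b) \<leftarrow> cs. poincare_dist a b) | cs. kobayashi_chain D z w cs} = {d. kreach D z w d}"
    using 1 2 by blast
  then show ?thesis by (simp add: kobayashi_dist_def)
qed

lemma kreach_nonneg: "kreach D z w d \<Longrightarrow> 0 \<le> d"
  by (induction rule: kreach.induct) (auto simp: poincare_dist_nonneg add_nonneg_nonneg)

lemma kreach_trans: "kreach D x y d \<Longrightarrow> kreach D y w e \<Longrightarrow> kreach D x w (d + e)"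
proof (induction rule: kreach.induct)
  case (single f a b) then show ?case by (rule kreach.cons)
next
  case (cons f a b w d) then show ?case using kreach.cons[of D f a b] by (simp add: add.assoc)
qed

lemma kreach_sym: "kreach D x y d \<Longrightarrow> kreach D y x d"
proof (induction rule: kreach.induct)
  case (single f a b) then show ?case using kreach.single[of D f b a]
    by (simp add: poincare_dist_commute)
next
  case (cons f a b w d)
  then have "kreach D (f b) (f a) (poincare_dist a b)" using kreach.single[of D f b a]
    by (simp add: poincare_dist_commute)
  then show ?case using kreach_trans cons by (metis add.commute)
qed

lemma kobayashi_dist_le: "kreach D x y d \<Longrightarrow> kobayashi_dist D x y \<le> d"
  unfolding kobayashi_dist_eq using kreach_nonneg
  by (intro cInf_lower) (auto intro!: bdd_belowI[of _ 0])

lemma kobayashi_dist_commute: "kobayashi_dist D x y = kobayashi_dist D y x"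
proof -
  have "{d. kreach D x y d} = {d. kreach D y x d}" using kreach_sym by blast
  then show ?thesis by (simp add: kobayashi_dist_eq)
qed

lemma kreach_refl: "x \<in> D \<Longrightarrow> kreach D x x 0"
  using kreach.single[of D "\<lambda>_. x" 0 0] by (auto simp: holo_disc_def)

lemma linear_disc:
  assumes "\<And>\<zeta>. cmod \<zeta> < 1 \<Longrightarrow> x + \<zeta> *s v \<in> D" "0 \<le> t" "t < 1"
  shows "kreach D x (x + of_real t *s v) (artanh t)"
proof -
  have "holo_disc D (\<lambda>\<zeta>. x + \<zeta> *s v)"
    using assms by (auto simp: holo_disc_def vector_scalar_mult_def intro!: holomorphic_intros)
  from kreach.single[OF this, of 0 "of_real t"] show ?thesis using assms
    by (simp add: poincare_dist_Moebius Moebius_function_def)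
qed

lemma norm_vector_scalar_mult_complex: "norm (c *s (v :: complex ^ 'n)) = cmod c * norm v"
  by (simp add: norm_vec_def vector_scalar_mult_def norm_mult L2_set_right_distrib)

lemma kreach_ball:
  assumes "ball x e \<subseteq> D" "norm (y - x) \<le> t * e" "0 < e" "0 < t" "t < 1"
  shows "kreach D x y (artanh t)"
proof -
  define v where "v = of_real (1 / t) *s (y - x)"
  have v: "norm v \<le> e" using assms unfolding v_def norm_vector_scalar_mult_complex
    by (simp add: field_simps norm_divide)
  have "x + \<zeta> *s v \<in> D" if "cmod \<zeta> < 1" for \<zeta>
  proof -
    have "cmod \<zeta> * norm v \<le> cmod \<zeta> * e" using v by (intro mult_left_mono) auto
    also have "\<dots> < 1 * e" using that assms by (intro mult_strict_right_mono) auto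
    finally have "norm (\<zeta> *s v) < e" unfolding norm_vector_scalar_mult_complex by simp
    then show ?thesis using assms(1) by (auto simp: dist_norm)
  qed
  from linear_disc[OF this] assms have "kreach D x (x + of_real t *s v) (artanh t)" by simp
  also have "x + of_real t *s v = y" using assms by (simp add: v_def vec_eq_iff)
  finally show ?thesis .
qed

text \<open>Being joined by a chain is an equivalence relation with open classes, and
  \<open>D\<close> is connected. This makes the set under the infimum in
  \<open>kobayashi_dist\<close> nonempty, so that the infimum is meaningful and can be
  approximated.\<close>

lemma kreach_exists:
  assumes "open D" "connected D" "x \<in> D" "y \<in> D"
  shows "\<exists>d. kreach D x y d"
proof (rule connected_equivalence_relation[OF \<open>connected D\<close> \<open>x \<in> D\<close> \<open>y \<in> D\<close>])
  show "\<exists>d. kreach D y x d" if "\<exists>d. kreach D x y d" for x y using that kreach_sym by blast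
  show "\<exists>d. kreach D x z d" if "\<exists>d. kreach D x y d" "\<exists>d. kreach D y z d" for x y z
    using that kreach_trans by blast
  show "\<exists>T. openin (top_of_set D) T \<and> a \<in> T \<and> (\<forall>x\<in>T. \<exists>d. kreach D a x d)" if a: "a \<in> D" for a
  proof -
    obtain e where e: "e > 0" "ball a e \<subseteq> D" using \<open>open D\<close> a open_contains_ball by blast
    have "\<exists>d. kreach D a x d" if "x \<in> ball a (e / 2)" for x
      using kreach_ball[OF e(2), of x "1/2"] that e by (auto simp: dist_norm norm_minus_commute)
    moreover have "openin (top_of_set D) (ball a (e / 2))"
    proof -
      have "ball a (e / 2) \<subseteq> ball a e" using e by auto
      then show ?thesis using e \<open>open D\<close> by (simp add: openin_open_eq)
    qed
    ultimately show ?thesis using e by (intro exI[of _ "ball a (e / 2)"]) auto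
  qed
qed

lemma kobayashi_dist_lessD:
  assumes "open D" "connected D" "x \<in> D" "y \<in> D" "kobayashi_dist D x y < R"
  obtains d where "kreach D x y d" "d < R"
proof -
  have "{d. kreach D x y d} \<noteq> {}" using kreach_exists assms by blast
  then obtain d where "d \<in> {d. kreach D x y d}" "d < R"
    using cInf_lessD[of "{d. kreach D x y d}" R] assms(5) unfolding kobayashi_dist_eq by blast
  then show ?thesis using that by simp
qed

lemma kobayashi_dist_nonneg:
  assumes "open D" "connected D" "x \<in> D" "y \<in> D"
  shows "0 \<le> kobayashi_dist D x y"
  unfolding kobayashi_dist_eq using kreach_exists[OF assms] kreach_nonneg
  by (intro cInf_greatest) auto

lemma kobayashi_dist_triangle:
  assumes "open D" "connected D" "x \<in> D" "y \<in> D" "w \<in> D"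
  shows "kobayashi_dist D x w \<le> kobayashi_dist D x y + kobayashi_dist D y w"
proof (rule field_le_epsilon)
  fix e :: real assume "e > 0"
  obtain d1 where d1: "kreach D x y d1" "d1 < kobayashi_dist D x y + e / 2"
    using kobayashi_dist_lessD[OF assms(1,2,3,4)] \<open>e > 0\<close> by (metis half_gt_zero less_add_same_cancel1)
  obtain d2 where d2: "kreach D y w d2" "d2 < kobayashi_dist D y w + e / 2"
    using kobayashi_dist_lessD[OF assms(1,2,4,5)] \<open>e > 0\<close> by (metis half_gt_zero less_add_same_cancel1)
  show "kobayashi_dist D x w \<le> kobayashi_dist D x y + kobayashi_dist D y w + e"
    using kobayashi_dist_le[OF kreach_trans[OF d1(1) d2(1)]] d1 d2 by linarith
qed

text \<open>Around a point of the ball a small affine disc costs less than the remaining radius.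
  Openness gives Borel measurability and makes the volume lemmas for open sets applicable.\<close>

lemma open_kobayashi_ball:
  assumes "open D" "connected D" "x \<in> D"
  shows "open {y\<in>D. kobayashi_dist D x y < R}"
  unfolding open_contains_ball
proof
  fix y assume y: "y \<in> {y\<in>D. kobayashi_dist D x y < R}"
  obtain e where e: "e > 0" "ball y e \<subseteq> D" using \<open>open D\<close> y open_contains_ball by blast
  define c where "c = R - kobayashi_dist D x y"
  have c: "c > 0" using y by (simp add: c_def)
  define t where "t = tanh (c / 2)"
  have t: "0 < t" "t < 1" "artanh t < c" using c by (auto simp: t_def artanh_tanh_real tanh_real_lt_1)
  have "y' \<in> {y\<in>D. kobayashi_dist D x y < R}" if "y' \<in> ball y (t * e)" for y'
  proof -
    have "t * e \<le> e" using t e by simp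
    then have "y' \<in> ball y e" using that by simp
    then have D: "y' \<in> D" using e by blast
    have "kreach D y y' (artanh t)"
      by (rule kreach_ball[OF e(2)]) (use that t e in \<open>auto simp: dist_norm norm_minus_commute\<close>)
    from kobayashi_dist_le[OF this] kobayashi_dist_triangle[OF assms, of y y'] y D t
    show ?thesis by (simp add: c_def)
  qed
  then show "\<exists>e>0. ball y e \<subseteq> {y\<in>D. kobayashi_dist D x y < R}"
    using t e by (intro exI[of _ "t * e"]) auto
qed

text \<open>Chains of normalised links, each from parameter 0 to a real \<open>t\<close> with
  \<open>artanh t \<le> s\<close>, hence also \<open>t \<le> s\<close>. Links are appended at the
  far end, so the base point \<open>x\<close> stays fixed in an induction, as estimates relative to
  \<open>x\<close> require.\<close>

inductive kpath :: "(complex ^ 'n) set \<Rightarrow> real \<Rightarrow> complex ^ 'n \<Rightarrow> complex ^ 'n \<Rightarrow> real \<Rightarrow> bool"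
  for D s x where
  refl: "x \<in> D \<Longrightarrow> kpath D s x x 0"
| step: "kpath D s x (f 0) d \<Longrightarrow> holo_disc D f \<Longrightarrow> 0 \<le> t \<Longrightarrow> t < 1 \<Longrightarrow> artanh t \<le> s \<Longrightarrow>
    kpath D s x (f (of_real t)) (d + artanh t)"

lemma kpath_nonneg: "kpath D s x y d \<Longrightarrow> 0 \<le> d"
  by (induction rule: kpath.induct) (auto simp: artanh_nonneg add_nonneg_nonneg)

lemma kpath_in: "kpath D s x y d \<Longrightarrow> x \<in> D \<and> y \<in> D"
  by (induction rule: kpath.induct) (auto simp: holo_disc_def image_subset_iff)

lemma kpath_trans: "kpath D s y w e \<Longrightarrow> kpath D s x y d \<Longrightarrow> kpath D s x w (d + e)"
proof (induction rule: kpath.induct)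
  case refl then show ?case by simp
next
  case (step f e t)
  then show ?case using kpath.step[of D s x f "d + e" t] by (simp add: add.assoc)
qed

text \<open>The radius from 0 to \<open>t\<close> is a Poincare geodesic: cut into \<open>N\<close>
  pieces of equal length \<open>e\<close>, it keeps its total length. The k-th cut is at parameter
  \<open>tanh (k * e)\<close>.\<close>

lemma kpath_disc:
  assumes f: "holo_disc D f" and t: "0 \<le> t" "t < 1" and s: "s > 0"
  shows "kpath D s (f 0) (f (of_real t)) (artanh t)"
proof -
  define d where "d = artanh t"
  have d: "d \<ge> 0" using t by (simp add: d_def artanh_nonneg)
  obtain N :: nat where N: "real N > d / s" using reals_Archimedean2 by blast
  have "d / s \<ge> 0" using d s by simp
  then have N0: "N > 0" using N by (cases N) auto
  define e where "e = d / real N"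
  have e: "e \<ge> 0" "e \<le> s" using N N0 d s by (auto simp: e_def field_simps)
  have "kpath D s (f 0) (f (of_real (tanh (real k * e)))) (real k * e)" for k
  proof (induction k)
    case 0
    have "f 0 \<in> D" using f by (auto simp: holo_disc_def)
    then show ?case by (simp add: kpath.refl)
  next
    case (Suc k)
    define a where "a = tanh (real k * e)"
    have a: "\<bar>a\<bar> < 1" "0 \<le> a" using e tanh_real_lt_1[of "real k * e"] by (auto simp: a_def)
    define \<phi> where "\<phi> = Moebius_function 0 (- of_real a)"
    have F: "holo_disc D (\<lambda>x. f (\<phi> x))"
      unfolding \<phi>_def using a
      by (intro holo_disc_compose[OF f] Moebius_function_holomorphic) (auto intro!: Moebius_function_norm_lt_1)
    have "\<phi> 0 = of_real a" by (simp add: \<phi>_def Moebius_function_of_zero)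
    \<comment> \<open>The addition theorem of \<open>tanh\<close> is the action of a Moebius
      translation on the real axis.\<close>
    moreover have "\<phi> (of_real (tanh e)) = of_real (tanh (real (Suc k) * e))"
    proof -
      have "tanh (real (Suc k) * e) = tanh (e + real k * e)" by (simp add: algebra_simps)
      also have "\<dots> = (tanh e + a) / (1 + tanh e * a)" unfolding a_def
        by (subst tanh_add) (auto simp: cosh_real_nonzero)
      finally show ?thesis by (simp add: \<phi>_def Moebius_function_def mult.commute)
    qed
    ultimately show ?case using kpath.step[OF _ F, of s "f 0" "real k * e" "tanh e"] Suc e
      by (simp add: a_def artanh_tanh_real tanh_real_lt_1 algebra_simps)
  qed
  from this[of N] show ?thesis using N0 t by (simp add: e_def d_def tanh_artanh_real)
qed

lemma kreach_imp_kpath: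
  assumes "kreach D x y d" "s > 0" shows "kpath D s x y d"
  using assms(1)
proof induction
  case (single f a b)
  obtain F where "holo_disc D F" "F 0 = f a" "F (of_real (cmod (Moebius_function 0 a b))) = f b"
    using holo_disc_normalize single by blast
  then show ?case unfolding poincare_dist_Moebius
    using kpath_disc[of D F "cmod (Moebius_function 0 a b)"] single Moebius_function_norm_lt_1 assms(2)
    by auto
next
  case (cons f a b w d)
  obtain F where "holo_disc D F" "F 0 = f a" "F (of_real (cmod (Moebius_function 0 a b))) = f b"
    using holo_disc_normalize cons by blast
  then have "kpath D s (f a) (f b) (poincare_dist a b)" unfolding poincare_dist_Moebius
    using kpath_disc[of D F "cmod (Moebius_function 0 a b)"] cons Moebius_function_norm_lt_1 assms(2)
    by auto
  then show ?case using kpath_trans cons by blast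
qed

subsection \<open>Volumes of slabs\<close>

text \<open>All volume bounds come from disjoint or covering translates, which avoids changes of
  variables on \<open>complex ^ 'n\<close>.\<close>

lemma measure_disjoint_translates:
  fixes E B :: "'a::euclidean_space set"
  assumes "finite J" "open E" "bounded E" "open B" "bounded B"
    and sub: "\<And>j x. j \<in> J \<Longrightarrow> x \<in> E \<Longrightarrow> p j + x \<in> B"
    and disj: "\<And>i j x y. i \<in> J \<Longrightarrow> j \<in> J \<Longrightarrow> i \<noteq> j \<Longrightarrow> x \<in> E \<Longrightarrow> y \<in> E \<Longrightarrow> p i + x \<noteq> p j + y"
  shows "real (card J) * measure lborel E \<le> measure lborel B"
proof -
  have E: "E \<in> lmeasurable" and B: "B \<in> lmeasurable" using assms by (auto intro: lmeasurable_open)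
  have "real (card J) * measure lebesgue E = (\<Sum>j\<in>J. measure lebesgue ((+) (p j) ` E))"
    by (simp add: measure_translation)
  also have "\<dots> = measure lebesgue (\<Union>j\<in>J. (+) (p j) ` E)"
    by (rule measure_UNION_AE[symmetric, OF \<open>finite J\<close>])
       (use disj E in \<open>auto simp: pairwise_def measurable_translation disjnt_def intro!: AE_I2\<close>)
  also have "\<dots> \<le> measure lebesgue B"
    by (rule measure_mono_fmeasurable) 
      (use sub E B \<open>finite J\<close> in \<open>auto intro!: fmeasurableD sets.finite_UN measurable_translation\<close>)
  finally show ?thesis using assms by (simp add: measure_completion)
qed

lemma measure_covering_translates:
  fixes E B :: "'a::euclidean_space set"
  assumes "finite J" "open E" "bounded E" "open B"
    and cov: "\<And>x. x \<in> B \<Longrightarrow> \<exists>j\<in>J. \<exists>y\<in>E. x = p j + y"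
  shows "measure lborel B \<le> real (card J) * measure lborel E"
proof -
  have E: "E \<in> lmeasurable" using assms by (auto intro: lmeasurable_open)
  have "measure lebesgue B \<le> measure lebesgue (\<Union>j\<in>J. (+) (p j) ` E)"
    by (rule measure_mono_fmeasurable)
      (use cov E \<open>open B\<close> \<open>finite J\<close> in \<open>auto simp: image_iff intro!: fmeasurable.finite_UN measurable_translation fmeasurableI2\<close>)
  also have "\<dots> \<le> (\<Sum>j\<in>J. measure lebesgue ((+) (p j) ` E))"
    by (rule measure_UNION_le) (use E \<open>finite J\<close> in \<open>auto intro!: fmeasurableD measurable_translation\<close>)
  also have "\<dots> = real (card J) * measure lebesgue E" by (simp add: measure_translation)
  finally show ?thesis using assms by (simp add: measure_completion)
qed

text \<open>Translate the slab by the lattice points \<tau> (m + i k) in the complex direction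
  \<open>u\<close>. The spacing \<tau> = 2 a / c separates the values of \<open>l\<close> on
  different translates, so these are disjoint. With 0 \<le> m, k \<le> b / \<tau> they lie in the
  ball of radius 2 b + b, and there are at least (b / \<tau>)^2 of them.\<close>

lemma slab_measure_upper:
  fixes l :: "complex ^ 'n \<Rightarrow> complex"
  assumes lin: "\<And>c v w. l (c *s w + v) = c * l w + l v" and cont: "continuous_on UNIV l"
    and u: "norm u = 1" "c \<le> cmod (l u)" and pos: "0 < c" "0 < a" "0 < b"
  shows "measure lborel {v. cmod (l v) < a \<and> norm v < b} * b\<^sup>2
         \<le> unit_ball_vol (real (2 * CARD('n))) * (3 * b) ^ (2 * CARD('n)) * (2 * a / c)\<^sup>2"
    (is "measure lborel ?E * _ \<le> ?V * _ * _")
proof -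
  define \<tau> where "\<tau> = 2 * a / c"
  have \<tau>: "\<tau> > 0" using pos by (simp add: \<tau>_def)
  define N where "N = nat \<lfloor>b / \<tau>\<rfloor>"
  have N: "real N \<le> b / \<tau>" "b / \<tau> \<le> real (N + 1)" using pos \<tau> real_of_int_floor_add_one_ge[of "b / \<tau>"] by (auto simp: N_def add.commute)
  define p where "p = (\<lambda>(m::nat, k::nat). (of_real \<tau> * Complex (real m) (real k)) *s u)"
  have op: "open ?E" using cont
    by (intro open_Collect_conj open_Collect_less) (auto intro!: continuous_intros)
  have "?E \<subseteq> ball 0 b" by auto
  then have bd: "bounded ?E" using bounded_ball bounded_subset by blast
  have "real (card ({..N} \<times> {..N})) * measure lborel ?E \<le> measure lborel (ball (0::complex^'n) (3 * b))"
  proof (rule measure_disjoint_translates[where p = p])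
    fix j x assume j: "j \<in> {..N} \<times> {..N}" and x: "x \<in> ?E"
    obtain m k where mk: "j = (m, k)" "m \<le> N" "k \<le> N" using j by auto
    have "cmod (Complex (real m) (real k)) \<le> \<bar>real m\<bar> + \<bar>real k\<bar>"
      using cmod_le[of "Complex (real m) (real k)"] by simp
    also have "\<dots> \<le> 2 * (b / \<tau>)" using mk N by simp
    finally have "norm (p j) \<le> \<tau> * (2 * (b / \<tau>))"
      using u \<tau> mult_left_mono[of _ "2 * (b / \<tau>)" \<tau>]
      by (simp only: p_def mk prod.case norm_vector_scalar_mult_complex norm_mult norm_of_real) simp
    then have "norm (p j) \<le> 2 * b" using \<tau> by simp
    then show "p j + x \<in> ball 0 (3 * b)" using x norm_triangle_ineq[of "p j" x] by auto
  next
    fix i j x y assume "i \<in> {..N} \<times> {..N}" "j \<in> {..N} \<times> {..N}" and ij: "i \<noteq> j" and x: "x \<in> ?E" and y: "y \<in> ?E"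
    obtain m k m' k' where mk: "i = (m, k)" "j = (m', k')" by (cases i, cases j)
    show "p i + x \<noteq> p j + y"
    proof
      assume "p i + x = p j + y"
      then have "l (p i + x) = l (p j + y)" by simp
      then have "l x - l y = of_real \<tau> * (Complex (real m') (real k') - Complex (real m) (real k)) * l u"
        unfolding p_def mk prod.case lin by (simp add: algebra_simps)
      then have eq: "cmod (l x - l y) = \<tau> * cmod (Complex (real m') (real k') - Complex (real m) (real k)) * cmod (l u)"
        using \<tau> by (simp add: norm_mult)
      have "1 \<le> cmod (Complex (real m') (real k') - Complex (real m) (real k))"
      proof (cases "m = m'")
        case False
        then have "1 \<le> \<bar>real m' - real m\<bar>" by linarith
        then show ?thesis using abs_Re_le_cmod[of "Complex (real m') (real k') - Complex (real m) (real k)"] by simp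
      next
        case True
        then have "1 \<le> \<bar>real k' - real k\<bar>" using ij mk by auto
        then show ?thesis using abs_Im_le_cmod[of "Complex (real m') (real k') - Complex (real m) (real k)"] by simp
      qed
      then have "\<tau> * 1 * c \<le> cmod (l x - l y)" unfolding eq using \<tau> u pos
        by (intro mult_mono) auto
      moreover have "\<tau> * c = 2 * a" using pos by (simp add: \<tau>_def)
      ultimately show False using x y norm_triangle_ineq4[of "l x" "l y"] by simp
    qed
  qed (use op bd in auto)
  then have 1: "(real (N + 1))\<^sup>2 * measure lborel ?E \<le> ?V * (3 * b) ^ (2 * CARD('n))"
  proof -
    have "real (card ({..N} \<times> {..N})) = (real (N + 1))\<^sup>2" by (simp add: power2_eq_square algebra_simps)
    moreover have "measure lborel (ball (0::complex^'n) (3 * b)) = ?V * (3 * b) ^ (2 * CARD('n))"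
      using pos content_ball[of "3 * b" "0::complex^'n"] by (simp add: mult.commute)
    ultimately show ?thesis
      using \<open>real (card ({..N} \<times> {..N})) * measure lborel ?E \<le> _\<close> by (simp only:)
  qed
  have "(b / \<tau>)\<^sup>2 * measure lborel ?E \<le> (real (N + 1))\<^sup>2 * measure lborel ?E"
    using N pos \<tau> by (intro mult_right_mono power_mono) auto
  also note 1
  finally have "(b / \<tau>)\<^sup>2 * measure lborel ?E \<le> ?V * (3 * b) ^ (2 * CARD('n))" .
  then have "((b / \<tau>)\<^sup>2 * measure lborel ?E) * \<tau>\<^sup>2 \<le> (?V * (3 * b) ^ (2 * CARD('n))) * \<tau>\<^sup>2"
    by (rule mult_right_mono) simp
  moreover have "((b / \<tau>)\<^sup>2 * measure lborel ?E) * \<tau>\<^sup>2 = measure lborel ?E * b\<^sup>2"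
    using \<tau> by (simp add: field_simps)
  ultimately show ?thesis by (simp only: \<tau>_def)
qed

text \<open>Dually to the packing for the upper bound, a ball of radius \<open>\<beta>\<close>
  proportional to \<open>b\<close> is covered by O((M b / a)^2) lattice translates of the slab along
  \<open>u\<close>: subtracting the lattice point next to \<open>l x / l u\<close> brings
  \<open>l\<close> below \<open>a\<close>.\<close>

lemma slab_measure_lower:
  fixes l :: "complex ^ 'n \<Rightarrow> complex"
  assumes lin: "\<And>c v w. l (c *s w + v) = c * l w + l v" and cont: "continuous_on UNIV l"
    and bd: "\<And>v. cmod (l v) \<le> M * norm v"
    and u: "norm u = 1" "c \<le> cmod (l u)" and pos: "0 < c" "0 < M" "0 < a" "0 < b" "a \<le> M * b"
  shows "unit_ball_vol (real (2 * CARD('n))) * (b / (3 * (1 + M / c))) ^ (2 * CARD('n)) * (a / (7 * M))\<^sup>2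
         \<le> measure lborel {v. cmod (l v) < a \<and> norm v < b} * b\<^sup>2"
    (is "?V * _ * _ \<le> measure lborel ?E * _")
proof -
  \<comment> \<open>Rounding both coordinates down costs less than 2 \<tau>, hence less than 2 M
    \<tau> < a in the value of \<open>l\<close>.\<close>
  define \<tau> where "\<tau> = a / (3 * M)"
  have \<tau>: "\<tau> > 0" "3 * \<tau> \<le> b" "3 * M * \<tau> = a" using pos by (auto simp: \<tau>_def field_simps)
  \<comment> \<open>Then \<open>\<beta> + M * \<beta> / c\<close> equals b / 3, which leaves room
    for the rounding error 2 \<tau> \<le> 2 b / 3 inside radius \<open>b\<close>.\<close>
  define \<beta> where "\<beta> = b / (3 * (1 + M / c))"
  have \<beta>0: "\<beta> > 0" using pos by (auto simp: \<beta>_def intro!: divide_pos_pos add_pos_pos)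
  have "1 + M / c > 0" using pos by (simp add: add_pos_pos)
  then have "3 * (\<beta> * (1 + M / c)) = b"
  proof -
    have "3 * (b / (3 * x) * x) = b" if "x > 0" for x using that by simp
    then show ?thesis unfolding \<beta>_def using \<open>1 + M / c > 0\<close> by blast
  qed
  then have \<beta>: "3 * \<beta> + 3 * (M * \<beta> / c) = b" by (simp add: algebra_simps)
  define N where "N = \<lceil>M * \<beta> / (c * \<tau>) + 1\<rceil>"
  have Mb: "M * \<beta> / (c * \<tau>) \<le> M * b / a"
  proof -
    have "M * \<beta> / c \<le> b / 3" using \<beta> \<beta>0 by linarith
    then have "M * \<beta> / c / \<tau> \<le> b / 3 / \<tau>" using \<tau> by (intro divide_right_mono) auto
    also have "\<dots> = M * b / a" using pos by (simp add: \<tau>_def field_simps)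
    finally show ?thesis by simp
  qed
  have N0: "M * \<beta> / (c * \<tau>) + 1 \<le> of_int N" "of_int N \<le> M * b / a + 2"
    unfolding N_def using Mb by linarith+
  have "0 \<le> M * \<beta> / (c * \<tau>)" using pos \<beta>0 \<tau> by simp
  then have Np: "N \<ge> 0" using N0 by linarith
  have Mba: "1 \<le> M * b / a" using pos by simp
  define p where "p = (\<lambda>(m::int, k::int). (of_real \<tau> * Complex (of_int m) (of_int k)) *s u)"
  have op: "open ?E" using cont
    by (intro open_Collect_conj open_Collect_less) (auto intro!: continuous_intros)
  have "?E \<subseteq> ball 0 b" by auto
  then have bE: "bounded ?E" using bounded_ball bounded_subset by blast
  have lu0: "l u \<noteq> 0" using u pos by auto
  have "measure lborel (ball (0::complex^'n) \<beta>) \<le> real (card ({-N..N} \<times> {-N..N})) * measure lborel ?E"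
  proof (rule measure_covering_translates[where p = p])
    fix x :: "complex ^ 'n" assume "x \<in> ball 0 \<beta>"
    then have x: "norm x < \<beta>" by simp
    define \<xi> where "\<xi> = l x / l u"
    have "cmod \<xi> \<le> M * norm x / c" unfolding \<xi>_def norm_divide
      using bd[of x] u pos by (intro frac_le) auto
    also have "\<dots> \<le> M * \<beta> / c" using x pos by (intro divide_right_mono mult_left_mono) auto
    finally have \<xi>: "cmod \<xi> \<le> M * \<beta> / c" .
    define m where "m = \<lfloor>Re \<xi> / \<tau>\<rfloor>"
    define k where "k = \<lfloor>Im \<xi> / \<tau>\<rfloor>"
    define \<omega> where "\<omega> = of_real \<tau> * Complex (of_int m) (of_int k)"
    have "\<bar>Re \<xi> / \<tau>\<bar> \<le> M * \<beta> / (c * \<tau>)" "\<bar>Im \<xi> / \<tau>\<bar> \<le> M * \<beta> / (c * \<tau>)"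
      using \<xi> abs_Re_le_cmod[of \<xi>] abs_Im_le_cmod[of \<xi>] \<tau>
        divide_right_mono[of "\<bar>Re \<xi>\<bar>" "M * \<beta> / c" \<tau>] divide_right_mono[of "\<bar>Im \<xi>\<bar>" "M * \<beta> / c" \<tau>]
      by auto
    then have "\<bar>of_int m\<bar> \<le> (of_int N :: real)" "\<bar>of_int k\<bar> \<le> (of_int N :: real)"
      using N0 unfolding m_def k_def by linarith+
    then have mk: "(m, k) \<in> {-N..N} \<times> {-N..N}" by auto
    have fr: "\<bar>r - \<tau> * of_int \<lfloor>r / \<tau>\<rfloor>\<bar> < \<tau>" for r
    proof -
      have "r / \<tau> - of_int \<lfloor>r / \<tau>\<rfloor> < 1" "0 \<le> r / \<tau> - of_int \<lfloor>r / \<tau>\<rfloor>" by linarith+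
      then have "\<tau> * (r / \<tau> - of_int \<lfloor>r / \<tau>\<rfloor>) < \<tau> * 1" "0 \<le> \<tau> * (r / \<tau> - of_int \<lfloor>r / \<tau>\<rfloor>)"
        using \<tau> by (auto intro!: mult_strict_left_mono)
      then show ?thesis using \<tau> by (simp add: right_diff_distrib)
    qed
    have "cmod (\<xi> - \<omega>) \<le> \<bar>Re (\<xi> - \<omega>)\<bar> + \<bar>Im (\<xi> - \<omega>)\<bar>" by (rule cmod_le)
    also have "\<dots> < 2 * \<tau>" using fr[of "Re \<xi>"] fr[of "Im \<xi>"] by (simp add: \<omega>_def m_def k_def)
    finally have d: "cmod (\<xi> - \<omega>) < 2 * \<tau>" .
    define y where "y = (- \<omega>) *s u + x"
    have xy: "x = p (m, k) + y" by (simp add: p_def y_def \<omega>_def vec_eq_iff)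
    have "l y = (\<xi> - \<omega>) * l u" unfolding y_def lin using lu0 by (simp add: \<xi>_def algebra_simps)
    then have "cmod (l y) = cmod (\<xi> - \<omega>) * cmod (l u)" by (simp add: norm_mult)
    also have "\<dots> \<le> cmod (\<xi> - \<omega>) * M" using bd[of u] u by (intro mult_left_mono) auto
    also have "\<dots> \<le> 2 * \<tau> * M" using d pos by (intro mult_right_mono) auto
    also have "\<dots> < 3 * M * \<tau>" using \<tau>(1) pos by simp
    also note \<tau>(3)
    finally have ly: "cmod (l y) < a" .
    have "norm y \<le> cmod \<omega> + norm x" unfolding y_def
      using norm_triangle_ineq[of "(- \<omega>) *s u" x] u by (simp add: norm_vector_scalar_mult_complex)
    moreover have "cmod \<omega> \<le> cmod \<xi> + cmod (\<xi> - \<omega>)"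
      by (metis norm_triangle_sub norm_minus_commute)
    moreover have "\<beta> + M * \<beta> / c + 2 * \<tau> \<le> b" using \<beta> \<tau> by linarith
    ultimately have "norm y < b" using \<xi> d x by linarith
    then show "\<exists>j\<in>{-N..N} \<times> {-N..N}. \<exists>y\<in>?E. x = p j + y" using mk xy ly by blast
  qed (use op bE in auto)
  moreover have "real (card ({-N..N} \<times> {-N..N})) = (2 * of_int N + 1)\<^sup>2"
    using Np by (simp add: power2_eq_square)
  \<comment> \<open>As M b / a is at least 1, 2 N + 1 \<le> 2 (M b / a + 2) + 1 is at most 7 M b /
    a.\<close>
  moreover have "(2 * of_int N + 1)\<^sup>2 * measure lborel ?E \<le> (7 * M * b / a)\<^sup>2 * measure lborel ?E"
    using N0 Np Mba by (intro mult_right_mono power_mono) auto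
  ultimately have 1: "?V * \<beta> ^ (2 * CARD('n)) \<le> (7 * M * b / a)\<^sup>2 * measure lborel ?E"
    using \<beta>0 content_ball[of \<beta> "0::complex^'n"] by (simp add: mult.commute)
  have "?V * \<beta> ^ (2 * CARD('n)) * (a / (7 * M))\<^sup>2 \<le> (7 * M * b / a)\<^sup>2 * measure lborel ?E * (a / (7 * M))\<^sup>2"
    using 1 by (rule mult_right_mono) simp
  also have "\<dots> = measure lborel ?E * b\<^sup>2" using pos by (simp add: field_simps)
  finally show ?thesis by (simp add: \<beta>_def)
qed

subsection \<open>Defining functions\<close>

lemma imul_eq: "imul v = \<i> *s v"
  by (simp add: imul_def vec_eq_iff)

lemma norm_imul [simp]: "norm (imul v) = norm v"
  by (simp add: imul_eq norm_vector_scalar_mult_complex)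

lemma bounded_linear_imul: "bounded_linear (imul :: complex ^ 'n \<Rightarrow> complex ^ 'n)"
  by (rule bounded_linear_intro[where K = 1]) (auto simp: imul_def vec_eq_iff algebra_simps scaleR_conv_of_real norm_imul[unfolded imul_def])

lemmas imul_linear = linear_simps[OF bounded_linear_imul]

lemma scalar_mult_eq_imul: "c *s (w :: complex ^ 'n) = Re c *\<^sub>R w + Im c *\<^sub>R imul w"
proof -
  have "c * x = of_real (Re c) * x + of_real (Im c) * (\<i> * x)" for x
    by (subst (1) complex_eq[of c]) (simp only: distrib_right mult.assoc mult.left_commute)
  then show ?thesis unfolding vec_eq_iff by (simp add: imul_def scaleR_conv_of_real[where 'a = complex])
qed

lemma imul_imul [simp]: "imul (imul v) = - v"
  by (simp add: imul_def vec_eq_iff flip: mult.assoc)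

lemma complex_linear_expansion:
  fixes L :: "complex ^ 'n \<Rightarrow> complex"
  assumes lin: "\<And>c v w. L (c *s w + v) = c * L w + L v"
  shows "L v = (\<Sum>k\<in>UNIV. v $ k * L (axis k 1))"
proof -
  have L0: "L 0 = 0" using lin[of "-1" 0 0] by simp
  have "L (\<Sum>k\<in>S. v $ k *s axis k 1) = (\<Sum>k\<in>S. v $ k * L (axis k 1))" for S :: "'n set"
    by (induction S rule: infinite_finite_induct) (auto simp: L0 lin)
  then show ?thesis using basis_expansion[of v] by metis
qed

text \<open>Discs are holomorphic coordinate by coordinate, so \<open>L\<close> is expanded over the
  standard basis into a finite combination of the coordinates.\<close>

lemma holomorphic_complex_linear:
  fixes L :: "complex ^ 'n \<Rightarrow> complex" and F :: "complex \<Rightarrow> complex ^ 'n"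
  assumes "\<And>c v w. L (c *s w + v) = c * L w + L v" and "\<And>k. (\<lambda>\<zeta>. F \<zeta> $ k) holomorphic_on S"
  shows "(\<lambda>\<zeta>. L (F \<zeta>)) holomorphic_on S"
proof -
  have "(\<lambda>\<zeta>. L (F \<zeta>)) = (\<lambda>\<zeta>. \<Sum>k\<in>UNIV. F \<zeta> $ k * L (axis k 1))"
    by (rule ext, rule complex_linear_expansion, rule assms(1))
  then show ?thesis by (simp only:) (intro holomorphic_intros assms(2))
qed

lemma holomorphic_complex_bilinear:
  fixes b :: "complex ^ 'n \<Rightarrow> complex ^ 'n \<Rightarrow> complex" and F :: "complex \<Rightarrow> complex ^ 'n"
  assumes l: "\<And>c v w u. b (c *s w + v) u = c * b w u + b v u"
    and r: "\<And>c v w u. b u (c *s w + v) = c * b u w + b u v"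
    and F: "\<And>k. (\<lambda>\<zeta>. F \<zeta> $ k) holomorphic_on S"
  shows "(\<lambda>\<zeta>. b (F \<zeta>) (F \<zeta>)) holomorphic_on S"
proof -
  have "b (F \<zeta>) (F \<zeta>) = (\<Sum>k\<in>UNIV. F \<zeta> $ k * b (axis k 1) (F \<zeta>))" for \<zeta>
    by (rule complex_linear_expansion[of "\<lambda>v. b v (F \<zeta>)", OF l])
  then show ?thesis
    by (simp only:) (intro holomorphic_intros F holomorphic_complex_linear[OF r])
qed

locale spc =
  fixes D U :: "(complex ^ 'n) set" and r :: "complex ^ 'n \<Rightarrow> real"
    and Dr :: "complex ^ 'n \<Rightarrow> (complex ^ 'n) \<Rightarrow>\<^sub>L real"
    and D2r :: "complex ^ 'n \<Rightarrow> (complex ^ 'n) \<Rightarrow>\<^sub>L (complex ^ 'n) \<Rightarrow>\<^sub>L real"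
  assumes open_D: "open D" and connected_D: "connected D" and D_ne: "D \<noteq> {}" and bounded_D: "bounded D"
    and open_U: "open U" and cl_U: "closure D \<subseteq> U"
    and der1: "\<And>x. x \<in> U \<Longrightarrow> (r has_derivative blinfun_apply (Dr x)) (at x)"
    and der2: "\<And>x. x \<in> U \<Longrightarrow> (Dr has_derivative blinfun_apply (D2r x)) (at x)"
    and cont2: "continuous_on U D2r"
    and D_eq: "D = {x\<in>U. r x < 0}"
    and grad_nz: "\<And>p. p \<in> frontier D \<Longrightarrow> Dr p \<noteq> 0"
    and levi: "\<And>p w. p \<in> frontier D \<Longrightarrow> w \<noteq> 0 \<Longrightarrow> Dr p w = 0 \<Longrightarrow> Dr p (imul w) = 0 \<Longrightarrow>
                 D2r p w w + D2r p (imul w) (imul w) > 0"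
begin

text \<open>\<open>ell x\<close> and \<open>qf x\<close> are the complex linear functional and the complex bilinear form with
  \<open>Re (ell x v) = Dr x v\<close> and \<open>D2r x v v / 2 = Re (qf x v v) + L\<close>, where \<open>L\<close> is the Levi form.\<close>

definition ell :: "complex ^ 'n \<Rightarrow> complex ^ 'n \<Rightarrow> complex" where
  "ell x v = Complex (Dr x v) (- Dr x (imul v))"

definition qf :: "complex ^ 'n \<Rightarrow> complex ^ 'n \<Rightarrow> complex ^ 'n \<Rightarrow> complex" where
  "qf x v w = Complex ((D2r x v w - D2r x (imul v) (imul w)) / 4) (- (D2r x (imul v) w + D2r x v (imul w)) / 4)"

lemmas blinfun_linear = blinfun.add_right blinfun.scaleR_right blinfun.diff_right blinfun.minus_right
  blinfun.add_left blinfun.scaleR_left blinfun.diff_left blinfun.minus_left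

lemma ell_linear: "ell x (c *s w + v) = c * ell x w + ell x v"
  by (simp add: ell_def complex_eq_iff scalar_mult_eq_imul imul_linear blinfun_linear algebra_simps)

lemma qf_linear1: "qf x (c *s w + v) u = c * qf x w u + qf x v u"
  by (simp add: qf_def complex_eq_iff scalar_mult_eq_imul imul_linear blinfun_linear field_simps)

lemma qf_linear2: "qf x u (c *s w + v) = c * qf x u w + qf x u v"
  by (simp add: qf_def complex_eq_iff scalar_mult_eq_imul imul_linear blinfun_linear field_simps)

lemma ell_diff: "ell x (v - w) = ell x v - ell x w"
  using ell_linear[of x "-1" w v] by (simp add: vec_eq_iff)

lemma cmod_ell_sq: "(cmod (ell x v))\<^sup>2 = (Dr x v)\<^sup>2 + (Dr x (imul v))\<^sup>2"
  by (simp add: ell_def cmod_power2)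

lemma cmod_ell_le: "cmod (ell x v) \<le> 2 * norm (Dr x) * norm v"
  using cmod_le[of "ell x v"] norm_blinfun[of "Dr x" v] norm_blinfun[of "Dr x" "imul v"]
  by (simp add: ell_def)

lemma cmod_ell_diff_le: "cmod (ell x v - ell y v) \<le> 2 * norm (Dr x - Dr y) * norm v"
  using cmod_le[of "ell x v - ell y v"] norm_blinfun[of "Dr x - Dr y" v] norm_blinfun[of "Dr x - Dr y" "imul v"]
  by (simp add: ell_def blinfun_linear)

lemma D2r_le: "\<bar>D2r x v w\<bar> \<le> norm (D2r x) * norm v * norm w"
proof -
  have "\<bar>D2r x v w\<bar> \<le> norm (D2r x v) * norm w" using norm_blinfun[of "D2r x v" w] by simp
  also have "\<dots> \<le> norm (D2r x) * norm v * norm w" by (intro mult_right_mono norm_blinfun) auto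
  finally show ?thesis .
qed

lemma cmod_qf_le: "cmod (qf x v v) \<le> norm (D2r x) * (norm v)\<^sup>2"
proof -
  have "cmod (qf x v v) \<le> \<bar>(D2r x v v - D2r x (imul v) (imul v)) / 4\<bar> + \<bar>- (D2r x (imul v) v + D2r x v (imul v)) / 4\<bar>"
    unfolding qf_def by (rule order_trans[OF cmod_le]) simp
  then show ?thesis
    using D2r_le[of x v v] D2r_le[of x "imul v" "imul v"] D2r_le[of x "imul v" v] D2r_le[of x v "imul v"]
    by (simp add: power2_eq_square mult.assoc field_simps)
qed

lemma continuous_ell: "continuous_on UNIV (ell x)"
  unfolding ell_def Complex_eq
  by (intro continuous_intros continuous_on_of_real bounded_linear.continuous_on[OF bounded_linear_imul] 
      linear_continuous_on blinfun.bounded_linear_right)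

section \<open>Uniform bounds on the defining function by compactness\<close>

lemma cont_r: "continuous_on U r"
  by (meson continuous_at_imp_continuous_on der1 has_derivative_continuous)

lemma cont_Dr: "continuous_on U Dr"
  by (meson continuous_at_imp_continuous_on der2 has_derivative_continuous)

lemma compact_cl: "compact (closure D)"
  using bounded_D by (simp add: compact_closure)

lemma r_neg: "x \<in> D \<Longrightarrow> r x < 0"
  using D_eq by blast

lemma D_sub_cl: "x \<in> D \<Longrightarrow> x \<in> closure D"
  using closure_subset by blast

lemma frontier_sub_cl: "p \<in> frontier D \<Longrightarrow> p \<in> closure D"
  by (simp add: frontier_def)

lemma r_frontier: assumes "p \<in> frontier D" shows "r p = 0"
proof -
  have "p \<notin> D" "p \<in> closure D" using assms open_D by (auto simp: frontier_def interior_open)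
  then have ge: "r p \<ge> 0" using cl_U D_eq by force
  have "r p \<le> 0"
    by (rule continuous_le_on_closure[of D r p 0])
       (use cont_r cl_U r_neg \<open>p \<in> closure D\<close> in \<open>auto intro: continuous_on_subset less_imp_le\<close>)
  with ge show ?thesis by simp
qed

lemma cl_cases: "x \<in> closure D \<Longrightarrow> x \<in> D \<or> x \<in> frontier D"
  using open_D by (auto simp: frontier_def interior_open)

text \<open>On the compact set \<open>closure D - W\<close> the function \<open>r\<close> attains a
  maximum, negative because the set misses the frontier. Open conditions at the frontier thus hold
  on a whole layer \<open>{g < \<eta>}\<close>.\<close>

lemma near_boundary:
  assumes "open W" "frontier D \<subseteq> W"
  shows "\<exists>\<eta>>0. \<forall>z\<in>D. - r z < \<eta> \<longrightarrow> z \<in> W"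
proof (cases "closure D - W = {}")
  case True
  then show ?thesis using D_sub_cl by (intro exI[of _ 1]) auto
next
  case False
  have "compact (closure D - W)" using compact_cl assms by (simp add: compact_diff)
  moreover have "continuous_on (closure D - W) r" using cont_r cl_U continuous_on_subset by blast
  ultimately obtain x0 where x0: "x0 \<in> closure D - W" "\<And>y. y \<in> closure D - W \<Longrightarrow> r y \<le> r x0"
    using continuous_attains_sup[of "closure D - W" r] False by blast
  then have "r x0 < 0" using cl_cases r_neg assms by blast
  then show ?thesis using x0 D_sub_cl by (intro exI[of _ "- r x0"]) force
qed

lemma frontier_ne: "frontier D \<noteq> {}"
  using D_ne bounded_D frontier_eq_empty[of D] not_bounded_UNIV by blast

lemma grad_lower: "\<exists>c>0. \<exists>\<eta>>0. \<forall>z\<in>D. - r z < \<eta> \<longrightarrow> c < norm (Dr z)"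
proof -
  have "compact (frontier D)" using bounded_D compact_frontier_bounded by blast
  moreover have "continuous_on (frontier D) (\<lambda>x. norm (Dr x))"
    using cont_Dr cl_U frontier_sub_cl by (intro continuous_on_norm) (meson continuous_on_subset subset_iff)
  ultimately obtain p where p: "p \<in> frontier D" "\<And>y. y \<in> frontier D \<Longrightarrow> norm (Dr p) \<le> norm (Dr y)"
    using continuous_attains_inf[of "frontier D" "\<lambda>x. norm (Dr x)"] frontier_ne by blast
  \<comment> \<open>Half of the minimum, so that the strict inequality persists in a neighbourhood
    of the frontier.\<close>
  define c where "c = norm (Dr p) / 2"
  have c: "c > 0" using grad_nz p by (simp add: c_def)
  define W where "W = U \<inter> (\<lambda>x. norm (Dr x)) -` {c<..}"
  have "open W" unfolding W_def using cont_Dr open_U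
    by (intro continuous_open_preimage continuous_on_norm) auto
  moreover have "frontier D \<subseteq> W" 
  proof
    fix y assume y: "y \<in> frontier D"
    then have "c < norm (Dr y)" using p(2)[OF y] c unfolding c_def by linarith
    then show "y \<in> W" using y frontier_sub_cl cl_U by (auto simp: W_def)
  qed
  ultimately show ?thesis using near_boundary[of W] c unfolding W_def by blast
qed

text \<open>A segment between two close points of \<open>closure D\<close> may leave it, so
  second-order bounds are needed on a tube around it: \<open>K\<close>, the sum of
  \<open>closure D\<close> and a small ball, is still a compact subset of \<open>U\<close>.\<close>

lemma taylor_tube:
  "\<exists>e>0. \<exists>M\<ge>1. (\<forall>x\<in>closure D. cball x e \<subseteq> U) \<and>
     (\<forall>x\<in>closure D. \<forall>y\<in>cball x e. norm (Dr y) \<le> M \<and> norm (D2r y) \<le> M) \<and>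
     (\<forall>\<epsilon>>0. \<exists>d>0. \<forall>x\<in>closure D. \<forall>y. dist x y < d \<longrightarrow> norm (D2r y - D2r x) \<le> \<epsilon>)"
proof -
  obtain e1 where e1: "e1 > 0" "(\<Union>x\<in>closure D. ball x e1) \<subseteq> U"
    using compact_subset_open_imp_ball_epsilon_subset[OF compact_cl open_U cl_U] by blast
  define e where "e = e1 / 2"
  have e: "e > 0" using e1 by (simp add: e_def)
  have cU: "cball x e \<subseteq> U" if "x \<in> closure D" for x
  proof -
    have "cball x e \<subseteq> ball x e1" using e1 by (auto simp: e_def)
    then show ?thesis using e1 that by blast
  qed
  define K where "K = {x + y | x y. x \<in> closure D \<and> y \<in> cball 0 e}"
  have K: "compact K" unfolding K_def by (intro compact_sums compact_cl compact_cball)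
  have inK: "y \<in> K" if "x \<in> closure D" "y \<in> cball x e" for x y
    unfolding K_def using that
    by (intro CollectI exI[of _ x] exI[of _ "y - x"]) (auto simp: dist_norm norm_minus_commute)
  have KU: "K \<subseteq> U" using cU unfolding K_def by (force simp: dist_norm)
  have "bounded (Dr ` K)" "bounded (D2r ` K)"
    using K cont_Dr cont2 KU by (meson compact_continuous_image compact_imp_bounded continuous_on_subset)+
  then obtain M1 M2 where M: "\<And>y. y \<in> K \<Longrightarrow> norm (Dr y) \<le> M1" "\<And>y. y \<in> K \<Longrightarrow> norm (D2r y) \<le> M2"
    unfolding bounded_iff by blast
  have uc: "uniformly_continuous_on K D2r"
    using K cont2 KU compact_uniformly_continuous continuous_on_subset by blast
  have unif: "\<exists>d>0. \<forall>x\<in>closure D. \<forall>y. dist x y < d \<longrightarrow> norm (D2r y - D2r x) \<le> \<epsilon>"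
    if "\<epsilon> > 0" for \<epsilon>
  proof -
    from that obtain d where d: "d > 0" "\<And>x y. x \<in> K \<Longrightarrow> y \<in> K \<Longrightarrow> dist y x < d \<Longrightarrow> dist (D2r y) (D2r x) < \<epsilon>"
      using uc unfolding uniformly_continuous_on_def by metis
    have "norm (D2r y - D2r x) \<le> \<epsilon>" if "x \<in> closure D" "dist x y < min d e" for x y
    proof -
      have "x \<in> K" "y \<in> K" using inK[of x x] inK[of x y] that e by auto
      then show ?thesis using d(2)[of x y] that by (simp add: dist_norm norm_minus_commute)
    qed
    then show ?thesis using d e by (intro exI[of _ "min d e"]) auto
  qed
  have bd: "norm (Dr y) \<le> max 1 (max M1 M2) \<and> norm (D2r y) \<le> max 1 (max M1 M2)"
    if "x \<in> closure D" "y \<in> cball x e" for x y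
    using M[OF inK[OF that]] by (simp add: le_max_iff_disj)
  show ?thesis
    by (rule exI[of _ e], rule conjI[OF e], rule exI[of _ "max 1 (max M1 M2)"])
       (intro conjI ballI allI impI unif cU bd; simp)
qed

text \<open>The Lagrange remainder of order two for the real function
  \<open>r (x + t *\<^sub>R v)\<close> on the unit interval; \<open>dif\<close> lists its
  derivatives of order 0, 1 and 2.\<close>

lemma taylor_point:
  assumes "cball x e \<subseteq> U" "norm v \<le> e"
  shows "\<exists>\<xi>. norm (\<xi> - x) \<le> norm v \<and> r (x + v) = r x + Dr x v + D2r \<xi> v v / 2"
proof -
  define dif where "dif = (\<lambda>m::nat. if m = 0 then (\<lambda>t. r (x + t *\<^sub>R v))
     else if m = 1 then (\<lambda>t. Dr (x + t *\<^sub>R v) v) else (\<lambda>t. D2r (x + t *\<^sub>R v) v v))"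
  have inU: "x + t *\<^sub>R v \<in> U" if "0 \<le> t" "t \<le> 1" for t
  proof -
    have "norm (t *\<^sub>R v) \<le> e" using that assms(2) mult_left_le_one_le[of "norm v" t] by simp
    then show ?thesis using assms(1) by (auto simp: dist_norm)
  qed
  have p: "((\<lambda>t. x + t *\<^sub>R v) has_derivative (\<lambda>t. t *\<^sub>R v)) (at t)" for t
    by (auto intro!: derivative_eq_intros)
  have d0: "DERIV (dif 0) t :> dif 1 t" if "0 \<le> t" "t \<le> 1" for t
    using has_derivative_compose[OF p der1[OF inU[OF that]]]
    by (simp add: dif_def has_field_derivative_def blinfun_linear mult_commute_abs)
  have d1: "DERIV (dif 1) t :> dif 2 t" if "0 \<le> t" "t \<le> 1" for t
  proof -
    have "((\<lambda>t. Dr (x + t *\<^sub>R v) v) has_derivative (\<lambda>t'. D2r (x + t *\<^sub>R v) (t' *\<^sub>R v) v)) (at t)"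
      by (rule bounded_linear.has_derivative[OF blinfun.bounded_linear_left has_derivative_compose[OF p der2[OF inU[OF that]]]])
    then show ?thesis by (simp add: dif_def has_field_derivative_def blinfun_linear mult_commute_abs)
  qed
  have "\<exists>t. 0 < t \<and> t < 1 \<and> dif 0 1 = (\<Sum>m<2. dif m 0 / fact m * 1 ^ m) + dif 2 t / fact 2 * 1 ^ 2"
  proof (rule Maclaurin)
    show "\<forall>m t. m < 2 \<and> 0 \<le> t \<and> t \<le> 1 \<longrightarrow> DERIV (dif m) t :> dif (Suc m) t"
      using d0 d1 less_2_cases by (metis One_nat_def Suc_1)
  qed auto
  then obtain t where t: "0 < t" "t < 1"
    "dif 0 1 = (\<Sum>m<2. dif m 0 / fact m * 1 ^ m) + dif 2 t / fact 2 * 1 ^ 2" by blast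
  then have "r (x + v) = r x + Dr x v + D2r (x + t *\<^sub>R v) v v / 2"
    by (simp add: dif_def numeral_2_eq_2)
  moreover have "norm (x + t *\<^sub>R v - x) \<le> norm v" using t mult_left_le_one_le[of "norm v" t] by simp
  ultimately show ?thesis by blast
qed

text \<open>Collects everything quantitative about \<open>r\<close> on \<open>closure D\<close> into
  two constants, which later become locale parameters. The last block holds for all pairs of points,
  also distant ones, so no smallness needs to be tracked afterwards.\<close>

lemma bounds_exist:
  "\<exists>e>0. \<exists>M\<ge>1. (\<forall>x\<in>closure D. \<forall>v. norm v \<le> e \<longrightarrow> x + v \<in> U \<and> \<bar>r (x + v) - r x - Dr x v\<bar> \<le> M * (norm v)\<^sup>2)
     \<and> (\<forall>\<epsilon>>0. \<exists>d>0. \<forall>x\<in>closure D. \<forall>v. norm v < d \<longrightarrow> \<bar>r (x + v) - r x - Dr x v - D2r x v v / 2\<bar> \<le> \<epsilon> * (norm v)\<^sup>2)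
     \<and> (\<forall>x\<in>closure D. norm (Dr x) \<le> M \<and> norm (D2r x) \<le> M)
     \<and> (\<forall>x\<in>closure D. \<forall>y\<in>closure D. norm (y - x) \<le> M \<and> \<bar>r y - r x\<bar> \<le> M * norm (y - x) \<and>
           norm (Dr y - Dr x) \<le> M * norm (y - x) \<and> \<bar>r y - r x - Dr x (y - x)\<bar> \<le> M * (norm (y - x))\<^sup>2)"
proof -
  obtain e M where e: "e > 0" and M: "M \<ge> 1" and tube: "(\<forall>x\<in>closure D. cball x e \<subseteq> U) \<and>
     (\<forall>x\<in>closure D. \<forall>y\<in>cball x e. norm (Dr y) \<le> M \<and> norm (D2r y) \<le> M) \<and>
     (\<forall>\<epsilon>>0. \<exists>d>0. \<forall>x\<in>closure D. \<forall>y. dist x y < d \<longrightarrow> norm (D2r y - D2r x) \<le> \<epsilon>)"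
    by (rule exE[OF taylor_tube]) (elim conjE exE, rule that, assumption+, intro conjI)
  have U: "cball x e \<subseteq> U" if "x \<in> closure D" for x using tube that by simp
  have bd: "norm (Dr y) \<le> M \<and> norm (D2r y) \<le> M" if "x \<in> closure D" "y \<in> cball x e" for x y
    using conjunct1[OF conjunct2[OF tube]] that by blast
  note uc = conjunct2[OF conjunct2[OF tube], rule_format]
  have bdx: "norm (Dr x) \<le> M \<and> norm (D2r x) \<le> M" if "x \<in> closure D" for x
    using bd[OF that, of x] e by auto
  have t1: "\<bar>r (x + v) - r x - Dr x v\<bar> \<le> M * (norm v)\<^sup>2" if x: "x \<in> closure D" "norm v \<le> e" for x v
  proof -
    obtain \<xi> where \<xi>: "norm (\<xi> - x) \<le> norm v" "r (x + v) = r x + Dr x v + D2r \<xi> v v / 2"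
      using taylor_point[OF U[OF x(1)] x(2)] by blast
    have "norm (D2r \<xi>) \<le> M" using bd[OF x(1), of \<xi>] \<xi> x by (simp add: dist_norm norm_minus_commute)
    then have "norm (D2r \<xi>) * norm v * norm v \<le> M * norm v * norm v" by (intro mult_right_mono) auto
    then have "\<bar>D2r \<xi> v v\<bar> \<le> M * (norm v)\<^sup>2" using D2r_le[of \<xi> v v] by (simp add: power2_eq_square mult.assoc)
    then show ?thesis using \<xi> by simp
  qed
  have t2: "\<exists>d>0. \<forall>x\<in>closure D. \<forall>v. norm v < d \<longrightarrow> \<bar>r (x + v) - r x - Dr x v - D2r x v v / 2\<bar> \<le> \<epsilon> * (norm v)\<^sup>2"
    if \<epsilon>: "\<epsilon> > 0" for \<epsilon>
  proof -
    obtain d where d: "d > 0" "\<And>x y. x \<in> closure D \<Longrightarrow> dist x y < d \<Longrightarrow> norm (D2r y - D2r x) \<le> \<epsilon>"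
      using uc[OF \<epsilon>] by metis
    have "\<bar>r (x + v) - r x - Dr x v - D2r x v v / 2\<bar> \<le> \<epsilon> * (norm v)\<^sup>2"
      if x: "x \<in> closure D" "norm v < min d e" for x v
    proof -
      obtain \<xi> where \<xi>: "norm (\<xi> - x) \<le> norm v" "r (x + v) = r x + Dr x v + D2r \<xi> v v / 2"
        using taylor_point[OF U[OF x(1)], of v] x(2) by auto
      have le: "norm (D2r \<xi> - D2r x) \<le> \<epsilon>" using d(2)[OF x(1), of \<xi>] \<xi> x(2) by (simp add: dist_norm norm_minus_commute)
      have "\<bar>(D2r \<xi> - D2r x) v v\<bar> \<le> norm ((D2r \<xi> - D2r x) v) * norm v"
        using norm_blinfun[of "(D2r \<xi> - D2r x) v" v] by simp
      also have "\<dots> \<le> norm (D2r \<xi> - D2r x) * norm v * norm v" by (intro mult_right_mono norm_blinfun) auto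
      also have "\<dots> \<le> \<epsilon> * norm v * norm v" using le by (intro mult_right_mono) auto
      finally have "\<bar>(D2r \<xi> - D2r x) v v\<bar> \<le> \<epsilon> * (norm v)\<^sup>2" by (simp add: power2_eq_square mult.assoc)
      then show ?thesis using \<xi> by (simp add: blinfun_linear)
    qed
    then show ?thesis using d e by (intro exI[of _ "min d e"]) auto
  qed
  obtain R where R: "\<And>x. x \<in> closure D \<Longrightarrow> norm x \<le> R"
    using compact_imp_bounded[OF compact_cl] unfolding bounded_iff by blast
  have "compact (r ` closure D)"
    by (rule compact_continuous_image[OF continuous_on_subset[OF cont_r cl_U] compact_cl])
  then have "bounded (r ` closure D)" by (rule compact_imp_bounded)
  then obtain G where G: "\<And>x. x \<in> closure D \<Longrightarrow> \<bar>r x\<bar> \<le> G"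
    unfolding bounded_iff by auto
  \<comment> \<open>The entry \<open>2 * R\<close> bounds the diameter and \<open>M + M * e\<close>
    serves pairs at distance at most \<open>e\<close>. The entries divided by \<open>e\<close> serve
    the other pairs: constant bounds on the differences are multiplied by
    \<open>norm (y - x) / e\<close>, which exceeds 1.\<close>
  define M' where "M' = max (2 * R) (M + M * e + 2 * M / e + 2 * G / e + (2 * G / e + M) / e)"
  obtain x0 where x0: "x0 \<in> closure D" using D_ne D_sub_cl by blast
  have G0: "G \<ge> 0" using G[OF x0] by simp
  have parts: "0 \<le> M * e" "0 \<le> 2 * M / e" "0 \<le> 2 * G / e" "0 \<le> (2 * G / e + M) / e" using e M G0 by auto
  have MM: "M \<le> M'" "M + M * e \<le> M'" "2 * M / e \<le> M'" "2 * G / e \<le> M'" "(2 * G / e + M) / e \<le> M'" "2 * R \<le> M'"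
    using parts M unfolding M'_def le_max_iff_disj by linarith+
  have pair: "\<bar>r y - r x\<bar> \<le> M' * norm (y - x)" "norm (Dr y - Dr x) \<le> M' * norm (y - x)"
     "\<bar>r y - r x - Dr x (y - x)\<bar> \<le> M' * (norm (y - x))\<^sup>2"
    if x: "x \<in> closure D" and y: "y \<in> closure D" for x y
  proof -
    have Dv: "\<bar>Dr x (y - x)\<bar> \<le> M * norm (y - x)"
      using norm_blinfun[of "Dr x" "y - x"] mult_right_mono[OF conjunct1[OF bdx[OF x]], of "norm (y - x)"]
      by simp
    have "\<bar>r y - r x\<bar> \<le> M' * norm (y - x) \<and> norm (Dr y - Dr x) \<le> M' * norm (y - x) \<and>
      \<bar>r y - r x - Dr x (y - x)\<bar> \<le> M' * (norm (y - x))\<^sup>2"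
    proof (cases "norm (y - x) \<le> e")
      case True
      have t: "\<bar>r y - r x - Dr x (y - x)\<bar> \<le> M * (norm (y - x))\<^sup>2" using t1[OF x True] by simp
      have "M * (norm (y - x))\<^sup>2 \<le> M * (e * norm (y - x))" unfolding power2_eq_square
        using True M by (intro mult_left_mono mult_right_mono) auto
      then have "\<bar>r y - r x\<bar> \<le> (M + M * e) * norm (y - x)" using t Dv by (simp add: algebra_simps)
      also have "\<dots> \<le> M' * norm (y - x)" using MM by (intro mult_right_mono) auto
      finally have 1: "\<bar>r y - r x\<bar> \<le> M' * norm (y - x)" .
      have "norm (Dr y - Dr x) \<le> M * norm (y - x)"
      proof (rule differentiable_bound[where S = "cball x e" and f' = "\<lambda>z. blinfun_apply (D2r z)"])
        show "(Dr has_derivative blinfun_apply (D2r z)) (at z within cball x e)" if "z \<in> cball x e" for z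
          using der2[of z] U[OF x] that has_derivative_at_withinI by blast
        show "onorm (blinfun_apply (D2r z)) \<le> M" if "z \<in> cball x e" for z
          using bd[OF x that] by (simp add: norm_blinfun.rep_eq)
      qed (use True e in \<open>auto simp: dist_norm norm_minus_commute\<close>)
      also have "\<dots> \<le> M' * norm (y - x)" using MM by (intro mult_right_mono) auto
      finally have 2: "norm (Dr y - Dr x) \<le> M' * norm (y - x)" .
      have "M * (norm (y - x))\<^sup>2 \<le> M' * (norm (y - x))\<^sup>2" using MM by (intro mult_right_mono) auto
      then show ?thesis using 1 2 t by linarith
    next
      case False
      then have n: "norm (y - x) / e \<ge> 1" using e by (simp add: field_simps)
      have "\<bar>r y - r x\<bar> \<le> 2 * G" using G[OF x] G[OF y] by linarith
      also have "\<dots> \<le> 2 * G * (norm (y - x) / e)" using n G0 mult_left_mono[OF n, of "2 * G"] by simp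
      finally have 1: "\<bar>r y - r x\<bar> \<le> 2 * G / e * norm (y - x)" by simp
      have "norm (Dr y - Dr x) \<le> 2 * M" using bdx[OF x] bdx[OF y] norm_triangle_ineq4[of "Dr y" "Dr x"] by linarith
      also have "\<dots> \<le> 2 * M * (norm (y - x) / e)" using n M mult_left_mono[OF n, of "2 * M"] by simp
      finally have 2: "norm (Dr y - Dr x) \<le> 2 * M / e * norm (y - x)" by simp
      have "\<bar>r y - r x - Dr x (y - x)\<bar> \<le> (2 * G / e + M) * norm (y - x)"
        using 1 Dv by (simp add: distrib_right)
      also have "\<dots> \<le> (2 * G / e + M) * norm (y - x) * (norm (y - x) / e)"
        using mult_left_mono[OF n, of "(2 * G / e + M) * norm (y - x)"] M parts by simp
      finally have 3: "\<bar>r y - r x - Dr x (y - x)\<bar> \<le> (2 * G / e + M) / e * (norm (y - x))\<^sup>2"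
        by (simp add: power2_eq_square)
      have "2 * G / e * norm (y - x) \<le> M' * norm (y - x)" "2 * M / e * norm (y - x) \<le> M' * norm (y - x)"
        "(2 * G / e + M) / e * (norm (y - x))\<^sup>2 \<le> M' * (norm (y - x))\<^sup>2"
        by (rule mult_right_mono; use MM in simp)+
      then show ?thesis using 1 2 3 by linarith
    qed
    then show "\<bar>r y - r x\<bar> \<le> M' * norm (y - x)" "norm (Dr y - Dr x) \<le> M' * norm (y - x)"
     "\<bar>r y - r x - Dr x (y - x)\<bar> \<le> M' * (norm (y - x))\<^sup>2" by auto
  qed
  have t1': "x + v \<in> U \<and> \<bar>r (x + v) - r x - Dr x v\<bar> \<le> M' * (norm v)\<^sup>2" if x: "x \<in> closure D" "norm v \<le> e" for x v
  proof -
    have "x + v \<in> U" using U[OF x(1)] x by (auto simp: dist_norm)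
    moreover have "M * (norm v)\<^sup>2 \<le> M' * (norm v)\<^sup>2" using MM by (intro mult_right_mono) auto
    ultimately show ?thesis using t1[OF x] by linarith
  qed
  have dm: "norm (y - x) \<le> M'" if "x \<in> closure D" "y \<in> closure D" for x y
    using R[OF that(1)] R[OF that(2)] norm_triangle_ineq4[of y x] MM by linarith
  show ?thesis
    apply (rule exI[of _ e], rule conjI[OF e], rule exI[of _ M'])
    using M MM(1) t1' t2 bdx pair dm by (intro conjI) (auto intro: order_trans[OF _ MM(1)])
qed

text \<open>Compactness: if \<open>K\<close> = n + 1 and \<open>c\<close> = \<open>\<eta>\<close> =
  1 / (n + 1) fail for every n, normalised counterexamples converge to a unit vector at a boundary
  point. The growing coefficient of the \<open>ell\<close> term forces the limit into the complex
  tangent space, where its Levi form would be nonpositive.\<close>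

lemma levi_uniform:
  "\<exists>K>0. \<exists>c>0. \<exists>\<eta>>0. \<forall>z\<in>D. - r z < \<eta> \<longrightarrow>
     (\<forall>v. c * (norm v)\<^sup>2 \<le> D2r z v v + D2r z (imul v) (imul v) + K * (cmod (ell z v))\<^sup>2)"
proof (rule ccontr)
  assume neg: "\<not> ?thesis"
  have ex: "\<exists>z v. z \<in> D \<and> - r z < 1 / real (Suc n) \<and> norm v = 1 \<and>
      D2r z v v + D2r z (imul v) (imul v) + real (Suc n) * (cmod (ell z v))\<^sup>2 < 1 / real (Suc n)" for n
  proof -
    have "real (Suc n) > 0" "1 / real (Suc n) > 0" by auto
    then obtain z v where z: "z \<in> D" "- r z < 1 / real (Suc n)"
      "D2r z v v + D2r z (imul v) (imul v) + real (Suc n) * (cmod (ell z v))\<^sup>2 < 1 / real (Suc n) * (norm v)\<^sup>2"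
      using neg by (meson not_le)
    have v0: "v \<noteq> 0" using z(3) by (auto simp: cmod_ell_sq imul_eq)
    define w where "w = (1 / norm v) *\<^sub>R v"
    have "(norm v)\<^sup>2 * (D2r z w w + D2r z (imul w) (imul w) + real (Suc n) * (cmod (ell z w))\<^sup>2)
       = D2r z v v + D2r z (imul v) (imul v) + real (Suc n) * (cmod (ell z v))\<^sup>2"
    proof -
      have "v = norm v *\<^sub>R w" using v0 by (simp add: w_def)
      then obtain s where s: "s = norm v" "v = s *\<^sub>R w" by blast
      show ?thesis unfolding s(1)[symmetric] cmod_ell_sq unfolding s(2)
        by (simp add: imul_linear blinfun_linear power2_eq_square algebra_simps)
    qed
    also have "\<dots> < (norm v)\<^sup>2 * (1 / real (Suc n))" using z(3) by (simp add: mult.commute)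
    finally have "D2r z w w + D2r z (imul w) (imul w) + real (Suc n) * (cmod (ell z w))\<^sup>2 < 1 / real (Suc n)"
      by (rule mult_left_less_imp_less) simp
    then show ?thesis using z v0 by (intro exI[of _ z] exI[of _ w]) (auto simp: w_def)
  qed
  then obtain Z V where ZV: "\<And>n. Z n \<in> D" "\<And>n. - r (Z n) < 1 / real (Suc n)" "\<And>n. norm (V n) = 1"
      "\<And>n. D2r (Z n) (V n) (V n) + D2r (Z n) (imul (V n)) (imul (V n)) + real (Suc n) * (cmod (ell (Z n) (V n)))\<^sup>2 < 1 / real (Suc n)"
    by metis
  have "compact (closure D \<times> sphere (0 :: complex ^ 'n) 1)" using compact_cl by (intro compact_Times) auto
  moreover have "\<forall>n. (Z n, V n) \<in> closure D \<times> sphere 0 1" using ZV D_sub_cl by auto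
  ultimately obtain p v \<phi> where pv: "(p, v) \<in> closure D \<times> sphere 0 1" "strict_mono \<phi>"
    "((\<lambda>n. (Z n, V n)) \<circ> \<phi>) \<longlonglongrightarrow> (p, v)"
    unfolding compact_def by (metis (no_types, lifting) surj_pair)
  have Zp: "(\<lambda>n. Z (\<phi> n)) \<longlonglongrightarrow> p" and Vv: "(\<lambda>n. V (\<phi> n)) \<longlonglongrightarrow> v"
    using tendsto_fst[OF pv(3)] tendsto_snd[OF pv(3)] by (auto simp: o_def)
  have pU: "p \<in> U" using pv cl_U by auto
  have inv: "(\<lambda>n. 1 / real (Suc (\<phi> n))) \<longlonglongrightarrow> 0"
    using LIMSEQ_subseq_LIMSEQ[OF lim_1_over_n[THEN LIMSEQ_Suc] pv(2)] by (simp add: o_def)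
  have conv: "(\<lambda>n. h (Z (\<phi> n))) \<longlonglongrightarrow> h p" if "continuous_on U h" for h :: "complex ^ 'n \<Rightarrow> 'x::topological_space"
    using that Zp pU open_U by (metis continuous_on_eq_continuous_at isCont_tendsto_compose)
  have "(\<lambda>n. - r (Z (\<phi> n))) \<longlonglongrightarrow> - r p" by (intro tendsto_minus conv cont_r)
  then have "- r p \<le> 0" using inv by (rule LIMSEQ_le) (use ZV(2) less_imp_le in blast)
  then have pf: "p \<in> frontier D" using pv cl_cases[of p] r_neg by force
  have iV: "(\<lambda>n. imul (V (\<phi> n))) \<longlonglongrightarrow> imul v" by (rule bounded_linear.tendsto[OF bounded_linear_imul Vv])
  define A where "A = (\<lambda>n. D2r (Z (\<phi> n)) (V (\<phi> n)) (V (\<phi> n)) + D2r (Z (\<phi> n)) (imul (V (\<phi> n))) (imul (V (\<phi> n))))"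
  have A: "A \<longlonglongrightarrow> D2r p v v + D2r p (imul v) (imul v)" unfolding A_def
    by (intro tendsto_add blinfun.tendsto conv cont2 Vv iV)
  have B: "(\<lambda>n. (cmod (ell (Z (\<phi> n)) (V (\<phi> n))))\<^sup>2) \<longlonglongrightarrow> (cmod (ell p v))\<^sup>2" unfolding cmod_ell_sq
    by (intro tendsto_add tendsto_power blinfun.tendsto conv cont_Dr Vv iV)
  have AB: "A n + real (Suc (\<phi> n)) * (cmod (ell (Z (\<phi> n)) (V (\<phi> n))))\<^sup>2 < 1 / real (Suc (\<phi> n))" for n
    using ZV(4)[of "\<phi> n"] by (simp add: A_def)
  have "A n \<le> 1 / real (Suc (\<phi> n))" for n
    using AB[of n] mult_nonneg_nonneg[OF of_nat_0_le_iff zero_le_power2, of "Suc (\<phi> n)" "cmod (ell (Z (\<phi> n)) (V (\<phi> n)))"]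
    by linarith
  then have A0: "D2r p v v + D2r p (imul v) (imul v) \<le> 0" using A inv by (intro LIMSEQ_le[OF A inv]) auto
  \<comment> \<open>Solves \<open>AB\<close> for the squared modulus; the bound tends to 0 because
    \<open>A\<close> converges, whence \<open>ell p v = 0\<close>.\<close>
  have "(cmod (ell (Z (\<phi> n)) (V (\<phi> n))))\<^sup>2 \<le> 1 / real (Suc (\<phi> n)) * (1 / real (Suc (\<phi> n)) - A n)" for n
  proof -
    have "b \<le> 1 / k * (1 / k - a)" if "k > 0" "a + k * b < 1 / k" for a b k :: real
    proof -
      have "k * b \<le> 1 / k - a" using that by linarith
      then have "1 / k * (k * b) \<le> 1 / k * (1 / k - a)" using that by (intro mult_left_mono) auto
      then show ?thesis using that by simp
    qed
    from this[OF _ AB[of n]] show ?thesis by simp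
  qed
  moreover have "(\<lambda>n. 1 / real (Suc (\<phi> n)) * (1 / real (Suc (\<phi> n)) - A n)) \<longlonglongrightarrow> 0 * (0 - (D2r p v v + D2r p (imul v) (imul v)))"
    by (intro tendsto_mult tendsto_diff inv A)
  ultimately have "(cmod (ell p v))\<^sup>2 \<le> 0 * (0 - (D2r p v v + D2r p (imul v) (imul v)))"
    using LIMSEQ_le[OF B] by blast
  then have "ell p v = 0" by simp
  then have "Dr p v = 0" "Dr p (imul v) = 0" by (auto simp: ell_def complex_eq_iff)
  moreover have "v \<noteq> 0" using pv by auto
  ultimately show False using levi[OF pf] A0 by force
qed

end

subsection \<open>Holomorphic discs near the boundary\<close>

lemma power2_mult_sqrt: "0 \<le> b \<Longrightarrow> (a * sqrt b * c)\<^sup>2 = a\<^sup>2 * b * (c * c)"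
  by (simp add: power_mult_distrib) (simp add: power2_eq_square)

locale spc_bounds = spc D U r Dr D2r
  for D U :: "(complex ^ 'n) set" and r Dr D2r +
  fixes e M :: real
  assumes e_pos: "e > 0" and M_ge1: "M \<ge> 1"
    and taylor1: "\<And>x v. x \<in> closure D \<Longrightarrow> norm v \<le> e \<Longrightarrow> x + v \<in> U \<and> \<bar>r (x + v) - r x - Dr x v\<bar> \<le> M * (norm v)\<^sup>2"
    and taylor2: "\<And>\<epsilon>. \<epsilon> > 0 \<Longrightarrow> \<exists>d>0. \<forall>x\<in>closure D. \<forall>v. norm v < d \<longrightarrow> \<bar>r (x + v) - r x - Dr x v - D2r x v v / 2\<bar> \<le> \<epsilon> * (norm v)\<^sup>2"
    and bd1: "\<And>x. x \<in> closure D \<Longrightarrow> norm (Dr x) \<le> M"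
    and bd2: "\<And>x. x \<in> closure D \<Longrightarrow> norm (D2r x) \<le> M"
    and diam: "\<And>x y. x \<in> closure D \<Longrightarrow> y \<in> closure D \<Longrightarrow> norm (y - x) \<le> M"
    and lip_r: "\<And>x y. x \<in> closure D \<Longrightarrow> y \<in> closure D \<Longrightarrow> \<bar>r y - r x\<bar> \<le> M * norm (y - x)"
    and lip_Dr: "\<And>x y. x \<in> closure D \<Longrightarrow> y \<in> closure D \<Longrightarrow> norm (Dr y - Dr x) \<le> M * norm (y - x)"
    and taylor_D: "\<And>x y. x \<in> closure D \<Longrightarrow> y \<in> closure D \<Longrightarrow> \<bar>r y - r x - Dr x (y - x)\<bar> \<le> M * (norm (y - x))\<^sup>2"
begin

abbreviation g :: "complex ^ 'n \<Rightarrow> real" where "g x \<equiv> - r x"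

lemma M_pos: "M > 0" using M_ge1 by linarith

lemma ell_le: "x \<in> D \<Longrightarrow> cmod (ell x v) \<le> 2 * M * norm v"
  using cmod_ell_le[of x v] mult_right_mono[OF bd1[OF D_sub_cl], of x "norm v"] by simp

lemma ell_lip: 
  assumes "x \<in> D" "y \<in> D" shows "cmod (ell x v - ell y v) \<le> 2 * (M * norm (x - y)) * norm v"
proof -
  have "2 * norm (Dr x - Dr y) * norm v \<le> 2 * (M * norm (x - y)) * norm v"
    using lip_Dr[of y x] assms D_sub_cl by (intro mult_right_mono mult_left_mono) auto
  then show ?thesis using cmod_ell_diff_le[of x v y] by linarith
qed

lemma qf_le: "x \<in> D \<Longrightarrow> cmod (qf x v v) \<le> M * (norm v)\<^sup>2"
  using cmod_qf_le[of x v] mult_right_mono[OF bd2[OF D_sub_cl], of x "(norm v)\<^sup>2"] by simp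

lemma g_pos: "x \<in> D \<Longrightarrow> g x > 0"
  using r_neg by simp

lemma g_le: assumes "x \<in> D" shows "g x \<le> M\<^sup>2"
proof -
  obtain p where p: "p \<in> frontier D" using frontier_ne by blast
  have x: "x \<in> closure D" and pc: "p \<in> closure D" using assms p D_sub_cl frontier_sub_cl by auto
  have "g x \<le> M * norm (p - x)" using lip_r[OF x pc] r_frontier[OF p] by simp
  also have "\<dots> \<le> M * M" using diam[OF x pc] M_pos by (intro mult_left_mono) auto
  finally show ?thesis by (simp add: power2_eq_square)
qed

lemma sqrt_g_le: "x \<in> D \<Longrightarrow> sqrt (g x) \<le> M"
  using g_le M_pos by (intro real_le_lsqrt) auto

text \<open>The term \<open>K * ell\<^sup>2\<close> corrects the Levi polynomial of \<open>r\<close> at \<open>z\<close>: since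
  \<open>\<bar>ell\<bar>\<^sup>2 = 2 * (Re ell)\<^sup>2 - Re (ell\<^sup>2)\<close> and \<open>Re ell\<close> is the increment of \<open>r\<close> up to second order,
  it turns positivity of the Levi form on the complex tangent space into
  positivity in all directions.\<close>

lemma levi_polynomial:
  "\<exists>K>0. \<exists>c>0. \<exists>\<eta>>0. \<exists>d>0. \<forall>z\<in>D. g z < \<eta> \<longrightarrow> (\<forall>w\<in>D. norm (w - z) < d \<longrightarrow>
     Re (ell z (w - z) + qf z (w - z) (w - z) + of_real K * (ell z (w - z))\<^sup>2) + c * (norm (w - z))\<^sup>2 \<le> 2 * g z)"
proof -
  obtain K0 c0 \<eta> where K0: "K0 > 0" and c0: "c0 > 0" and \<eta>: "\<eta> > 0"
    and lev: "\<And>z v. z \<in> D \<Longrightarrow> g z < \<eta> \<Longrightarrow>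
      c0 * (norm v)\<^sup>2 \<le> D2r z v v + D2r z (imul v) (imul v) + K0 * (cmod (ell z v))\<^sup>2"
    using levi_uniform by blast
  \<comment> \<open>\<open>L\<close> is one quarter of the expression bounded in \<open>lev\<close>;
    this accounts for both divisions by 4.\<close>
  define K where "K = K0 / 4"
  define c where "c = c0 / 4"
  have K: "K > 0" and c: "c > 0" using K0 c0 by (auto simp: K_def c_def)
  obtain d0 where d0: "d0 > 0" "\<And>x v. x \<in> closure D \<Longrightarrow> norm v < d0 \<Longrightarrow>
      \<bar>r (x + v) - r x - Dr x v - D2r x v v / 2\<bar> \<le> c / 4 * (norm v)\<^sup>2"
    using taylor2[of "c / 4"] c by auto
  \<comment> \<open>The bound \<open>1 / (4 * K * M)\<close> makes the quadratic term in
    \<open>x\<close> at most \<open>\<bar>x\<bar>\<close>. The last two bounds make the fourth-order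
    error \<open>4 * K * (M * N)\<^sup>2\<close> at most \<open>c / 4 * N\<close>.\<close>
  define d where "d = min d0 (min (1 / (4 * K * M)) (min 1 (c / (16 * K * M\<^sup>2))))"
  have d: "d > 0" "d \<le> d0" "d \<le> 1 / (4 * K * M)" "d \<le> 1" "d \<le> c / (16 * K * M\<^sup>2)"
    using d0 K c M_pos by (auto simp: d_def)
  have main: "Re (ell z (w - z) + qf z (w - z) (w - z) + of_real K * (ell z (w - z))\<^sup>2) + c / 2 * (norm (w - z))\<^sup>2 \<le> 2 * g z"
    if z: "z \<in> D" "g z < \<eta>" and w: "w \<in> D" "norm (w - z) < d" for z w
  proof -
    define v where "v = w - z"
    define x where "x = r w - r z"
    define a where "a = Dr z v"
    define L where "L = (D2r z v v + D2r z (imul v) (imul v)) / 4"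
    define N where "N = (norm v)\<^sup>2"
    have N0: "N \<ge> 0" by (simp add: N_def)
    have nv: "norm v < d" using w by (simp add: v_def)
    have Req: "Re (qf z v v) = D2r z v v / 2 - L" by (simp add: qf_def L_def field_simps)
    have T: "\<bar>x - a - D2r z v v / 2\<bar> \<le> c / 4 * N"
      using d0(2)[OF D_sub_cl[OF z(1)], of v] nv d by (simp add: v_def x_def a_def N_def)
    have Llow: "c * N - K * (cmod (ell z v))\<^sup>2 \<le> L" using lev[OF z, of v]
      by (simp add: L_def c_def K_def N_def field_simps)
    have ell2: "(cmod (ell z v))\<^sup>2 = 2 * a\<^sup>2 - Re ((ell z v)\<^sup>2)"
      unfolding cmod_ell_sq by (simp add: ell_def a_def power2_eq_square)
    have xa: "\<bar>x - a\<bar> \<le> M * N"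
      using taylor_D[OF D_sub_cl[OF z(1)] D_sub_cl[OF w(1)]] by (simp add: v_def x_def a_def N_def)
    have "(x - a)\<^sup>2 \<le> (M * N)\<^sup>2" using xa abs_le_square_iff[of "x - a" "M * N"] M_pos N0 by simp
    moreover have "a\<^sup>2 \<le> 2 * x\<^sup>2 + 2 * (x - a)\<^sup>2"
      using zero_le_power2[of "2 * x - a"] by (simp add: power2_eq_square algebra_simps)
    ultimately have a2: "a\<^sup>2 \<le> 2 * x\<^sup>2 + 2 * (M * N)\<^sup>2" by linarith
    have "N \<le> c / (16 * K * M\<^sup>2)"
    proof -
      have "N \<le> norm v * 1" unfolding N_def power2_eq_square using nv d by (intro mult_left_mono) auto
      then show ?thesis using nv d by linarith
    qed
    then have "16 * K * M\<^sup>2 * N \<le> c" using K M_pos by (simp add: pos_le_divide_eq mult.commute)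
    then have "16 * K * M\<^sup>2 * N * N \<le> c * N" using N0 by (intro mult_right_mono)
    then have s1: "4 * K * (M * N)\<^sup>2 \<le> c / 4 * N" by (simp add: power2_eq_square algebra_simps)
    have s2: "2 * K * a\<^sup>2 \<le> 4 * K * x\<^sup>2 + 4 * K * (M * N)\<^sup>2"
      using mult_left_mono[OF a2, of "2 * K"] K by (simp add: algebra_simps)
    have s3: "K * (cmod (ell z v))\<^sup>2 = 2 * K * a\<^sup>2 - K * Re ((ell z v)\<^sup>2)"
      unfolding ell2 by (simp add: algebra_simps)
    \<comment> \<open>Of the gain \<open>c * N\<close> from the Levi form, one quarter is lost to
      the Taylor remainder and one quarter to \<open>s1\<close>.\<close>
    have "x \<ge> a + Re (qf z v v) + L - c / 4 * N" using T Req by linarith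
    then have lower: "a + Re (qf z v v) + K * Re ((ell z v)\<^sup>2) + c / 2 * N \<le> x + 4 * K * x\<^sup>2"
      using Llow s1 s2 s3 by linarith
    have "\<bar>x\<bar> \<le> M * norm v" using lip_r[OF D_sub_cl[OF z(1)] D_sub_cl[OF w(1)]] by (simp add: x_def v_def)
    also have "\<dots> \<le> M * (1 / (4 * K * M))" using nv d M_pos by (intro mult_left_mono) auto
    also have "\<dots> = 1 / (4 * K)" using M_pos by simp
    finally have "4 * K * \<bar>x\<bar> \<le> 1" using K by (simp add: field_simps)
    then have "4 * K * \<bar>x\<bar> * \<bar>x\<bar> \<le> 1 * \<bar>x\<bar>" by (rule mult_right_mono) simp
    then have "4 * K * x\<^sup>2 \<le> \<bar>x\<bar>" by (simp add: power2_eq_square mult.assoc)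
    \<comment> \<open>The point \<open>w\<close> lies in \<open>D\<close>, so \<open>r\<close>
      increases by less than \<open>g z\<close>; \<open>x + \<bar>x\<bar>\<close> is then at most
      \<open>2 * g z\<close>, the origin of the factor 2 in the statement.\<close>
    moreover have "x \<le> g z" using r_neg[OF w(1)] by (simp add: x_def)
    ultimately have "x + 4 * K * x\<^sup>2 \<le> 2 * g z" using g_pos[OF z(1)] by linarith
    then show ?thesis using lower by (simp add: v_def[symmetric] N_def[symmetric] ell_def a_def)
  qed
  have "c / 2 > 0" using c by simp
  with K \<eta> d(1) main show ?thesis by blast
qed

section \<open>Displacement along discs and along subdivided chains\<close>

lemma holo_disc_in: "holo_disc D f \<Longrightarrow> cmod \<zeta> < 1 \<Longrightarrow> f \<zeta> \<in> D"
  by (auto simp: holo_disc_def image_subset_iff)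

text \<open>Follows from boundedness of \<open>D\<close> alone. Crude in its dependence on the
  boundary distance, it nevertheless confines every disc to a small neighbourhood of its centre,
  uniformly in the disc. \<open>M + 1\<close> provides the strict bound that Schwarz asks
  for.\<close>

lemma disc_lipschitz:
  assumes "holo_disc D f" "cmod \<zeta> < 1"
  shows "norm (f \<zeta> - f 0) \<le> real CARD('n) * (M + 1) * cmod \<zeta>"
proof -
  have "norm (f \<zeta> - f 0) \<le> real CARD('n) * (M + 1) * cmod \<zeta> / 1"
  proof (rule Schwarz_bound_vec)
    show "norm (f \<zeta> - f 0) < M + 1" if "cmod \<zeta> < 1" for \<zeta>
      using diam[of "f 0" "f \<zeta>"] holo_disc_in[OF assms(1)] D_sub_cl that by fastforce
  qed (use assms in \<open>auto simp: holo_disc_def\<close>)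
  then show ?thesis by simp
qed

text \<open>Let \<open>h\<close> be the corrected Levi polynomial along the disc. Borel-Caratheodory
  gives \<open>h\<close> = O(g \<zeta>), in particular a lower bound for its real part; inserted
  into \<open>key\<close> this bounds the displacement by O(sqrt g), and Schwarz restores the factor
  \<zeta>. Finally \<open>ell\<close> differs from \<open>h\<close> by terms quadratic in the
  displacement, again O(g \<zeta>).\<close>

lemma disc_estimate_near:
  "\<exists>C>0. \<exists>\<eta>>0. \<exists>s>0. \<forall>f \<zeta>. holo_disc D f \<longrightarrow> g (f 0) < \<eta> \<longrightarrow> cmod \<zeta> < s \<longrightarrow> cmod \<zeta> < 1 \<longrightarrow>
     norm (f \<zeta> - f 0) \<le> C * sqrt (g (f 0)) * cmod \<zeta> \<and> cmod (ell (f 0) (f \<zeta> - f 0)) \<le> C * g (f 0) * cmod \<zeta>"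
proof -
  obtain K c \<eta> d where K: "K > 0" and c: "c > 0" and \<eta>: "\<eta> > 0" and d: "d > 0"
    and lp: "\<And>z w. z \<in> D \<Longrightarrow> g z < \<eta> \<Longrightarrow> w \<in> D \<Longrightarrow> norm (w - z) < d \<Longrightarrow>
     Re (ell z (w - z) + qf z (w - z) (w - z) + of_real K * (ell z (w - z))\<^sup>2) + c * (norm (w - z))\<^sup>2 \<le> 2 * g z"
    using levi_polynomial by blast
  define n where "n = real CARD('n)"
  have n: "n \<ge> 1" by (simp add: n_def Suc_leI)
  \<comment> \<open>The second entry makes \<open>disc_lipschitz\<close> keep the disc within
    distance \<open>d\<close> of its centre, where \<open>lp\<close> applies.\<close>
  define R where "R = min (1/2) (d / (n * (M + 1)))"
  have R: "R > 0" "R < 1" "R \<le> d / (n * (M + 1))" using d n M_pos by (auto simp: R_def)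
  define C1 where "C1 = n * (3 / sqrt c) / (R / 2)"
  have C1: "C1 > 0" using n c R by (simp add: C1_def)
  define C2 where "C2 = 12 / R + (M + 4 * K * M\<^sup>2) * C1\<^sup>2"
  have C2: "C2 > 0" unfolding C2_def using R K M_pos C1 by (intro add_pos_pos mult_pos_pos) auto
  have main: "norm (f \<zeta> - f 0) \<le> (C1 + C2) * sqrt (g (f 0)) * cmod \<zeta> \<and> cmod (ell (f 0) (f \<zeta> - f 0)) \<le> (C1 + C2) * g (f 0) * cmod \<zeta>"
    if f: "holo_disc D f" and gz: "g (f 0) < \<eta>" and \<zeta>: "cmod \<zeta> < R / 2" for f \<zeta>
  proof -
    define z where "z = f 0"
    have z: "z \<in> D" using holo_disc_in[OF f, of 0] by (simp add: z_def)
    have g0: "g z > 0" using g_pos[OF z] .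
    define h where "h = (\<lambda>\<zeta>. ell z (f \<zeta> - z) + qf z (f \<zeta> - z) (f \<zeta> - z) + of_real K * (ell z (f \<zeta> - z))\<^sup>2)"
    have inD: "f x \<in> D" if "cmod x < R" for x using holo_disc_in[OF f] that R by simp
    have small: "norm (f x - z) < d" if "cmod x < R" for x
    proof -
      have "norm (f x - z) \<le> n * (M + 1) * cmod x" using disc_lipschitz[OF f, of x] that R by (simp add: n_def z_def)
      also have "\<dots> < n * (M + 1) * R" using that n M_pos by (intro mult_strict_left_mono) auto
      also have "\<dots> \<le> d"
        using R(3) n M_pos pos_le_divide_eq[of "n * (M + 1)" R d] by (simp add: mult.commute)
      finally show ?thesis .
    qed
    have key: "Re (h x) + c * (norm (f x - z))\<^sup>2 \<le> 2 * g z" if "cmod x < R" for x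
      unfolding h_def using lp[OF z _ inD[OF that] small[OF that]] gz by (simp add: z_def)
    have hk: "(\<lambda>\<zeta>. (f \<zeta> - z) $ k) holomorphic_on ball 0 R" for k
    proof -
      have "(\<lambda>\<zeta>. f \<zeta> $ k) holomorphic_on ball 0 R"
        using f R holomorphic_on_subset[of "\<lambda>\<zeta>. f \<zeta> $ k" "ball 0 1" "ball 0 R"] by (auto simp: holo_disc_def subset_ball)
      then show ?thesis by (auto intro!: holomorphic_intros)
    qed
    have holh: "h holomorphic_on ball 0 R" unfolding h_def
      by (intro holomorphic_intros holomorphic_complex_linear[OF ell_linear hk]
            holomorphic_complex_bilinear[OF qf_linear1 qf_linear2 hk])
    have h0: "h 0 = 0"
    proof -
      have "ell z 0 = 0" using ell_diff[of z 0 0] by simp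
      moreover have "qf z 0 0 = 0" using cmod_qf_le[of z 0] by simp
      ultimately show ?thesis by (simp add: h_def z_def)
    qed
    \<comment> \<open>A bound of \<open>3 * g z\<close> replaces the available
      \<open>2 * g z\<close> because strictness is required.\<close>
    have hb: "cmod (h x) \<le> 4 * (3 * g z) * cmod x / R" if "cmod x \<le> R / 2" for x
    proof (rule Borel_Caratheodory_half[OF holh h0 R(1)])
      show "Re (h x) < 3 * g z" if "cmod x < R" for x
        using key[OF that] g0 mult_nonneg_nonneg[OF less_imp_le[OF c] zero_le_power2, of "norm (f x - z)"] by linarith
    qed (use g0 that in auto)
    have sq: "norm (f x - z) < 3 / sqrt c * sqrt (g z)" if x: "cmod x < R / 2" for x
    proof -
      have "4 * (3 * g z) * cmod x / R \<le> 6 * g z" using x R g0 by (simp add: field_simps)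
      then have "cmod (h x) \<le> 6 * g z" using hb[of x] x by linarith
      then have "c * (norm (f x - z))\<^sup>2 \<le> 8 * g z" using key[of x] x R abs_Re_le_cmod[of "h x"] by auto
      then have "c * (norm (f x - z))\<^sup>2 < 9 * g z" using g0 by linarith
      then have "(norm (f x - z))\<^sup>2 < (3 / sqrt c * sqrt (g z))\<^sup>2"
        using c g0 by (simp add: power_mult_distrib power_divide field_simps)
      then show ?thesis by (rule power2_less_imp_less) (use c g0 in simp)
    qed
    have "norm (f \<zeta> - f 0) \<le> real CARD('n) * (3 / sqrt c * sqrt (g z)) * cmod \<zeta> / (R / 2)"
    proof (rule Schwarz_bound_vec)
      show "norm (f x - f 0) < 3 / sqrt c * sqrt (g z)" if "cmod x < R / 2" for x
        using sq[OF that] by (simp add: z_def)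
      show "(\<lambda>\<zeta>. f \<zeta> $ k) holomorphic_on ball 0 (R / 2)" for k
        using f R holomorphic_on_subset[of "\<lambda>\<zeta>. f \<zeta> $ k" "ball 0 1" "ball 0 (R / 2)"] by (auto simp: holo_disc_def subset_ball)
    qed (use R \<zeta> in auto)
    also have "\<dots> = C1 * sqrt (g z) * cmod \<zeta>" by (simp add: C1_def n_def field_simps)
    finally have v: "norm (f \<zeta> - z) \<le> C1 * sqrt (g z) * cmod \<zeta>" by (simp add: z_def)
    have "(norm (f \<zeta> - z))\<^sup>2 \<le> (C1 * sqrt (g z) * cmod \<zeta>)\<^sup>2" using v by (intro power_mono) auto
    also have "\<dots> = C1\<^sup>2 * g z * (cmod \<zeta> * cmod \<zeta>)" using g0 by (intro power2_mult_sqrt) auto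
    also have "\<dots> \<le> C1\<^sup>2 * g z * (1 * cmod \<zeta>)" using g0 \<zeta> R by (intro mult_left_mono mult_right_mono) (auto simp: mult_le_0_iff)
    finally have v2: "(norm (f \<zeta> - z))\<^sup>2 \<le> C1\<^sup>2 * g z * cmod \<zeta>" by simp
    define v where "v = f \<zeta> - z"
    have "cmod (ell z v) \<le> 2 * M * norm v" using ell_le[OF z] .
    then have "(cmod (ell z v))\<^sup>2 \<le> (2 * M * norm v)\<^sup>2" by (intro power_mono) auto
    then have l2: "K * (cmod (ell z v))\<^sup>2 \<le> K * (4 * M\<^sup>2 * (norm v)\<^sup>2)" using K
      by (intro mult_left_mono) (auto simp: power_mult_distrib)
    have "ell z v = h \<zeta> - qf z v v - of_real K * (ell z v)\<^sup>2" by (simp add: h_def v_def)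
    then have "cmod (ell z v) \<le> cmod (h \<zeta>) + cmod (qf z v v) + cmod (of_real K * (ell z v)\<^sup>2)"
      by (metis (no_types, opaque_lifting) norm_triangle_ineq4 add_right_mono order_trans)
    also have "cmod (of_real K * (ell z v)\<^sup>2) = K * (cmod (ell z v))\<^sup>2" using K by (simp add: norm_mult norm_power)
    finally have "cmod (ell z v) \<le> 12 / R * g z * cmod \<zeta> + (M + 4 * K * M\<^sup>2) * (norm v)\<^sup>2"
      using hb[of \<zeta>] \<zeta> qf_le[OF z, of v] l2 by (simp add: algebra_simps)
    also have "\<dots> \<le> 12 / R * g z * cmod \<zeta> + (M + 4 * K * M\<^sup>2) * (C1\<^sup>2 * g z * cmod \<zeta>)"
      using v2 M_pos K by (intro add_left_mono mult_left_mono) (auto simp: v_def)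
    also have "\<dots> = C2 * g z * cmod \<zeta>" by (simp add: C2_def algebra_simps)
    finally have l: "cmod (ell z v) \<le> C2 * g z * cmod \<zeta>" .
    have "C1 * sqrt (g z) * cmod \<zeta> \<le> (C1 + C2) * sqrt (g z) * cmod \<zeta>" "C2 * g z * cmod \<zeta> \<le> (C1 + C2) * g z * cmod \<zeta>"
      using C1 C2 g0 by (auto intro!: mult_right_mono)
    then show ?thesis using v l unfolding v_def z_def by linarith
  qed
  have "C1 + C2 > 0" "R / 2 > 0" using C1 C2 R by auto
  then show ?thesis using main \<eta> by blast
qed

text \<open>Removes the restriction to the boundary layer: for \<open>g \<ge> \<eta>\<close> the
  Lipschitz bound is multiplied by \<open>sqrt (g / \<eta>)\<close> or \<open>g / \<eta>\<close>,
  which are at least 1. The estimate for the change of \<open>g\<close> is the Taylor formula, since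
  \<open>Dr\<close> is the real part of \<open>ell\<close> and the remainder is quadratic.\<close>

lemma disc_estimate:
  "\<exists>C\<ge>1. \<exists>s>0. s < 1 \<and> C * s \<le> 1 / 2 \<and> (\<forall>f \<zeta>. holo_disc D f \<longrightarrow> cmod \<zeta> \<le> s \<longrightarrow>
     norm (f \<zeta> - f 0) \<le> C * sqrt (g (f 0)) * cmod \<zeta> \<and> cmod (ell (f 0) (f \<zeta> - f 0)) \<le> C * g (f 0) * cmod \<zeta>
     \<and> \<bar>g (f \<zeta>) - g (f 0)\<bar> \<le> C * g (f 0) * cmod \<zeta>)"
proof -
  obtain C1 \<eta> s1 where C1: "C1 > 0" and \<eta>: "\<eta> > 0" and s1: "s1 > 0"
    and near: "\<And>f \<zeta>. holo_disc D f \<Longrightarrow> g (f 0) < \<eta> \<Longrightarrow> cmod \<zeta> < s1 \<Longrightarrow> cmod \<zeta> < 1 \<Longrightarrow>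
     norm (f \<zeta> - f 0) \<le> C1 * sqrt (g (f 0)) * cmod \<zeta> \<and> cmod (ell (f 0) (f \<zeta> - f 0)) \<le> C1 * g (f 0) * cmod \<zeta>"
    using disc_estimate_near by blast
  define L where "L = real CARD('n) * (M + 1)"
  have L: "L > 0" using M_pos by (simp add: L_def)
  define C2 where "C2 = C1 + L / sqrt \<eta> + 2 * M * L / \<eta>"
  have C2: "C2 > 0" "C1 \<le> C2" "L / sqrt \<eta> \<le> C2" "2 * M * L / \<eta> \<le> C2"
    using C1 L \<eta> M_pos by (auto simp: C2_def add_pos_pos)
  define C where "C = 1 + C2 + M * C2\<^sup>2"
  have MC: "M * C2\<^sup>2 \<ge> 0" using M_pos by simp
  have C: "C \<ge> 1" "C2 \<le> C" "C2 + M * C2\<^sup>2 \<le> C" using C2 MC by (auto simp: C_def)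
  \<comment> \<open>The second entry gives \<open>C * s \<le> 1 / 2\<close>: one link lowers
    \<open>g\<close> by at most half, which the multiplicative comparison along a chain
    needs.\<close>
  define s where "s = min (s1 / 2) (1 / (2 * C))"
  have s: "s > 0" "s < s1" "s \<le> 1 / (2 * C)" using s1 C by (auto simp: s_def)
  have Cs: "C * s \<le> 1 / 2" using s(3) C by (simp add: field_simps)
  have "s \<le> C * s" using C(1) s(1) by (simp add: mult_le_cancel_right1)
  then have sl: "s < 1" using Cs by linarith
  have main: "norm (f \<zeta> - f 0) \<le> C * sqrt (g (f 0)) * cmod \<zeta> \<and> cmod (ell (f 0) (f \<zeta> - f 0)) \<le> C * g (f 0) * cmod \<zeta>
     \<and> \<bar>g (f \<zeta>) - g (f 0)\<bar> \<le> C * g (f 0) * cmod \<zeta>" if f: "holo_disc D f" and \<zeta>: "cmod \<zeta> \<le> s" for f \<zeta>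
  proof -
    define z where "z = f 0"
    define v where "v = f \<zeta> - z"
    have z: "z \<in> D" using holo_disc_in[OF f, of 0] by (simp add: z_def)
    have w: "f \<zeta> \<in> D" using holo_disc_in[OF f] \<zeta> sl by simp
    have g0: "g z > 0" using g_pos[OF z] .
    have A: "norm v \<le> C2 * sqrt (g z) * cmod \<zeta> \<and> cmod (ell z v) \<le> C2 * g z * cmod \<zeta>"
    proof (cases "g z < \<eta>")
      case True
      then have "norm v \<le> C1 * sqrt (g z) * cmod \<zeta> \<and> cmod (ell z v) \<le> C1 * g z * cmod \<zeta>"
        using near[OF f, of \<zeta>] \<zeta> s sl by (simp add: z_def v_def)
      moreover have "C1 * sqrt (g z) * cmod \<zeta> \<le> C2 * sqrt (g z) * cmod \<zeta>" "C1 * g z * cmod \<zeta> \<le> C2 * g z * cmod \<zeta>"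
        using C2 g0 by (auto intro!: mult_right_mono)
      ultimately show ?thesis by linarith
    next
      case False
      have vL: "norm v \<le> L * cmod \<zeta>" using disc_lipschitz[OF f, of \<zeta>] \<zeta> sl by (simp add: z_def v_def L_def)
      have "1 \<le> sqrt (g z) / sqrt \<eta>" using False \<eta> by simp
      then have "L * cmod \<zeta> * 1 \<le> L * cmod \<zeta> * (sqrt (g z) / sqrt \<eta>)" using L by (intro mult_left_mono) auto
      also have "\<dots> = L / sqrt \<eta> * sqrt (g z) * cmod \<zeta>" by simp
      also have "\<dots> \<le> C2 * sqrt (g z) * cmod \<zeta>" using C2 g0 by (intro mult_right_mono) auto
      finally have 1: "norm v \<le> C2 * sqrt (g z) * cmod \<zeta>" using vL by simp
      have "cmod (ell z v) \<le> 2 * M * norm v" using ell_le[OF z] .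
      also have "\<dots> \<le> 2 * M * (L * cmod \<zeta>)" using vL M_pos by (intro mult_left_mono) auto
      finally have 2: "cmod (ell z v) \<le> 2 * M * L * cmod \<zeta> * 1" by simp
      have "1 \<le> g z / \<eta>" using False \<eta> pos_le_divide_eq[of \<eta> 1 "g z"] by linarith
      then have "2 * M * L * cmod \<zeta> * 1 \<le> 2 * M * L * cmod \<zeta> * (g z / \<eta>)" using L M_pos by (intro mult_left_mono) auto
      also have "\<dots> = 2 * M * L / \<eta> * g z * cmod \<zeta>" by simp
      also have "\<dots> \<le> C2 * g z * cmod \<zeta>" using C2 g0 by (intro mult_right_mono) auto
      finally show ?thesis using 1 2 by linarith
    qed
    have "(norm v)\<^sup>2 \<le> (C2 * sqrt (g z) * cmod \<zeta>)\<^sup>2" using A by (intro power_mono) auto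
    also have "\<dots> = C2\<^sup>2 * g z * (cmod \<zeta> * cmod \<zeta>)" using g0 by (intro power2_mult_sqrt) auto
    also have "\<dots> \<le> C2\<^sup>2 * g z * (1 * cmod \<zeta>)" using g0 \<zeta> sl by (intro mult_left_mono mult_right_mono) (auto simp: mult_le_0_iff)
    finally have "(norm v)\<^sup>2 \<le> C2\<^sup>2 * g z * cmod \<zeta>" by simp
    then have "M * (norm v)\<^sup>2 \<le> M * (C2\<^sup>2 * g z * cmod \<zeta>)" using M_pos by (intro mult_left_mono) auto
    moreover have "\<bar>Dr z v\<bar> \<le> cmod (ell z v)" using abs_Re_le_cmod[of "ell z v"] by (simp add: ell_def)
    moreover have "\<bar>r (f \<zeta>) - r z - Dr z v\<bar> \<le> M * (norm v)\<^sup>2" using taylor_D[OF D_sub_cl[OF z] D_sub_cl[OF w]] by (simp add: v_def)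
    moreover have "(C2 + M * C2\<^sup>2) * g z * cmod \<zeta> = C2 * g z * cmod \<zeta> + M * (C2\<^sup>2 * g z * cmod \<zeta>)"
      by (simp add: algebra_simps)
    ultimately have "\<bar>g (f \<zeta>) - g z\<bar> \<le> (C2 + M * C2\<^sup>2) * g z * cmod \<zeta>" using A by linarith
    also have "\<dots> \<le> C * g z * cmod \<zeta>" using C g0 by (intro mult_right_mono) auto
    finally have G: "\<bar>g (f \<zeta>) - g z\<bar> \<le> C * g z * cmod \<zeta>" .
    have "C2 * sqrt (g z) * cmod \<zeta> \<le> C * sqrt (g z) * cmod \<zeta>" "C2 * g z * cmod \<zeta> \<le> C * g z * cmod \<zeta>"
      using C g0 by (auto intro!: mult_right_mono)
    then show ?thesis using A G unfolding v_def z_def by linarith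
  qed
  show ?thesis
    by (rule exI[of _ C], rule conjI[OF C(1)], rule exI[of _ s]) (use s(1) sl Cs main in blast)
qed

text \<open>Induction over the links. Each is estimated at its own starting point \<open>y\<close>
  and then referred back to \<open>x\<close>: \<open>g y\<close> is at most \<open>Q * g x\<close>,
  and replacing \<open>ell y\<close> by \<open>ell x\<close> costs the product of two displacements
  of size sqrt g. Since all increments are linear in the link length \<open>a\<close>, they add up
  to \<open>d\<close>.\<close>

lemma path_estimate:
  assumes C: "C \<ge> 1" and s: "s > 0" "s < 1" "C * s \<le> 1 / 2"
    and est: "\<And>f \<zeta>. holo_disc D f \<Longrightarrow> cmod \<zeta> \<le> s \<Longrightarrow>
     norm (f \<zeta> - f 0) \<le> C * sqrt (g (f 0)) * cmod \<zeta> \<and> cmod (ell (f 0) (f \<zeta> - f 0)) \<le> C * g (f 0) * cmod \<zeta>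
     \<and> \<bar>g (f \<zeta>) - g (f 0)\<bar> \<le> C * g (f 0) * cmod \<zeta>"
    and path: "kpath D s x y d" and dR: "d \<le> R"
  defines "Q \<equiv> exp (2 * C * R)"
  shows "g y \<le> exp (2 * C * d) * g x \<and> g x \<le> exp (2 * C * d) * g y \<and>
    norm (y - x) \<le> C * Q * d * sqrt (g x) \<and>
    cmod (ell x (y - x)) \<le> (C * Q + 2 * M * (C * Q * R) * (C * Q)) * d * g x"
  using path dR
proof (induction rule: kpath.induct)
  case refl
  then show ?case using ell_diff[of x 0 0] by simp
next
  case (step f d t)
  define y where "y = f 0"
  define w where "w = f (of_real t)"
  define a where "a = artanh t"
  have x: "x \<in> D" and y: "y \<in> D" using kpath_in[OF step.hyps(1)] by (auto simp: y_def)
  have w: "w \<in> D" using holo_disc_in[OF step.hyps(2)] step.hyps by (simp add: w_def)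
  have ta: "t \<le> a" using artanh_ge_self step.hyps by (simp add: a_def)
  then have ts: "t \<le> s" using step.hyps by (simp add: a_def)
  have a0: "a \<ge> 0" and t0: "t \<ge> 0" using step.hyps ta by auto
  have d0: "d \<ge> 0" using kpath_nonneg step.hyps by blast
  have dR: "d \<le> R" "d + a \<le> R" using step.prems a0 by (auto simp: a_def)
  have IH: "g y \<le> exp (2 * C * d) * g x" "g x \<le> exp (2 * C * d) * g y"
    "norm (y - x) \<le> C * Q * d * sqrt (g x)"
    "cmod (ell x (y - x)) \<le> (C * Q + 2 * M * (C * Q * R) * (C * Q)) * d * g x"
    using step.IH dR by (auto simp: y_def)
  have E: "norm (w - y) \<le> C * sqrt (g y) * t" "cmod (ell y (w - y)) \<le> C * g y * t" "\<bar>g w - g y\<bar> \<le> C * g y * t"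
    using est[OF step.hyps(2), of "of_real t"] ts t0 by (auto simp: y_def w_def)
  have gx: "g x > 0" and gy: "g y > 0" and gw: "g w > 0" using g_pos x y w by auto
  have Q1: "Q \<ge> 1" using C dR d0 by (simp add: Q_def)
  have edQ: "exp (2 * C * d) \<le> Q" using C dR by (simp add: Q_def)
  have gyQ: "g y \<le> Q * g x" using IH(1) mult_right_mono[OF edQ, of "g x"] gx by linarith
  define u where "u = C * t"
  have u: "0 \<le> u" "u \<le> 1 / 2" "u \<le> C * a"
    using C t0 s mult_left_mono[OF ts, of C] mult_left_mono[OF ta, of C] unfolding u_def by (simp, linarith, simp)
  have gwy: "g w \<le> (1 + u) * g y" "(1 - u) * g y \<le> g w" using E(3) by (auto simp: u_def algebra_simps)
  have "1 + u \<le> exp u" "1 + 2 * u \<le> exp (2 * u)" using exp_ge_add_one_self by auto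
  moreover have "exp u \<le> exp (2 * C * a)" "exp (2 * u) \<le> exp (2 * C * a)" using u by auto
  ultimately have ex: "1 + u \<le> exp (2 * C * a)" "1 + 2 * u \<le> exp (2 * C * a)" by linarith+
  have "g w \<le> exp (2 * C * a) * g y" using gwy mult_right_mono[OF ex(1), of "g y"] gy by linarith
  also have "\<dots> \<le> exp (2 * C * a) * (exp (2 * C * d) * g x)" using IH(1) by (intro mult_left_mono) auto
  also have "\<dots> = exp (2 * C * (d + a)) * g x" by (simp add: exp_add[symmetric] algebra_simps flip: mult.assoc)
  finally have 1: "g w \<le> exp (2 * C * (d + a)) * g x" .
  \<comment> \<open>For \<open>u \<le> 1 / 2\<close> the inverse of 1 - u is at most 1 + 2 u; this
    is why the exponent carries a factor 2.\<close>
  have "u * u \<le> u * (1 / 2)" using u by (intro mult_left_mono) auto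
  then have "1 \<le> (1 + 2 * u) * (1 - u)" using u by (simp add: algebra_simps)
  then have "1 * g y \<le> (1 + 2 * u) * (1 - u) * g y" using gy by (intro mult_right_mono) auto
  also have "\<dots> \<le> (1 + 2 * u) * g w" using gwy(2) u mult_left_mono[OF gwy(2), of "1 + 2 * u"] by (simp add: mult.assoc)
  also have "\<dots> \<le> exp (2 * C * a) * g w" using ex(2) gw by (intro mult_right_mono) auto
  finally have "exp (2 * C * d) * g y \<le> exp (2 * C * d) * (exp (2 * C * a) * g w)" by simp
  also have "\<dots> = exp (2 * C * (d + a)) * g w" by (simp add: exp_add[symmetric] algebra_simps flip: mult.assoc)
  finally have 2: "g x \<le> exp (2 * C * (d + a)) * g w" using IH(2) by linarith
  \<comment> \<open>\<open>Q \<ge> 1\<close> allows the weaker constant \<open>Q\<close> in place of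
    its square root.\<close>
  have "sqrt (g y) \<le> sqrt (Q\<^sup>2 * g x)"
  proof -
    have "Q * g x \<le> Q\<^sup>2 * g x" using Q1 gx by (simp add: power2_eq_square)
    then show ?thesis using gyQ by simp
  qed
  also have "\<dots> = Q * sqrt (g x)" unfolding real_sqrt_mult using Q1 by simp
  finally have sy: "sqrt (g y) \<le> Q * sqrt (g x)" .
  have "C * sqrt (g y) * t \<le> C * (Q * sqrt (g x)) * a"
    using sy C t0 ta gy Q1 gx by (intro mult_mono) auto
  then have nwy: "norm (w - y) \<le> C * Q * a * sqrt (g x)" using E(1) by (simp add: algebra_simps)
  have 3: "norm (w - x) \<le> C * Q * (d + a) * sqrt (g x)"
    using norm_triangle_ineq[of "w - y" "y - x"] nwy IH(3) by (simp add: algebra_simps)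
  have "C * g y * t \<le> C * (Q * g x) * a" using gyQ C t0 ta gy Q1 gx by (intro mult_mono) (auto simp: mult_le_0_iff)
  then have l1: "cmod (ell y (w - y)) \<le> C * Q * a * g x" using E(2) by (simp add: algebra_simps)
  have "norm (x - y) \<le> C * Q * R * sqrt (g x)"
  proof -
    have "C * Q * d * sqrt (g x) \<le> C * Q * R * sqrt (g x)" using C Q1 dR gx by (intro mult_right_mono mult_left_mono) auto
    then show ?thesis using IH(3) by (simp add: norm_minus_commute)
  qed
  moreover have "R \<ge> 0" using dR d0 by linarith
  ultimately have "2 * (M * norm (x - y)) * norm (w - y) \<le> 2 * (M * (C * Q * R * sqrt (g x))) * (C * Q * a * sqrt (g x))"
    using nwy M_pos C Q1 gx a0 by (intro mult_mono) auto
  also have "\<dots> = 2 * M * (C * Q * R) * (C * Q) * a * (sqrt (g x) * sqrt (g x))" by (simp add: algebra_simps)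
  also have "sqrt (g x) * sqrt (g x) = g x" using gx by simp
  finally have "cmod (ell x (w - y) - ell y (w - y)) \<le> 2 * M * (C * Q * R) * (C * Q) * a * g x"
    using ell_lip[OF x y, of "w - y"] by linarith
  then have "cmod (ell x (w - y)) \<le> C * Q * a * g x + 2 * M * (C * Q * R) * (C * Q) * a * g x"
    using l1 norm_triangle_sub[of "ell x (w - y)" "ell y (w - y)"] by linarith
  moreover have "ell x (w - x) = ell x (w - y) + ell x (y - x)" by (simp add: ell_diff)
  ultimately have 4: "cmod (ell x (w - x)) \<le> (C * Q + 2 * M * (C * Q * R) * (C * Q)) * (d + a) * g x"
    using norm_triangle_ineq[of "ell x (w - y)" "ell x (y - x)"] IH(4) by (simp add: algebra_simps)
  show ?case using 1 2 3 4 by (simp add: w_def a_def)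
qed

section \<open>Slabs around and inside Kobayashi balls\<close>

lemma kobayashi_ball_outer:
  assumes "R > 0"
  shows "\<exists>Q\<ge>1. \<forall>x\<in>D. \<forall>y\<in>D. kobayashi_dist D x y < R \<longrightarrow>
    g y \<le> Q * g x \<and> g x \<le> Q * g y \<and> norm (y - x) \<le> Q * sqrt (g x) \<and> cmod (ell x (y - x)) \<le> Q * g x"
proof -
  obtain C s where C: "C \<ge> 1" and s: "s > 0" "s < 1" "C * s \<le> 1 / 2"
    and est: "\<And>f \<zeta>. holo_disc D f \<Longrightarrow> cmod \<zeta> \<le> s \<Longrightarrow>
     norm (f \<zeta> - f 0) \<le> C * sqrt (g (f 0)) * cmod \<zeta> \<and> cmod (ell (f 0) (f \<zeta> - f 0)) \<le> C * g (f 0) * cmod \<zeta>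
     \<and> \<bar>g (f \<zeta>) - g (f 0)\<bar> \<le> C * g (f 0) * cmod \<zeta>"
    using disc_estimate by blast
  define E where "E = exp (2 * C * R)"
  define B where "B = C * E + 2 * M * (C * E * R) * (C * E)"
  have pos: "E \<ge> 1" "C * E * R \<ge> 0" "B * R \<ge> 0" "B \<ge> 0" "C * E \<ge> 0" using C assms M_pos by (auto simp: E_def B_def)
  define Q where "Q = E + C * E * R + B * R"
  have Q: "Q \<ge> 1" "E \<le> Q" "C * E * R \<le> Q" "B * R \<le> Q" using pos by (auto simp: Q_def)
  have main: "g y \<le> Q * g x \<and> g x \<le> Q * g y \<and> norm (y - x) \<le> Q * sqrt (g x) \<and> cmod (ell x (y - x)) \<le> Q * g x"
    if x: "x \<in> D" and y: "y \<in> D" and k: "kobayashi_dist D x y < R" for x y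
  proof -
    obtain d where d: "kreach D x y d" "d < R" using kobayashi_dist_lessD[OF open_D connected_D x y k] .
    have p: "kpath D s x y d" using kreach_imp_kpath[OF d(1) s(1)] .
    have d0: "d \<ge> 0" using kpath_nonneg[OF p] .
    note P = path_estimate[OF C s est p less_imp_le[OF d(2)], folded E_def, folded B_def]
    have gx: "g x > 0" and gy: "g y > 0" using g_pos x y by auto
    have ed: "exp (2 * C * d) \<le> E" using d C by (simp add: E_def)
    have m: "exp (2 * C * d) \<le> Q" "C * E * d \<le> Q" "B * d \<le> Q"
      using ed Q mult_left_mono[of d R "C * E"] mult_left_mono[of d R B] d(2) pos by linarith+
    have "exp (2 * C * d) * g x \<le> Q * g x" "exp (2 * C * d) * g y \<le> Q * g y"
      "C * E * d * sqrt (g x) \<le> Q * sqrt (g x)" "B * d * g x \<le> Q * g x"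
      using m gx gy by (auto intro!: mult_right_mono)
    then show ?thesis using P by linarith
  qed
  then show ?thesis using Q(1) by blast
qed

text \<open>The affine disc through \<open>x\<close> that reaches \<open>y\<close> at parameter
  \<open>t\<close> stays in \<open>D\<close>: by Taylor, \<open>r\<close> rises along it by less
  than one third of \<open>g x\<close> through the linear term and less than one third through the
  quadratic one.\<close>

lemma kobayashi_ball_inner:
  assumes "R > 0"
  shows "\<exists>q>0. \<forall>x\<in>D. \<forall>y. norm (y - x) < q * sqrt (g x) \<longrightarrow> cmod (ell x (y - x)) < q * g x \<longrightarrow>
    y \<in> D \<and> kobayashi_dist D x y < R"
proof -
  define t where "t = tanh (R / 2)"
  have t: "0 < t" "t < 1" "artanh t < R" using assms by (auto simp: t_def artanh_tanh_real tanh_real_lt_1)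
  \<comment> \<open>As \<open>sqrt (g x) \<le> M\<close>, the entry \<open>e / M\<close> keeps the
    disc in the Taylor range; \<open>1 / (3 * M)\<close> yields the two thirds.\<close>
  define q where "q = t * min (e / M) (1 / (3 * M))"
  have q: "q > 0" using t e_pos M_pos by (simp add: q_def)
  have q1: "q * M \<le> t * e"
  proof -
    have "q \<le> t * (e / M)" unfolding q_def using t by (intro mult_left_mono) auto
    then show ?thesis using M_pos by (simp add: field_simps)
  qed
  have q2: "3 * M * q \<le> t"
  proof -
    have "q \<le> t * (1 / (3 * M))" unfolding q_def using t by (intro mult_left_mono) auto
    then show ?thesis using M_pos by (simp add: field_simps)
  qed
  have main: "y \<in> D \<and> kobayashi_dist D x y < R"
    if x: "x \<in> D" and y: "norm (y - x) < q * sqrt (g x)" "cmod (ell x (y - x)) < q * g x" for x y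
  proof -
    have g0: "g x > 0" using g_pos[OF x] .
    define v where "v = of_real (1 / t) *s (y - x)"
    have tv: "of_real t *s v = y - x" using t by (simp add: v_def vec_eq_iff)
    have nv: "t * norm v < q * sqrt (g x)" using y(1) t unfolding tv[symmetric] norm_vector_scalar_mult_complex by simp
    have ls: "ell x (c *s v) = c * ell x v" for c
      using ell_linear[of x c v 0] ell_diff[of x 0 0] by simp
    have lv: "t * cmod (ell x v) < q * g x" using y(2) t unfolding tv[symmetric] ls by (simp add: norm_mult)
    have "q * sqrt (g x) \<le> q * M" using sqrt_g_le[OF x] q by (intro mult_left_mono) auto
    then have "t * norm v \<le> t * e" using q1 nv by linarith
    then have ve: "norm v \<le> e" using t by simp
    have qM: "q \<le> 3 * M * q" "q * 3 \<le> 3 * M * q" using M_ge1 q by auto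
    have "t * (3 * cmod (ell x v)) < 3 * q * g x" using lv by simp
    also have "\<dots> \<le> t * g x" using q2 qM g0 by (intro mult_right_mono) auto
    finally have "t * (3 * cmod (ell x v)) < t * g x" .
    then have l3: "3 * cmod (ell x v) < g x" by (rule mult_left_less_imp_less) (use t in simp)
    have "(t * norm v)\<^sup>2 < (q * sqrt (g x))\<^sup>2" using nv t by (intro power_strict_mono) auto
    then have "t\<^sup>2 * (norm v)\<^sup>2 < q\<^sup>2 * g x" using g0 by (simp add: power_mult_distrib)
    then have "3 * M * (t\<^sup>2 * (norm v)\<^sup>2) < 3 * M * (q\<^sup>2 * g x)" using M_pos by (intro mult_strict_left_mono) auto
    also have "\<dots> = (3 * M * q) * q * g x" by (simp add: power2_eq_square)
    also have "\<dots> \<le> t * t * g x"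
      using q2 order_trans[OF qM(1) q2] q t g0 by (intro mult_right_mono[of _ _ "g x"] mult_mono) auto
    finally have "t\<^sup>2 * (3 * M * (norm v)\<^sup>2) < t\<^sup>2 * g x" by (simp add: power2_eq_square algebra_simps)
    then have n3: "3 * M * (norm v)\<^sup>2 < g x" by (rule mult_left_less_imp_less) simp
    have inD: "x + \<zeta> *s v \<in> D" if \<zeta>: "cmod \<zeta> < 1" for \<zeta>
    proof -
      define w where "w = \<zeta> *s v"
      have nw: "norm w \<le> norm v" unfolding w_def norm_vector_scalar_mult_complex
        using \<zeta> mult_left_le_one_le[of "norm v" "cmod \<zeta>"] by simp
      have lw: "cmod (ell x w) \<le> cmod (ell x v)" unfolding w_def ls norm_mult
        using \<zeta> mult_left_le_one_le[of "cmod (ell x v)" "cmod \<zeta>"] by simp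
      have T: "x + w \<in> U" "\<bar>r (x + w) - r x - Dr x w\<bar> \<le> M * (norm w)\<^sup>2"
        using taylor1[OF D_sub_cl[OF x], of w] nw ve by auto
      have "Dr x w \<le> cmod (ell x w)" using complex_Re_le_cmod[of "ell x w"] by (simp add: ell_def)
      moreover have "M * (norm w)\<^sup>2 \<le> M * (norm v)\<^sup>2" using nw M_pos by (intro mult_left_mono power_mono) auto
      ultimately have "r (x + w) < 0" using T(2) l3 n3 lw g0 by linarith
      then show ?thesis using T(1) D_eq by (auto simp: w_def)
    qed
    have "kreach D x (x + of_real t *s v) (artanh t)" by (rule linear_disc) (use inD t in auto)
    then have k: "kreach D x y (artanh t)" by (simp add: tv)
    have "x + of_real t *s v \<in> D" by (rule inD) (use t in simp)
    then have "y \<in> D" by (simp add: tv)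
    then show ?thesis using kobayashi_dist_le[OF k] t by simp
  qed
  then show ?thesis using q by blast
qed

end

subsection \<open>Volumes of Kobayashi balls and of boundary layers\<close>

lemma measure_mono_open:
  fixes A B :: "'a::euclidean_space set"
  assumes "open A" "open B" "bounded B" "A \<subseteq> B"
  shows "measure lborel A \<le> measure lborel B"
proof -
  have "measure lebesgue A \<le> measure lebesgue B"
    by (rule measure_mono_fmeasurable) (use assms in \<open>auto intro: lmeasurable_open\<close>)
  then show ?thesis using assms by (simp add: measure_completion)
qed

lemma measure_translate_open:
  fixes S :: "'a::euclidean_space set"
  assumes "open S"
  shows "measure lborel ((+) x ` S) = measure lborel S"
  using measure_translation[of x S] assms by (simp add: measure_completion open_translation)

lemma power_sqrt_even: "0 \<le> \<gamma> \<Longrightarrow> (a * sqrt \<gamma>) ^ (2 * n) = a ^ (2 * n) * \<gamma> ^ n"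
  by (simp add: power_mult_distrib power_mult)

context spc_bounds
begin

text \<open>The anisotropic model of a Kobayashi ball, centred at the origin; its translate by
  \<open>x\<close> is what is compared with the ball.\<close>

definition slab :: "complex ^ 'n \<Rightarrow> real \<Rightarrow> (complex ^ 'n) set" where
  "slab x q = {v. cmod (ell x v) < q * g x \<and> norm v < q * sqrt (g x)}"

lemma open_slab: "open (slab x q)"
  unfolding slab_def using continuous_ell
  by (intro open_Collect_conj open_Collect_less) (auto intro!: continuous_intros)

lemma bounded_slab: "bounded (slab x q)"
  by (rule bounded_subset[OF bounded_ball[of 0 "q * sqrt (g x)"]]) (auto simp: slab_def)

lemma unit_normal: 
  assumes "c < norm (Dr x)" "0 \<le> c" obtains u where "norm u = 1" "c < Dr x u"
proof -
  have "\<exists>v. \<not> norm (Dr x v) \<le> c * norm v" using norm_blinfun_bound[of c "Dr x"] assms by force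
  then obtain v where v: "c * norm v < \<bar>Dr x v\<bar>" by (metis not_le real_norm_def)
  then have v0: "v \<noteq> 0" by auto
  define u where "u = (sgn (Dr x v) / norm v) *\<^sub>R v"
  have "Dr x v \<noteq> 0" using v mult_nonneg_nonneg[OF assms(2) norm_ge_zero[of v]] by linarith
  then have 1: "norm u = 1" using v0 by (simp add: u_def abs_sgn_eq)
  have "Dr x u = \<bar>Dr x v\<bar> / norm v" by (simp add: u_def blinfun_linear abs_sgn mult.commute)
  then have "c < Dr x u" using v v0 pos_less_divide_eq[of "norm v" c "\<bar>Dr x v\<bar>"] by simp
  with 1 that show ?thesis by blast
qed

text \<open>In a slab of thickness q \<gamma> and radius q sqrt \<gamma>,
  \<open>slab_measure_lower\<close> yields \<gamma>^n times \<gamma>^2 / \<gamma>, that is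
  \<gamma>^(n+1). Where \<open>g \<ge> \<eta>\<close> the gradient may vanish, but then the slab
  contains a ball of fixed radius \<open>\<rho>\<close>.\<close>

lemma slab_lower:
  assumes q: "q > 0"
  shows "\<exists>c>0. \<forall>x\<in>D. c * g x ^ (CARD('n) + 1) \<le> measure lborel (slab x q)"
proof -
  let ?n = "CARD('n)"
  define V where "V = unit_ball_vol (real (2 * ?n))"
  have V: "V > 0" by (simp add: V_def)
  obtain c0 \<eta> where c0: "c0 > 0" and \<eta>: "\<eta> > 0" and gr: "\<And>z. z \<in> D \<Longrightarrow> g z < \<eta> \<Longrightarrow> c0 < norm (Dr z)"
    using grad_lower by blast
  define B where "B = 3 * (1 + 2 * M / c0)"
  have B: "B > 0" using M_pos c0 by (simp add: B_def add_pos_pos)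
  define c1 where "c1 = V * (q / B) ^ (2 * ?n) / (7 * (2 * M))\<^sup>2"
  have c1: "c1 > 0" using V q B M_pos by (simp add: c1_def)
  define \<rho> where "\<rho> = min (q * \<eta> / (2 * M)) (q * sqrt \<eta>)"
  have \<rho>: "\<rho> > 0" using q \<eta> M_pos by (simp add: \<rho>_def)
  define c2 where "c2 = V * \<rho> ^ (2 * ?n) / (M\<^sup>2) ^ (?n + 1)"
  have c2: "c2 > 0" using V \<rho> M_pos by (simp add: c2_def)
  have main: "min c1 c2 * \<gamma> ^ (?n + 1) \<le> measure lborel (slab x q)" if x: "x \<in> D" and \<gamma>: "\<gamma> = g x" for x \<gamma>
  proof -
    have g0: "\<gamma> > 0" using g_pos x \<gamma> by simp
    have gM: "\<gamma> \<le> M\<^sup>2" "sqrt \<gamma> \<le> M" using g_le[OF x] sqrt_g_le[OF x] \<gamma> by auto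
    show ?thesis
    proof (cases "\<gamma> < \<eta>")
      case True
      obtain u where u: "norm u = 1" "c0 < Dr x u" using unit_normal[OF gr[OF x]] True \<gamma> c0 by auto
      have "c0 \<le> cmod (ell x u)" using u complex_Re_le_cmod[of "ell x u"] by (simp add: ell_def)
      \<comment> \<open>The side condition \<open>a \<le> M * b\<close> of the covering argument,
        which holds because \<open>g\<close> is bounded.\<close>
      moreover have "q * \<gamma> \<le> 2 * M * (q * sqrt \<gamma>)"
      proof -
        have "\<gamma> = sqrt \<gamma> * sqrt \<gamma>" using g0 by simp
        also have "\<dots> \<le> 2 * M * sqrt \<gamma>" using gM M_pos g0 by (intro mult_right_mono) auto
        finally show ?thesis using mult_left_mono[of \<gamma> "2 * M * sqrt \<gamma>" q] q by (simp add: algebra_simps)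
      qed
      ultimately have "V * (q * sqrt \<gamma> / B) ^ (2 * ?n) * (q * \<gamma> / (7 * (2 * M)))\<^sup>2 \<le> measure lborel (slab x q) * (q * sqrt \<gamma>)\<^sup>2"
        unfolding V_def B_def slab_def \<gamma>[symmetric]
        using slab_measure_lower[of "ell x" "2 * M" u c0 "q * \<gamma>" "q * sqrt \<gamma>"] ell_linear continuous_ell ell_le[OF x] u c0 M_pos q g0
        by (simp add: mult.assoc)
      moreover have "V * (q * sqrt \<gamma> / B) ^ (2 * ?n) * (q * \<gamma> / (7 * (2 * M)))\<^sup>2 = (c1 * \<gamma> ^ (?n + 1)) * (q * sqrt \<gamma>)\<^sup>2"
      proof -
        have "(q * sqrt \<gamma> / B) ^ (2 * ?n) = (q / B) ^ (2 * ?n) * \<gamma> ^ ?n"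
          using power_sqrt_even[of \<gamma> "q / B" ?n] g0 by simp
        moreover have "(q * sqrt \<gamma>)\<^sup>2 = q\<^sup>2 * \<gamma>" using g0 by (simp add: power_mult_distrib)
        moreover have "(q * \<gamma> / (7 * (2 * M)))\<^sup>2 = q\<^sup>2 * \<gamma> * \<gamma> / (7 * (2 * M))\<^sup>2"
          by (simp add: power_divide power_mult_distrib) (simp add: power2_eq_square)
        ultimately show ?thesis by (simp add: c1_def)
      qed
      ultimately have "c1 * \<gamma> ^ (?n + 1) \<le> measure lborel (slab x q)"
        using q g0 mult_right_le_imp_le[of "c1 * \<gamma> ^ (?n + 1)" "(q * sqrt \<gamma>)\<^sup>2" "measure lborel (slab x q)"] by simp
      moreover have "min c1 c2 * \<gamma> ^ (?n + 1) \<le> c1 * \<gamma> ^ (?n + 1)" using g0 by (intro mult_right_mono) auto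
      ultimately show ?thesis by linarith
    next
      case False
      have "ball 0 \<rho> \<subseteq> slab x q"
      proof
        fix v :: "complex ^ 'n" assume "v \<in> ball 0 \<rho>"
        then have v: "norm v < \<rho>" by simp
        have "2 * M * norm v < 2 * M * \<rho>" using v M_pos by simp
        also have "\<dots> \<le> 2 * M * (q * \<eta> / (2 * M))" using M_pos by (intro mult_left_mono) (auto simp: \<rho>_def)
        also have "\<dots> = q * \<eta>" using M_pos by simp
        also have "\<dots> \<le> q * \<gamma>" using False q by simp
        finally have "cmod (ell x v) < q * \<gamma>" using ell_le[OF x, of v] by linarith
        moreover have "q * sqrt \<eta> \<le> q * sqrt \<gamma>" using False q by simp
        then have "norm v < q * sqrt \<gamma>" using v by (simp add: \<rho>_def)
        ultimately show "v \<in> slab x q" by (simp add: slab_def \<gamma>)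
      qed
      then have "measure lborel (ball (0::complex^'n) \<rho>) \<le> measure lborel (slab x q)"
        by (intro measure_mono_open open_slab bounded_slab) auto
      moreover have "measure lborel (ball (0::complex^'n) \<rho>) = V * \<rho> ^ (2 * ?n)"
        using content_ball[of \<rho> "0::complex^'n"] \<rho> by (simp add: V_def mult.commute)
      moreover have "min c1 c2 * \<gamma> ^ (?n + 1) \<le> c2 * (M\<^sup>2) ^ (?n + 1)"
        using g0 gM c1 c2 by (intro mult_mono power_mono) auto
      moreover have "c2 * (M\<^sup>2) ^ (?n + 1) = V * \<rho> ^ (2 * ?n)" using M_pos by (simp add: c2_def)
      ultimately show ?thesis by linarith
    qed
  qed
  have "min c1 c2 > 0" using c1 c2 by simp
  then show ?thesis using main by blast
qed

text \<open>The two cases of \<open>slab_lower\<close> again; away from the boundary the slab lies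
  in a ball of radius \<open>q * M\<close>, and \<gamma>^(n+1) is bounded below.\<close>

lemma slab_upper:
  assumes q: "q > 0"
  shows "\<exists>C>0. \<forall>x\<in>D. measure lborel (slab x q) \<le> C * g x ^ (CARD('n) + 1)"
proof -
  let ?n = "CARD('n)"
  define V where "V = unit_ball_vol (real (2 * ?n))"
  have V: "V > 0" by (simp add: V_def)
  obtain c0 \<eta> where c0: "c0 > 0" and \<eta>: "\<eta> > 0" and gr: "\<And>z. z \<in> D \<Longrightarrow> g z < \<eta> \<Longrightarrow> c0 < norm (Dr z)"
    using grad_lower by blast
  define C1 where "C1 = V * (3 * q) ^ (2 * ?n) * (2 / c0)\<^sup>2"
  have C1: "C1 > 0" using V q c0 by (simp add: C1_def)
  define C2 where "C2 = V * (q * M) ^ (2 * ?n) / \<eta> ^ (?n + 1)"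
  have C2: "C2 > 0" using V q M_pos \<eta> by (simp add: C2_def)
  have main: "measure lborel (slab x q) \<le> (C1 + C2) * \<gamma> ^ (?n + 1)" if x: "x \<in> D" and \<gamma>: "\<gamma> = g x" for x \<gamma>
  proof -
    have g0: "\<gamma> > 0" using g_pos x \<gamma> by simp
    have gM: "\<gamma> \<le> M\<^sup>2" "sqrt \<gamma> \<le> M" using g_le[OF x] sqrt_g_le[OF x] \<gamma> by auto
    show ?thesis
    proof (cases "\<gamma> < \<eta>")
      case True
      obtain u where u: "norm u = 1" "c0 < Dr x u" using unit_normal[OF gr[OF x]] True \<gamma> c0 by auto
      have "c0 \<le> cmod (ell x u)" using u complex_Re_le_cmod[of "ell x u"] by (simp add: ell_def)
      then have "measure lborel (slab x q) * (q * sqrt \<gamma>)\<^sup>2 \<le> V * (3 * (q * sqrt \<gamma>)) ^ (2 * ?n) * (2 * (q * \<gamma>) / c0)\<^sup>2"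
        unfolding V_def slab_def \<gamma>[symmetric]
        using ell_linear continuous_ell u c0 q g0 by (intro slab_measure_upper[of _ u]) auto
      moreover have "V * (3 * (q * sqrt \<gamma>)) ^ (2 * ?n) * (2 * (q * \<gamma>) / c0)\<^sup>2 = (C1 * \<gamma> ^ (?n + 1)) * (q * sqrt \<gamma>)\<^sup>2"
      proof -
        have "(3 * (q * sqrt \<gamma>)) ^ (2 * ?n) = (3 * q) ^ (2 * ?n) * \<gamma> ^ ?n"
          using power_sqrt_even[of \<gamma> "3 * q" ?n] g0 by (simp only: mult.assoc)
        moreover have "(q * sqrt \<gamma>)\<^sup>2 = q\<^sup>2 * \<gamma>" using g0 by (simp add: power_mult_distrib)
        moreover have "(2 * (q * \<gamma>) / c0)\<^sup>2 = (2 / c0)\<^sup>2 * (q\<^sup>2 * \<gamma>) * \<gamma>"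
          by (simp add: power_divide power_mult_distrib) (simp add: power2_eq_square)
        ultimately show ?thesis by (simp only: C1_def) simp
      qed
      ultimately have "measure lborel (slab x q) \<le> C1 * \<gamma> ^ (?n + 1)"
        using q g0 mult_right_le_imp_le[of "measure lborel (slab x q)" "(q * sqrt \<gamma>)\<^sup>2" "C1 * \<gamma> ^ (?n + 1)"] by simp
      moreover have "C1 * \<gamma> ^ (?n + 1) \<le> (C1 + C2) * \<gamma> ^ (?n + 1)" using g0 C2 by (intro mult_right_mono) auto
      ultimately show ?thesis by linarith
    next
      case False
      have "q * sqrt \<gamma> \<le> q * M" using gM q by simp
      then have "slab x q \<subseteq> ball 0 (q * M)" by (auto simp: slab_def \<gamma>)
      then have "measure lborel (slab x q) \<le> measure lborel (ball (0::complex^'n) (q * M))"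
        by (intro measure_mono_open open_slab) auto
      also have "\<dots> = V * (q * M) ^ (2 * ?n)"
        using content_ball[of "q * M" "0::complex^'n"] q M_pos by (simp add: V_def mult.commute)
      also have "\<dots> = C2 * \<eta> ^ (?n + 1)" using \<eta> by (simp add: C2_def)
      also have "\<dots> \<le> (C1 + C2) * \<gamma> ^ (?n + 1)" using C1 C2 \<eta> False by (intro mult_mono power_mono) auto
      finally show ?thesis .
    qed
  qed
  have "C1 + C2 > 0" using C1 C2 by simp
  then show ?thesis using main by blast
qed

text \<open>Parametrised by the Kobayashi radius itself, so that radii add in the triangle
  inequality.\<close>

definition kball :: "complex ^ 'n \<Rightarrow> real \<Rightarrow> (complex ^ 'n) set" where
  "kball x R = {y\<in>D. kobayashi_dist D x y < R}"

lemma open_kball: "x \<in> D \<Longrightarrow> open (kball x R)"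
  unfolding kball_def by (rule open_kobayashi_ball[OF open_D connected_D])

lemma bounded_kball: "bounded (kball x R)"
  by (rule bounded_subset[OF bounded_D]) (auto simp: kball_def)

lemma measure_kball:
  assumes "R > 0"
  shows "\<exists>c>0. \<exists>C>0. \<forall>x\<in>D. c * g x ^ (CARD('n) + 1) \<le> measure lborel (kball x R) \<and>
           measure lborel (kball x R) \<le> C * g x ^ (CARD('n) + 1)"
proof -
  obtain q where q: "q > 0" "\<And>x y. x \<in> D \<Longrightarrow> norm (y - x) < q * sqrt (g x) \<Longrightarrow> cmod (ell x (y - x)) < q * g x \<Longrightarrow>
    y \<in> D \<and> kobayashi_dist D x y < R" using kobayashi_ball_inner[OF assms] by blast
  obtain Q where Q: "Q \<ge> 1" "\<And>x y. x \<in> D \<Longrightarrow> y \<in> D \<Longrightarrow> kobayashi_dist D x y < R \<Longrightarrow>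
    norm (y - x) \<le> Q * sqrt (g x) \<and> cmod (ell x (y - x)) \<le> Q * g x" using kobayashi_ball_outer[OF assms] by blast
  obtain c where c: "c > 0" "\<And>x. x \<in> D \<Longrightarrow> c * g x ^ (CARD('n) + 1) \<le> measure lborel (slab x q)"
    using slab_lower[OF q(1)] by blast
  \<comment> \<open>Doubling turns the non-strict outer bounds into the strict ones defining a
    slab.\<close>
  have "2 * Q > 0" using Q by simp
  then obtain C where C: "C > 0" "\<And>x. x \<in> D \<Longrightarrow> measure lborel (slab x (2 * Q)) \<le> C * g x ^ (CARD('n) + 1)"
    using slab_upper by blast
  have "c * g x ^ (CARD('n) + 1) \<le> measure lborel (kball x R) \<and> measure lborel (kball x R) \<le> C * g x ^ (CARD('n) + 1)"
    if x: "x \<in> D" for x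
  proof
    have "(+) x ` slab x q \<subseteq> kball x R" using q(2)[OF x] by (auto simp: slab_def kball_def)
    then have "measure lborel ((+) x ` slab x q) \<le> measure lborel (kball x R)"
      by (intro measure_mono_open open_translation open_slab open_kball[OF x] bounded_kball)
    then show "c * g x ^ (CARD('n) + 1) \<le> measure lborel (kball x R)"
      using c(2)[OF x] by (simp add: measure_translate_open[OF open_slab])
    have "kball x R \<subseteq> (+) x ` slab x (2 * Q)"
    proof
      fix y assume "y \<in> kball x R"
      then have y: "norm (y - x) \<le> Q * sqrt (g x)" "cmod (ell x (y - x)) \<le> Q * g x"
        using Q(2)[OF x] by (auto simp: kball_def)
      have "0 < Q * sqrt (g x)" "0 < Q * g x" by (rule mult_pos_pos; use Q(1) g_pos[OF x] in simp)+
      then have "y - x \<in> slab x (2 * Q)" using y by (auto simp: slab_def)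
      then show "y \<in> (+) x ` slab x (2 * Q)" by (intro image_eqI[of _ _ "y - x"]) auto
    qed
    then have "measure lborel (kball x R) \<le> measure lborel ((+) x ` slab x (2 * Q))"
      by (intro measure_mono_open open_translation open_slab open_kball[OF x] bounded_translation bounded_slab)
    then show "measure lborel (kball x R) \<le> C * g x ^ (CARD('n) + 1)"
      using C(2)[OF x] by (simp add: measure_translate_open[OF open_slab])
  qed
  then show ?thesis using c(1) C(1) by blast
qed

text \<open>One inequality is the Lipschitz bound for \<open>r\<close>, which vanishes on the
  frontier. For the other, a move of length 2 g / c in a direction of steep ascent makes
  \<open>r\<close> nonnegative, so the segment meets the frontier.\<close>

lemma bdist_comparable: "\<exists>C\<ge>1. \<forall>x\<in>D. g x \<le> C * bdist D x \<and> bdist D x \<le> C * g x"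
proof -
  obtain c \<eta>0 where c: "c > 0" and \<eta>0: "\<eta>0 > 0" and gr: "\<And>z. z \<in> D \<Longrightarrow> g z < \<eta>0 \<Longrightarrow> c < norm (Dr z)"
    using grad_lower by blast
  \<comment> \<open>The entry \<open>c * e / 2\<close> puts the move \<open>t\<close> within the
    Taylor range, and the last entry bounds the remainder \<open>M * t\<^sup>2\<close> by
    \<open>g x\<close>.\<close>
  define \<eta> where "\<eta> = min \<eta>0 (min (c * e / 2) (c\<^sup>2 / (4 * M)))"
  have \<eta>: "\<eta> > 0" "\<eta> \<le> \<eta>0" "\<eta> \<le> c * e / 2" "\<eta> \<le> c\<^sup>2 / (4 * M)" using c \<eta>0 e_pos M_pos by (auto simp: \<eta>_def)
  define C where "C = M + 2 / c + M / \<eta>"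
  have C: "C \<ge> 1" "M \<le> C" "2 / c \<le> C" "M / \<eta> \<le> C"
  proof -
    have "0 \<le> 2 / c" "0 \<le> M / \<eta>" using c \<eta> M_pos by auto
    then show "C \<ge> 1" "M \<le> C" "2 / c \<le> C" "M / \<eta> \<le> C" unfolding C_def using M_ge1 by linarith+
  qed
  have "g x \<le> C * bdist D x \<and> bdist D x \<le> C * g x" if x: "x \<in> D" for x
  proof
    have g0: "g x > 0" using g_pos[OF x] .
    obtain p where p: "p \<in> frontier D" "infdist x (frontier D) = dist x p"
      using infdist_attains_inf[OF frontier_closed frontier_ne] by metis
    have "g x \<le> M * norm (p - x)" using lip_r[OF D_sub_cl[OF x] frontier_sub_cl[OF p(1)]] r_frontier[OF p(1)] by simp
    also have "\<dots> \<le> C * norm (p - x)" using C by (intro mult_right_mono) auto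
    finally show "g x \<le> C * bdist D x" using p(2) by (simp add: bdist_def dist_norm norm_minus_commute)
    show "bdist D x \<le> C * g x"
    proof (cases "g x < \<eta>")
      case True
      obtain u where u: "norm u = 1" "c < Dr x u" using unit_normal[OF gr[OF x]] True \<eta> c by force
      define \<gamma> where "\<gamma> = g x"
      define t where "t = 2 * \<gamma> / c"
      have t: "t > 0" "t \<le> e" "c * t = 2 * \<gamma>" using True g0 c \<eta> by (auto simp: t_def \<gamma>_def field_simps)
      have T: "x + t *\<^sub>R u \<in> U" "\<bar>r (x + t *\<^sub>R u) - r x - Dr x (t *\<^sub>R u)\<bar> \<le> M * t\<^sup>2"
        using taylor1[OF D_sub_cl[OF x], of "t *\<^sub>R u"] t u by auto
      have "c * t \<le> Dr x u * t" using u t by (intro mult_right_mono) auto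
      then have "c * t \<le> Dr x (t *\<^sub>R u)" by (simp add: blinfun_linear mult.commute)
      moreover have "M * t\<^sup>2 \<le> \<gamma>"
      proof -
        have "\<gamma> \<le> c\<^sup>2 / (4 * M)" using True \<eta>(4) unfolding \<gamma>_def by linarith
        then have "4 * M * \<gamma> \<le> c\<^sup>2" using M_pos by (simp add: pos_le_divide_eq mult.commute)
        then have "4 * M * \<gamma> * \<gamma> \<le> c\<^sup>2 * \<gamma>" using g0 by (intro mult_right_mono) (auto simp: \<gamma>_def)
        then show ?thesis using c by (simp add: t_def power_divide power_mult_distrib field_simps power2_eq_square)
      qed
      ultimately have "r (x + t *\<^sub>R u) \<ge> 0" using T(2) t(3) g0 unfolding \<gamma>_def by linarith
      then have "x + t *\<^sub>R u \<notin> D" using r_neg by force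
      then obtain p where p: "p \<in> closed_segment x (x + t *\<^sub>R u)" "p \<in> frontier D"
        using connected_Int_frontier[of "closed_segment x (x + t *\<^sub>R u)" D] x by auto
      have "bdist D x \<le> dist x p" unfolding bdist_def using p(2) by (rule infdist_le)
      also have "\<dots> \<le> t" using dist_in_closed_segment[OF p(1)] u t by (simp add: dist_norm norm_minus_commute)
      also have "\<dots> = 2 / c * g x" by (simp add: t_def \<gamma>_def)
      also have "\<dots> \<le> C * g x" using C g0 by (intro mult_right_mono) auto
      finally show ?thesis .
    next
      case False
      have "bdist D x \<le> M" using p(2) diam[OF D_sub_cl[OF x] frontier_sub_cl[OF p(1)]]
        by (simp add: bdist_def dist_norm norm_minus_commute)
      also have "\<dots> = M / \<eta> * \<eta>" using \<eta> by simp
      also have "\<dots> \<le> C * g x" using C False \<eta> M_pos by (intro mult_mono) auto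
      finally show ?thesis .
    qed
  qed
  then show ?thesis using C(1) by blast
qed

section \<open>Volume of the boundary layers \<open>{g < t}\<close>\<close>

lemma open_layer: "open {x\<in>D. g x < t}"
proof -
  have "{x\<in>D. g x < t} = D \<inter> r -` {-t<..}" by auto
  then show ?thesis using continuous_open_preimage[OF continuous_on_subset[OF cont_r] open_D open_greaterThan, of "-t"]
    cl_U D_sub_cl by auto
qed

text \<open>Near \<open>p\<close> the function \<open>r\<close> grows at rate at least
  \<open>c\<close> along \<open>u\<close>, so a shift by t / c or more carries the layer off itself.
  About \<epsilon> c / t such shifts are disjoint inside the ball of radius 2 \<epsilon>, which
  makes the layer's volume O(t).\<close>

lemma layer_local:
  assumes p: "p \<in> frontier D"
  shows "\<exists>\<epsilon>>0. \<exists>C>0. \<forall>t>0. measure lborel ({x\<in>D. g x < t} \<inter> ball p \<epsilon>) \<le> C * t"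
proof -
  have pU: "p \<in> U" using p frontier_sub_cl cl_U by auto
  obtain u where u: "norm u = 1" "norm (Dr p) / 2 < Dr p u"
    using unit_normal[of "norm (Dr p) / 2" p] grad_nz[OF p] by auto
  define c where "c = norm (Dr p) / 2"
  have c: "c > 0" using grad_nz[OF p] by (simp add: c_def)
  have "open (U \<inter> (\<lambda>x. Dr x u) -` {c<..})"
    by (intro continuous_open_preimage blinfun.continuous_on cont_Dr open_U continuous_on_const) auto
  moreover have "p \<in> U \<inter> (\<lambda>x. Dr x u) -` {c<..}" using pU u by (simp add: c_def)
  ultimately obtain \<epsilon> where \<epsilon>: "\<epsilon> > 0" "ball p \<epsilon> \<subseteq> U \<inter> (\<lambda>x. Dr x u) -` {c<..}"
    using open_contains_ball by blast
  define V where "V = measure lborel (ball p (2 * \<epsilon>))"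
  have incr: "c * s \<le> r (x + s *\<^sub>R u) - r x" if "s > 0" "x \<in> ball p \<epsilon>" "x + s *\<^sub>R u \<in> ball p \<epsilon>" for s x
  proof -
    have in_ball: "x + \<tau> *\<^sub>R u \<in> ball p \<epsilon>" if "0 \<le> \<tau>" "\<tau> \<le> s" for \<tau>
    proof -
      have "x + \<tau> *\<^sub>R u = (1 - \<tau> / s) *\<^sub>R x + (\<tau> / s) *\<^sub>R (x + s *\<^sub>R u)"
        using \<open>s > 0\<close> by (simp add: algebra_simps)
      then show ?thesis using convexD_alt[OF convex_ball \<open>x \<in> ball p \<epsilon>\<close> \<open>x + s *\<^sub>R u \<in> ball p \<epsilon>\<close>, of "\<tau> / s"] that \<open>s > 0\<close> by simp
    qed
    have "\<exists>z. 0 < z \<and> z < s \<and> r (x + s *\<^sub>R u) - r (x + 0 *\<^sub>R u) = (s - 0) * Dr (x + z *\<^sub>R u) u"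
    proof (rule MVT2[OF \<open>s > 0\<close>])
      fix \<tau> assume "0 \<le> \<tau>" "\<tau> \<le> s"
      then have "x + \<tau> *\<^sub>R u \<in> U" using in_ball \<epsilon> by blast
      moreover have "((\<lambda>t. x + t *\<^sub>R u) has_derivative (\<lambda>t. t *\<^sub>R u)) (at \<tau>)" by (auto intro!: derivative_eq_intros)
      ultimately show "((\<lambda>t. r (x + t *\<^sub>R u)) has_real_derivative Dr (x + \<tau> *\<^sub>R u) u) (at \<tau>)"
        using has_derivative_compose[OF _ der1, of "\<lambda>t. x + t *\<^sub>R u" "\<lambda>t. t *\<^sub>R u" \<tau> UNIV]
        by (simp add: has_field_derivative_def blinfun_linear mult_commute_abs)
    qed
    then obtain z where z: "0 < z" "z < s" "r (x + s *\<^sub>R u) - r x = s * Dr (x + z *\<^sub>R u) u" by auto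
    have "c < Dr (x + z *\<^sub>R u) u" using in_ball[of z] z \<epsilon> by auto
    then show ?thesis using z \<open>s > 0\<close> by (simp add: mult.commute)
  qed
  have "measure lborel ({x\<in>D. g x < t} \<inter> ball p \<epsilon>) \<le> V / (c * \<epsilon>) * t" if t: "t > 0" for t
  proof -
    let ?A = "{x\<in>D. g x < t} \<inter> ball p \<epsilon>"
    define \<tau> where "\<tau> = t / c"
    have \<tau>: "\<tau> > 0" "c * \<tau> = t" using t c by (auto simp: \<tau>_def)
    define N where "N = nat \<lfloor>\<epsilon> / \<tau>\<rfloor>"
    have N: "real N \<le> \<epsilon> / \<tau>" "\<epsilon> / \<tau> \<le> real (N + 1)"
      using \<tau> \<epsilon> real_of_int_floor_add_one_ge[of "\<epsilon> / \<tau>"] by (auto simp: N_def add.commute)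
    have "real (card {..N}) * measure lborel ?A \<le> measure lborel (ball p (2 * \<epsilon>))"
    proof (rule measure_disjoint_translates[where p = "\<lambda>k. (real k * \<tau>) *\<^sub>R u"])
      show "bounded ?A" using bounded_ball bounded_subset by blast
      fix j x assume j: "j \<in> {..N}" and x: "x \<in> ?A"
      have "real j \<le> \<epsilon> / \<tau>" using N(1) j by (meson atMost_iff of_nat_mono order_trans)
      then have "real j * \<tau> \<le> \<epsilon>" using \<tau> by (simp add: pos_le_divide_eq)
      then have "norm ((real j * \<tau>) *\<^sub>R u) \<le> \<epsilon>" using u \<tau> by simp
      then show "(real j * \<tau>) *\<^sub>R u + x \<in> ball p (2 * \<epsilon>)"
        using x norm_triangle_ineq[of "(real j * \<tau>) *\<^sub>R u" "x - p"] by (simp add: dist_norm norm_minus_commute[of p] algebra_simps)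
    next
      have wlog: "(real i * \<tau>) *\<^sub>R u + x \<noteq> (real j * \<tau>) *\<^sub>R u + y" if ij: "i < j" and x: "x \<in> ?A" and y: "y \<in> ?A" for i j x y
      proof
        assume eq: "(real i * \<tau>) *\<^sub>R u + x = (real j * \<tau>) *\<^sub>R u + y"
        define s where "s = (real j - real i) * \<tau>"
        have xy: "x = y + s *\<^sub>R u" using eq by (simp add: s_def algebra_simps)
        have "1 * \<tau> \<le> (real j - real i) * \<tau>" using ij \<tau> by (intro mult_right_mono) auto
        then have s: "s \<ge> \<tau>" by (simp add: s_def)
        have "c * \<tau> \<le> c * s" using s c by simp
        also have "\<dots> \<le> r x - r y" using incr[of s y] x y xy s \<tau> by auto
        \<comment> \<open>On the layer \<open>r\<close> takes values strictly between -t and 0, so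
          it cannot increase by \<open>c * \<tau> = t\<close>.\<close>
        finally show False using x y r_neg[of x] \<tau> by auto
      qed
      fix i j :: nat and x y assume "i \<noteq> j" "x \<in> ?A" "y \<in> ?A"
      then show "(real i * \<tau>) *\<^sub>R u + x \<noteq> (real j * \<tau>) *\<^sub>R u + y"
        using wlog[of i j x y] wlog[of j i y x] by (metis linorder_neqE_nat)
    qed (auto intro: open_layer open_Int)
    then have "real (N + 1) * measure lborel ?A \<le> V" by (simp add: V_def)
    moreover have "\<epsilon> / \<tau> * measure lborel ?A \<le> real (N + 1) * measure lborel ?A" using N by (intro mult_right_mono) auto
    ultimately have "\<epsilon> / \<tau> * measure lborel ?A \<le> V" by linarith
    then have "\<tau> / \<epsilon> * (\<epsilon> / \<tau> * measure lborel ?A) \<le> \<tau> / \<epsilon> * V" using \<tau> \<epsilon> by (intro mult_left_mono) auto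
    then show ?thesis using t \<epsilon>(1) c by (simp add: \<tau>_def mult.commute)
  qed
  moreover have "V / (c * \<epsilon>) > 0" using c \<epsilon> content_ball_pos[of "2 * \<epsilon>" p] by (simp add: V_def)
  ultimately show ?thesis using \<epsilon> by blast
qed

text \<open>Finitely many local balls cover the frontier and hence every sufficiently thin layer;
  for \<open>t \<ge> \<eta>\<close> the volume of \<open>D\<close> is itself at most a multiple of
  \<open>t\<close>.\<close>

lemma layer_measure: "\<exists>C>0. \<forall>t>0. measure lborel {x\<in>D. g x < t} \<le> C * t"
proof -
  define P where "P = (\<lambda>p \<epsilon> C. \<epsilon> > 0 \<and> C > 0 \<and> (\<forall>t>0. measure lborel ({x\<in>D. g x < t} \<inter> ball p \<epsilon>) \<le> C * t))"
  have "\<forall>p\<in>frontier D. \<exists>\<epsilon> C. P p \<epsilon> C"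
    using layer_local unfolding P_def by blast
  then obtain \<epsilon> C where "\<And>p. p \<in> frontier D \<Longrightarrow> P p (\<epsilon> p) (C p)"
    by metis
  then have \<epsilon>C: "\<epsilon> p > 0 \<and> C p > 0 \<and> (\<forall>t>0. measure lborel ({x\<in>D. g x < t} \<inter> ball p (\<epsilon> p)) \<le> C p * t)"
    if "p \<in> frontier D" for p using that unfolding P_def by blast
  have "compact (frontier D)" using bounded_D compact_frontier_bounded by blast
  then obtain F where F: "F \<subseteq> frontier D" "finite F" "frontier D \<subseteq> (\<Union>p\<in>F. ball p (\<epsilon> p))"
  proof (rule compactE_image[of "frontier D" "frontier D" "\<lambda>p. ball p (\<epsilon> p)"])
    show "frontier D \<subseteq> (\<Union>p\<in>frontier D. ball p (\<epsilon> p))"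
    proof
      fix p assume p: "p \<in> frontier D"
      then have "p \<in> ball p (\<epsilon> p)" using \<epsilon>C by simp
      with p show "p \<in> (\<Union>p\<in>frontier D. ball p (\<epsilon> p))" by blast
    qed
  qed auto
  obtain \<eta> where \<eta>: "\<eta> > 0" "\<And>z. z \<in> D \<Longrightarrow> g z < \<eta> \<Longrightarrow> z \<in> (\<Union>p\<in>F. ball p (\<epsilon> p))"
    using near_boundary[OF _ F(3)] by blast
  define K where "K = (\<Sum>p\<in>F. C p) + measure lborel D / \<eta> + 1"
  have "C p \<ge> 0" if "p \<in> F" for p using F(1) \<epsilon>C[of p] that by auto
  then have pos: "(\<Sum>p\<in>F. C p) \<ge> 0" "measure lborel D / \<eta> \<ge> 0" using \<eta>(1) by (auto intro!: sum_nonneg)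
  have "measure lborel {x\<in>D. g x < t} \<le> K * t" if t: "t > 0" for t
  proof (cases "t < \<eta>")
    case True
    let ?A = "\<lambda>p. {x\<in>D. g x < t} \<inter> ball p (\<epsilon> p)"
    have opA: "open (?A p)" for p using open_layer by (intro open_Int) auto
    have "{x\<in>D. g x < t} \<subseteq> (\<Union>p\<in>F. ?A p)" using \<eta>(2) True by force
    then have "measure lborel {x\<in>D. g x < t} \<le> measure lborel (\<Union>p\<in>F. ?A p)"
      by (intro measure_mono_open open_layer open_UN ballI opA) (auto intro: bounded_subset[OF bounded_D])
    also have "\<dots> \<le> (\<Sum>p\<in>F. measure lborel (?A p))"
      by (rule measure_UNION_le) (use opA F in auto)
    also have "\<dots> \<le> (\<Sum>p\<in>F. C p * t)" using \<epsilon>C F t by (intro sum_mono) blast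
    also have "\<dots> = (\<Sum>p\<in>F. C p) * t" by (simp add: sum_distrib_right)
    also have "\<dots> \<le> K * t" using t pos by (intro mult_right_mono) (auto simp: K_def)
    finally show ?thesis .
  next
    case False
    have "measure lborel {x\<in>D. g x < t} \<le> measure lborel D"
      using open_layer open_D bounded_D by (intro measure_mono_open) auto
    also have "\<dots> = measure lborel D / \<eta> * \<eta>" using \<eta> by simp
    also have "\<dots> \<le> K * t" using False \<eta> pos by (intro mult_mono) (auto simp: K_def)
    finally show ?thesis .
  qed
  moreover have "K > 0" using pos by (simp add: K_def)
  ultimately show ?thesis by blast
qed

end

subsection \<open>Carleson measures and uniformly discrete sequences\<close>

text \<open>\<open>measure_of\<close> returns the zero measure unless its set function is countably
  additive. Realising the function by a genuine measure \<open>N\<close>, the image under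
  \<open>x\<close> of a weighted counting measure, settles this at once.\<close>

lemma dirac_sum_measure:
  fixes x :: "nat \<Rightarrow> 'a::topological_space"
  shows sets_dirac_sum: "sets (dirac_sum x c) = sets borel"
    and emeasure_dirac_sum: "A \<in> sets borel \<Longrightarrow> emeasure (dirac_sum x c) A = (\<Sum>j. ennreal (c j) * indicator A (x j))"
proof -
  define N where "N = distr (density (count_space UNIV) (\<lambda>j. ennreal (c j))) borel x"
  have em: "emeasure N A = (\<Sum>j. ennreal (c j) * indicator A (x j))" if "A \<in> sets borel" for A
  proof -
    have "emeasure N A = emeasure (density (count_space UNIV) (\<lambda>j. ennreal (c j))) (x -` A)"
      unfolding N_def using that by (subst emeasure_distr) auto
    also have "\<dots> = (\<integral>\<^sup>+j. ennreal (c j) * indicator (x -` A) j \<partial>count_space UNIV)"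
      by (rule emeasure_density) auto
    also have "\<dots> = (\<Sum>j. ennreal (c j) * indicator A (x j))"
      by (simp add: nn_integral_count_space_nat indicator_def)
    finally show ?thesis .
  qed
  have "dirac_sum x c = measure_of (space N) (sets N) (emeasure N)"
    unfolding dirac_sum_def N_def[symmetric] 
    using em sets.sigma_sets_eq[of "borel :: 'a measure"] by (simp add: N_def) (intro measure_of_eq, auto)
  also have "\<dots> = N" by (rule measure_of_of_measure)
  finally have eq: "dirac_sum x c = N" .
  show "sets (dirac_sum x c) = sets borel" by (simp add: eq N_def)
  show "A \<in> sets borel \<Longrightarrow> emeasure (dirac_sum x c) A = (\<Sum>j. ennreal (c j) * indicator A (x j))"
    using em by (simp add: eq)
qed

lemma emeasure_dirac_sum_le:
  assumes A: "A \<in> sets borel" and c: "\<And>j. 0 \<le> c j"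
    and bd: "\<And>F. finite F \<Longrightarrow> (\<And>j. j \<in> F \<Longrightarrow> x j \<in> A) \<Longrightarrow> (\<Sum>j\<in>F. c j) \<le> K"
  shows "emeasure (dirac_sum x c) A \<le> ennreal K"
  unfolding emeasure_dirac_sum[OF A]
proof (rule suminf_le_const)
  fix n
  have "(\<Sum>j<n. ennreal (c j) * indicator A (x j)) = (\<Sum>j\<in>{j\<in>{..<n}. x j \<in> A}. ennreal (c j))"
    by (intro sum.mono_neutral_cong_right) auto
  also have "\<dots> = ennreal (\<Sum>j\<in>{j\<in>{..<n}. x j \<in> A}. c j)" using c by (simp add: sum_ennreal)
  also have "\<dots> \<le> ennreal K" by (intro ennreal_leI bd) auto
  finally show "(\<Sum>j<n. ennreal (c j) * indicator A (x j)) \<le> ennreal K" .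
qed auto

lemma sum_le_measure_dirac_sum:
  assumes A: "A \<in> sets borel" and c: "\<And>j. 0 \<le> c j" and fin: "finite_measure (dirac_sum x c)"
    and F: "finite F" "\<And>j. j \<in> F \<Longrightarrow> x j \<in> A"
  shows "(\<Sum>j\<in>F. c j) \<le> measure (dirac_sum x c) A"
proof -
  have "(\<Sum>j\<in>F. ennreal (c j) * indicator A (x j)) = (\<Sum>j\<in>F. ennreal (c j))"
    using F(2) by (intro sum.cong) auto
  then have "ennreal (\<Sum>j\<in>F. c j) = (\<Sum>j\<in>F. ennreal (c j) * indicator A (x j))"
    using c by (simp add: sum_ennreal)
  also have "\<dots> \<le> (\<Sum>j. ennreal (c j) * indicator A (x j))"
    using F by (intro sum_le_suminf) auto
  also have "\<dots> = emeasure (dirac_sum x c) A" by (rule emeasure_dirac_sum[OF A, symmetric])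
  also have "\<dots> = ennreal (measure (dirac_sum x c) A)" 
    by (rule finite_measure.emeasure_eq_measure[OF fin])
  finally show ?thesis by (simp add: ennreal_le_iff)
qed

lemma sum_measure_disjoint_open_le:
  fixes A :: "'i \<Rightarrow> 'a::euclidean_space set"
  assumes "finite F" "\<And>j. j \<in> F \<Longrightarrow> open (A j)" "\<And>j. j \<in> F \<Longrightarrow> A j \<subseteq> B" "open B" "bounded B"
    and disj: "disjoint_family_on A F"
  shows "(\<Sum>j\<in>F. measure lborel (A j)) \<le> measure lborel B"
proof -
  have bA: "bounded (A j)" if "j \<in> F" for j using bounded_subset[OF \<open>bounded B\<close> assms(3)[OF that]] .
  have "(\<Sum>j\<in>F. measure lborel (A j)) = measure lborel (\<Union>j\<in>F. A j)"
    by (rule measure_finite_Union[symmetric])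
       (use assms emeasure_bounded_finite[OF bA] in \<open>auto simp: less_top\<close>)
  also have "\<dots> \<le> measure lborel B" using assms by (intro measure_mono_open open_UN) auto
  finally show ?thesis .
qed

text \<open>The index sets of a finite union of uniformly discrete sequences may overlap, so only an
  inequality is available.\<close>

lemma sum_le_sum_cover:
  fixes f :: "'a \<Rightarrow> real"
  assumes "finite \<I>" "finite F" "F \<subseteq> \<Union>\<I>" "\<And>j. f j \<ge> 0"
  shows "(\<Sum>j\<in>F. f j) \<le> (\<Sum>I\<in>\<I>. \<Sum>j\<in>F \<inter> I. f j)"
proof -
  have "f j \<le> (\<Sum>I\<in>\<I>. if j \<in> I then f j else 0)" if j: "j \<in> F" for j
  proof -
    obtain I where I: "I \<in> \<I>" "j \<in> I" using assms(3) j by blast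
    show ?thesis using member_le_sum[of I \<I> "\<lambda>I. if j \<in> I then f j else 0"] I assms by auto
  qed
  then have "(\<Sum>j\<in>F. f j) \<le> (\<Sum>j\<in>F. \<Sum>I\<in>\<I>. if j \<in> I then f j else 0)" by (rule sum_mono)
  also have "\<dots> = (\<Sum>I\<in>\<I>. \<Sum>j\<in>F. if j \<in> I then f j else 0)" by (rule sum.swap)
  also have "\<dots> = (\<Sum>I\<in>\<I>. \<Sum>j\<in>F \<inter> I. f j)" using assms by (simp add: sum.inter_restrict)
  finally show ?thesis .
qed

text \<open>Indices are coloured in increasing order: at most \<open>N\<close> colours are blocked
  by earlier neighbours, while \<open>N + 1\<close> are available.\<close>

lemma greedy_colouring:
  fixes E :: "nat \<Rightarrow> nat \<Rightarrow> bool"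
  assumes "\<And>j. card {i. i < j \<and> E i j} \<le> N"
  shows "\<exists>col. \<forall>j. col j \<le> N \<and> (\<forall>i<j. E i j \<longrightarrow> col i \<noteq> col j)"
proof (rule dependent_wellorder_choice[where P = "\<lambda>f x r. r \<le> N \<and> (\<forall>i<x. E i x \<longrightarrow> f i \<noteq> r)"])
  fix x :: nat and f :: "nat \<Rightarrow> nat"
  let ?S = "{i. i < x \<and> E i x}"
  have "card (f ` ?S) \<le> N" by (rule order_trans[OF card_image_le assms]) simp
  then have "card (f ` ?S) < card {..N}" by simp
  then have "\<not> {..N} \<subseteq> f ` ?S" using card_mono[of "f ` ?S" "{..N}"] by force
  then obtain c where "c \<le> N" "c \<notin> f ` ?S" by auto
  then show "\<exists>r. r \<le> N \<and> (\<forall>i<x. E i x \<longrightarrow> f i \<noteq> r)" by blast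
qed auto

lemma power_powr: "0 < (x::real) \<Longrightarrow> (x ^ m) powr \<theta> = x powr (real m * \<theta>)"
  by (simp add: powr_powr flip: powr_realpow)

lemma dyadic_shell:
  fixes b x :: real
  assumes "0 < x" "x \<le> b"
  shows "\<exists>m::nat. b / 2 ^ (m + 1) < x \<and> x \<le> b / 2 ^ m"
proof -
  have ex: "\<exists>m::nat. b / 2 ^ (m + 1) < x"
  proof -
    obtain m where "b / x < 2 ^ m" using real_arch_pow[of 2 "b / x"] by auto
    also have "(2::real) ^ m \<le> 2 ^ (m + 1)" by simp
    finally have "b / x < 2 ^ (m + 1)" .
    then have "b / 2 ^ (m + 1) < x" using assms by (simp add: field_simps)
    then show ?thesis by blast
  qed
  define m where "m = (LEAST m. b / 2 ^ (m + 1) < x)"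
  have 1: "b / 2 ^ (m + 1) < x" unfolding m_def by (rule LeastI_ex[OF ex])
  have "x \<le> b / 2 ^ m"
  proof (cases m)
    case 0 then show ?thesis using assms by simp
  next
    case (Suc k)
    then have "\<not> b / 2 ^ (k + 1) < x" using not_less_Least[of k "\<lambda>m. b / 2 ^ (m + 1) < x"] by (simp add: m_def)
    then show ?thesis using Suc by simp
  qed
  with 1 show ?thesis by blast
qed

context spc_bounds
begin

section \<open>Counting separated points\<close>

lemmas kdist_triangle = kobayashi_dist_triangle[OF open_D connected_D]

lemma kballs_disjoint:
  assumes "\<And>i j. i \<in> F \<Longrightarrow> j \<in> F \<Longrightarrow> i \<noteq> j \<Longrightarrow> a \<le> kobayashi_dist D (z i) (z j)" "\<And>j. j \<in> F \<Longrightarrow> z j \<in> D"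
  shows "disjoint_family_on (\<lambda>j. kball (z j) (a / 2)) F"
  unfolding disjoint_family_on_def
proof (intro ballI impI)
  fix i j assume ij: "i \<in> F" "j \<in> F" "i \<noteq> j"
  have False if "y \<in> kball (z i) (a / 2)" "y \<in> kball (z j) (a / 2)" for y
    using that kdist_triangle[of "z i" y "z j"] assms(1)[OF ij] assms(2) ij kobayashi_dist_commute[of D y "z j"]
    by (force simp: kball_def)
  then show "kball (z i) (a / 2) \<inter> kball (z j) (a / 2) = {}" by blast
qed

text \<open>The balls of radius a / 2 about the points are disjoint and lie in the ball of radius R
  + a / 2 about \<open>x\<close>. All volumes are comparable to the same power of
  \<open>g x\<close>, which cancels, so the count does not depend on \<open>x\<close>.\<close>

lemma packing_count:
  assumes a: "a > 0" and R: "R > 0" and zD: "\<And>j. z j \<in> D"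
    and sep: "\<And>i j. i \<in> I \<Longrightarrow> j \<in> I \<Longrightarrow> i \<noteq> j \<Longrightarrow> a \<le> kobayashi_dist D (z i) (z j)"
  shows "\<exists>N\<ge>0. \<forall>x\<in>D. \<forall>F. finite F \<longrightarrow> F \<subseteq> I \<longrightarrow> (\<forall>j\<in>F. z j \<in> kball x R) \<longrightarrow> real (card F) \<le> N"
proof -
  let ?n = "CARD('n) + 1"
  obtain c where c: "c > 0" "\<And>x. x \<in> D \<Longrightarrow> c * g x ^ ?n \<le> measure lborel (kball x (a / 2))"
    using measure_kball[of "a / 2"] a by auto
  obtain C where C: "C > 0" "\<And>x. x \<in> D \<Longrightarrow> measure lborel (kball x (R + a / 2)) \<le> C * g x ^ ?n"
    using measure_kball[of "R + a / 2"] a R by auto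
  obtain Q where Q: "Q \<ge> 1" "\<And>x y. x \<in> D \<Longrightarrow> y \<in> D \<Longrightarrow> kobayashi_dist D x y < R \<Longrightarrow> g x \<le> Q * g y"
    using kobayashi_ball_outer[OF R] by blast
  have main: "real (card F) \<le> C * Q ^ ?n / c"
    if x: "x \<in> D" and F: "finite F" "F \<subseteq> I" "\<And>j. j \<in> F \<Longrightarrow> z j \<in> kball x R" for x F
  proof -
    define \<gamma> where "\<gamma> = g x"
    have g0: "\<gamma> > 0" using g_pos[OF x] by (simp add: \<gamma>_def)
    have "(\<Sum>j\<in>F. measure lborel (kball (z j) (a / 2))) \<le> measure lborel (kball x (R + a / 2))"
    proof (rule sum_measure_disjoint_open_le)
      show "disjoint_family_on (\<lambda>j. kball (z j) (a / 2)) F" using sep zD F by (intro kballs_disjoint) auto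
      show "kball (z j) (a / 2) \<subseteq> kball x (R + a / 2)" if "j \<in> F" for j
        using F(3)[OF that] kdist_triangle[OF x zD[of j]] by (force simp: kball_def)
    qed (use F x zD in \<open>auto intro: open_kball bounded_kball\<close>)
    moreover have "c * (\<gamma> / Q) ^ ?n \<le> measure lborel (kball (z j) (a / 2))" if "j \<in> F" for j
    proof -
      have "\<gamma> \<le> Q * g (z j)" using Q(2)[OF x zD] F(3)[OF that] by (simp add: kball_def \<gamma>_def)
      then have "\<gamma> / Q \<le> g (z j)" using Q(1) pos_divide_le_eq[of Q \<gamma> "g (z j)"] by (simp add: mult.commute)
      then have "c * (\<gamma> / Q) ^ ?n \<le> c * g (z j) ^ ?n" using c Q(1) g0 by (intro mult_left_mono power_mono) auto
      then show ?thesis using c(2)[OF zD] by (meson order_trans)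
    qed
    then have "(\<Sum>j\<in>F. c * (\<gamma> / Q) ^ ?n) \<le> (\<Sum>j\<in>F. measure lborel (kball (z j) (a / 2)))" by (rule sum_mono)
    ultimately have "real (card F) * (c * (\<gamma> / Q) ^ ?n) \<le> C * \<gamma> ^ ?n" using C(2)[OF x] by (simp add: \<gamma>_def)
    then have "(real (card F) * c / Q ^ ?n) * \<gamma> ^ ?n \<le> C * \<gamma> ^ ?n" by (simp add: power_divide)
    then have "real (card F) * c / Q ^ ?n \<le> C" using g0 by (meson mult_right_le_imp_le zero_less_power)
    then have "real (card F) * c \<le> C * Q ^ ?n" using Q(1) by (simp add: pos_divide_le_eq)
    then show ?thesis using c by (simp add: pos_le_divide_eq)
  qed
  have "C * Q ^ ?n / c \<ge> 0" using C c Q by simp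
  then show ?thesis by (intro exI[of _ "C * Q ^ ?n / c"] conjI ballI allI impI main) auto
qed

text \<open>In the k-th dyadic shell the disjoint balls have volume at least of order 2^(-k (n+1))
  and lie in a layer of volume O(2^(-k)), which leaves O(2^(k n)) points. Each contributes O(2^(-k
  h)), and h > n makes the series geometric with ratio \<open>q\<close>.\<close>

lemma summable_separated:
  fixes z :: "nat \<Rightarrow> complex ^ 'n"
  assumes a: "a > 0" and zD: "\<And>j. z j \<in> D" and h: "real CARD('n) < h"
    and sep: "\<And>i j. i \<in> I \<Longrightarrow> j \<in> I \<Longrightarrow> i \<noteq> j \<Longrightarrow> a \<le> kobayashi_dist D (z i) (z j)"
  shows "\<exists>K\<ge>0. \<forall>F. finite F \<longrightarrow> F \<subseteq> I \<longrightarrow> (\<Sum>j\<in>F. g (z j) powr h) \<le> K"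
proof -
  let ?n = "CARD('n)"
  define b where "b = M\<^sup>2"
  have b: "b > 0" using M_pos by (simp add: b_def)
  have a2: "a / 2 > 0" using a by simp
  obtain c where c: "c > 0" "\<And>x. x \<in> D \<Longrightarrow> c * g x ^ (?n + 1) \<le> measure lborel (kball x (a / 2))"
    using measure_kball[OF a2] by blast
  obtain Q where Q: "Q \<ge> 1" "\<And>x y. x \<in> D \<Longrightarrow> y \<in> D \<Longrightarrow> kobayashi_dist D x y < a / 2 \<Longrightarrow> g y \<le> Q * g x"
    using kobayashi_ball_outer[OF a2] by blast
  obtain L where L: "L > 0" "\<And>t. t > 0 \<Longrightarrow> measure lborel {x\<in>D. g x < t} \<le> L * t"
    using layer_measure by blast
  have "\<exists>m::nat. b / 2 ^ (m + 1) < g (z j) \<and> g (z j) \<le> b / 2 ^ m" for j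
    by (rule dyadic_shell) (use g_pos[OF zD] g_le[OF zD] in \<open>auto simp: b_def\<close>)
  then obtain m :: "nat \<Rightarrow> nat" where m: "\<And>j. b / 2 ^ (m j + 1) < g (z j)" "\<And>j. g (z j) \<le> b / 2 ^ m j" by metis
  define K1 where "K1 = L * (2 * Q * b) * 2 ^ (?n + 1) / (c * b ^ (?n + 1))"
  have K1: "K1 \<ge> 0" using L Q b c by (simp add: K1_def)
  have count: "real (card S) \<le> K1 * 2 ^ (k * ?n)" if S: "finite S" "S \<subseteq> I" "\<And>j. j \<in> S \<Longrightarrow> m j = k" for S k
  proof -
    \<comment> \<open>A ball of radius a / 2 may leave its shell, but \<open>g\<close> grows there
      by at most the factor \<open>Q\<close>; the 2 makes the inclusion strict.\<close>
    let ?t = "2 * Q * b / 2 ^ k"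
    have t0: "?t > 0" using Q b by simp
    have "(\<Sum>j\<in>S. measure lborel (kball (z j) (a / 2))) \<le> measure lborel {x\<in>D. g x < ?t}"
    proof (rule sum_measure_disjoint_open_le)
      show "disjoint_family_on (\<lambda>j. kball (z j) (a / 2)) S" using sep zD S by (intro kballs_disjoint) auto
      show "kball (z j) (a / 2) \<subseteq> {x\<in>D. g x < ?t}" if "j \<in> S" for j
      proof
        fix y assume y: "y \<in> kball (z j) (a / 2)"
        then have "g y \<le> Q * g (z j)" using Q(2)[OF zD] by (simp add: kball_def)
        also have "\<dots> \<le> Q * (b / 2 ^ k)" using m(2)[of j] S(3)[OF that] Q(1) by (intro mult_left_mono) auto
        also have "\<dots> < ?t"
        proof -
          have "0 < Q * (b / 2 ^ k)" using Q(1) b by simp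
          moreover have "?t = 2 * (Q * (b / 2 ^ k))" by simp
          ultimately show ?thesis by linarith
        qed
        finally show "y \<in> {x\<in>D. g x < ?t}" using y by (simp add: kball_def)
      qed
      show "bounded {x\<in>D. g x < ?t}" by (rule bounded_subset[OF bounded_D]) auto
    qed (use S zD in \<open>auto intro: open_kball open_layer\<close>)
    moreover have "c * (b / 2 ^ (k + 1)) ^ (?n + 1) \<le> measure lborel (kball (z j) (a / 2))" if "j \<in> S" for j
    proof -
      have "c * (b / 2 ^ (k + 1)) ^ (?n + 1) \<le> c * g (z j) ^ (?n + 1)"
        using m(1)[of j] S(3)[OF that] c b by (intro mult_left_mono power_mono) auto
      then show ?thesis using c(2)[OF zD] by (meson order_trans)
    qed
    then have "(\<Sum>j\<in>S. c * (b / 2 ^ (k + 1)) ^ (?n + 1)) \<le> (\<Sum>j\<in>S. measure lborel (kball (z j) (a / 2)))" by (rule sum_mono)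
    ultimately have le: "real (card S) * (c * (b / 2 ^ (k + 1)) ^ (?n + 1)) \<le> L * ?t" using L(2)[OF t0] by simp
    have pos: "c * (b / 2 ^ (k + 1)) ^ (?n + 1) > 0" using c b by simp
    have "real (card S) \<le> L * ?t / (c * (b / 2 ^ (k + 1)) ^ (?n + 1))"
      using le pos by (simp only: pos_le_divide_eq)
    also have "\<dots> = K1 * 2 ^ (k * ?n)"
    proof -
      have "((2::real) ^ (k + 1)) ^ (?n + 1) = 2 ^ k * 2 ^ (k * ?n) * 2 ^ (?n + 1)"
        by (simp add: power_mult[symmetric] power_add[symmetric] algebra_simps)
      then show ?thesis using c b by (simp only: K1_def power_divide) (simp add: divide_simps)
    qed
    finally show ?thesis .
  qed
  define q where "q = 2 powr (real ?n - h)"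
  have q: "0 < q" "q < 1" using h by (auto simp: q_def powr_less_one)
  have main: "(\<Sum>j\<in>F. g (z j) powr h) \<le> K1 * b powr h / (1 - q)" if F: "finite F" "F \<subseteq> I" for F
  proof -
    \<comment> \<open>The inserted 0 keeps \<open>Max\<close> meaningful for empty
      \<open>F\<close>.\<close>
    define N where "N = Max (insert 0 (m ` F))"
    have "m ` F \<subseteq> {..N}" using F by (auto simp: N_def)
    then have "(\<Sum>j\<in>F. g (z j) powr h) = (\<Sum>k\<le>N. \<Sum>j | j \<in> F \<and> m j = k. g (z j) powr h)"
      using F by (intro sum.group[symmetric]) auto
    also have "\<dots> \<le> (\<Sum>k\<le>N. K1 * b powr h * q ^ k)"
    proof (rule sum_mono)
      fix k
      have "(\<Sum>j | j \<in> F \<and> m j = k. g (z j) powr h) \<le> (\<Sum>j | j \<in> F \<and> m j = k. (b / 2 ^ k) powr h)"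
      proof (intro sum_mono powr_mono2)
        fix j assume "j \<in> {j \<in> F. m j = k}"
        then show "g (z j) \<le> b / 2 ^ k" using m(2)[of j] by auto
        show "0 \<le> h" using h by (meson less_imp_le of_nat_0_le_iff order_trans)
        show "0 \<le> g (z j)" using g_pos[OF zD] less_imp_le by blast
      qed
      also have "\<dots> = real (card {j. j \<in> F \<and> m j = k}) * (b / 2 ^ k) powr h" by simp
      also have "\<dots> \<le> K1 * 2 ^ (k * ?n) * (b / 2 ^ k) powr h"
        using F by (intro mult_right_mono count) auto
      also have "\<dots> = K1 * b powr h * q ^ k"
      proof -
        have "(b / 2 ^ k) powr h = b powr h / (2 powr (real k * h))"
          using b by (simp add: powr_divide powr_powr flip: powr_realpow)
        moreover have "(2::real) ^ (k * ?n) = 2 powr (real k * real ?n)" by (simp flip: powr_realpow)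
        moreover have "q ^ k = 2 powr (real k * real ?n) / 2 powr (real k * h)"
          unfolding q_def powr_diff[symmetric] by (simp add: powr_powr algebra_simps flip: powr_realpow)
        ultimately show ?thesis by simp
      qed
      finally show "(\<Sum>j | j \<in> F \<and> m j = k. g (z j) powr h) \<le> K1 * b powr h * q ^ k" .
    qed
    also have "\<dots> = K1 * b powr h * (\<Sum>k\<le>N. q ^ k)" by (simp add: sum_distrib_left)
    also have "\<dots> \<le> K1 * b powr h * (1 / (1 - q))"
    proof (intro mult_left_mono)
      have "(\<Sum>k\<le>N. q ^ k) \<le> (\<Sum>k. q ^ k)" using q by (intro sum_le_suminf summable_geometric) auto
      then show "(\<Sum>k\<le>N. q ^ k) \<le> 1 / (1 - q)" using q by (simp add: suminf_geometric)
    qed (use K1 in auto)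
    finally show ?thesis by simp
  qed
  have "K1 * b powr h / (1 - q) \<ge> 0" using K1 q by simp
  then show ?thesis using main by blast
qed

lemma kob_ball_eq: "kob_ball D x s = kball x (artanh s)"
  by (simp add: kob_ball_def kball_def artanh_def)

text \<open>The ball estimates restated with the intrinsic distance to the boundary, in which the
  weights of the measure are expressed; each change between \<open>g\<close> and
  \<open>bdist\<close> costs a power of \<open>A\<close>.\<close>

lemma bdist_kball:
  assumes "R > 0"
  shows "\<exists>c>0. \<exists>C>0. \<exists>Q\<ge>1. \<forall>x\<in>D. 0 < bdist D x \<and>
     c * bdist D x ^ (CARD('n) + 1) \<le> measure lborel (kball x R) \<and>
     measure lborel (kball x R) \<le> C * bdist D x ^ (CARD('n) + 1) \<and>
     (\<forall>y\<in>kball x R. bdist D y \<le> Q * bdist D x \<and> bdist D x \<le> Q * bdist D y)"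
proof -
  let ?n = "CARD('n) + 1"
  obtain A where A: "A \<ge> 1" "\<And>x. x \<in> D \<Longrightarrow> g x \<le> A * bdist D x \<and> bdist D x \<le> A * g x"
    using bdist_comparable by blast
  obtain c C where cC: "c > 0" "C > 0" "\<And>x. x \<in> D \<Longrightarrow> c * g x ^ ?n \<le> measure lborel (kball x R) \<and>
     measure lborel (kball x R) \<le> C * g x ^ ?n" using measure_kball[OF assms] by blast
  obtain Q where Q: "Q \<ge> 1" "\<And>x y. x \<in> D \<Longrightarrow> y \<in> D \<Longrightarrow> kobayashi_dist D x y < R \<Longrightarrow> g y \<le> Q * g x \<and> g x \<le> Q * g y"
    using kobayashi_ball_outer[OF assms] by blast
  have pos: "0 < bdist D x" if "x \<in> D" for x
  proof (rule ccontr)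
    assume "\<not> 0 < bdist D x"
    then have "A * bdist D x \<le> 0" using A(1) by (simp add: mult_nonneg_nonpos)
    then show False using A(2)[OF that] g_pos[OF that] by linarith
  qed
  have "c / A ^ ?n * bdist D x ^ ?n \<le> measure lborel (kball x R) \<and> measure lborel (kball x R) \<le> C * A ^ ?n * bdist D x ^ ?n"
    if x: "x \<in> D" for x
  proof
    have "bdist D x / A \<le> g x" using A(2)[OF x] A(1) pos_divide_le_eq[of A "bdist D x" "g x"] by (simp add: mult.commute)
    then have "c * (bdist D x / A) ^ ?n \<le> c * g x ^ ?n" using cC pos[OF x] A(1) by (intro mult_left_mono power_mono) auto
    moreover have "c * (bdist D x / A) ^ ?n = c / A ^ ?n * bdist D x ^ ?n" by (simp add: power_divide)
    ultimately show "c / A ^ ?n * bdist D x ^ ?n \<le> measure lborel (kball x R)" using cC(3)[OF x] by linarith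
    have "C * g x ^ ?n \<le> C * (A * bdist D x) ^ ?n" using cC A(2)[OF x] g_pos[OF x] by (intro mult_left_mono power_mono) auto
    moreover have "C * (A * bdist D x) ^ ?n = C * A ^ ?n * bdist D x ^ ?n" by (simp add: power_mult_distrib)
    ultimately show "measure lborel (kball x R) \<le> C * A ^ ?n * bdist D x ^ ?n" using cC(3)[OF x] by linarith
  qed
  moreover have "bdist D y \<le> A * Q * A * bdist D x" if x: "x \<in> D" "y \<in> D" and le: "g y \<le> Q * g x" for x y
  proof -
    have "bdist D y \<le> A * g y" using A(2) x by blast
    also have "\<dots> \<le> A * (Q * g x)" using le A(1) by (intro mult_left_mono) auto
    also have "\<dots> \<le> A * (Q * (A * bdist D x))" using A Q x by (intro mult_left_mono) auto
    finally show ?thesis by (simp add: mult.assoc)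
  qed
  then have "\<forall>y\<in>kball x R. bdist D y \<le> A * Q * A * bdist D x \<and> bdist D x \<le> A * Q * A * bdist D y" if "x \<in> D" for x
    using Q(2)[OF that] that by (auto simp: kball_def)
  moreover have "c / A ^ ?n > 0" "C * A ^ ?n > 0" using cC A by auto
  moreover have "1 \<le> A * Q" using A(1) Q(1) mult_mono[of 1 A 1 Q] by simp
  then have "1 \<le> A * Q * A" using A(1) mult_mono[of 1 "A * Q" 1 A] by simp
  ultimately show ?thesis using pos by blast
qed

section \<open>The two implications\<close>

lemma kball_borel: "x \<in> D \<Longrightarrow> kball x R \<in> sets borel"
  using open_kball by auto

text \<open>Because tanh k \<le> k, a separation constant for \<open>rho\<close> also serves for the
  Kobayashi distance.\<close>

lemma uniformly_discreteD:
  assumes "uniformly_discrete D z I" and zD: "\<And>j. z j \<in> D"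
  obtains a where "a > 0" "\<And>i j. i \<in> I \<Longrightarrow> j \<in> I \<Longrightarrow> i \<noteq> j \<Longrightarrow> a \<le> kobayashi_dist D (z i) (z j)"
proof -
  obtain a where a: "a > 0" "\<And>i j. i \<in> I \<Longrightarrow> j \<in> I \<Longrightarrow> i \<noteq> j \<Longrightarrow> a \<le> tanh (kobayashi_dist D (z i) (z j))"
    using assms(1) unfolding uniformly_discrete_def rho_def by blast
  have "tanh k \<le> k" if "k \<ge> 0" for k :: real
    using artanh_ge_self[of "tanh k"] that by (simp add: artanh_tanh_real tanh_real_lt_1)
  then have "a \<le> kobayashi_dist D (z i) (z j)" if "i \<in> I" "j \<in> I" "i \<noteq> j" for i j
    using a(2)[OF that] kobayashi_dist_nonneg[OF open_D connected_D zD zD] order_trans by blast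
  with a(1) that show ?thesis by blast
qed

text \<open>Finiteness comes from \<open>summable_separated\<close>. For the ball inequality, a ball
  about \<open>x\<close> holds at most \<open>T\<close> points of weight at most
  \<open>(Q * \<delta>) powr h\<close>, and the volume to the power \<theta> is at least a multiple
  of \<open>\<delta> powr h\<close>, since h = (n+1) \<theta>.\<close>

lemma carleson_if_discrete:
  assumes zD: "\<And>j. z j \<in> D" and \<theta>: "1 - 1 / (real CARD('n) + 1) < \<theta>"
    and fin: "finite \<I>" "\<Union>\<I> = UNIV" and ud: "\<And>I. I \<in> \<I> \<Longrightarrow> uniformly_discrete D z I"
  shows "theta_carleson D \<theta> (dirac_sum z (\<lambda>j. bdist D (z j) powr ((real CARD('n) + 1) * \<theta>)))"
proof -
  define h where "h = (real CARD('n) + 1) * \<theta>"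
  \<comment> \<open>The lower bound on \<theta> amounts to h > n, the exponent condition for
    summability.\<close>
  have "real CARD('n) = (1 - 1 / (real CARD('n) + 1)) * (real CARD('n) + 1)" by (simp add: field_simps)
  also have "\<dots> < \<theta> * (real CARD('n) + 1)" using \<theta> by (intro mult_strict_right_mono) auto
  finally have h: "real CARD('n) < h" by (simp add: h_def mult.commute)
  have h0: "h > 0" using h by (meson le_less_trans of_nat_0_le_iff)
  have \<theta>0: "\<theta> > 0" using h0 by (simp add: h_def zero_less_mult_iff)
  let ?\<mu> = "dirac_sum z (\<lambda>j. bdist D (z j) powr h)"
  have split: "(\<Sum>j\<in>F. f j) \<le> (\<Sum>I\<in>\<I>. \<Sum>j\<in>F \<inter> I. f j)" if "finite F" "\<And>j. f j \<ge> 0" for F and f :: "nat \<Rightarrow> real"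
    using that fin by (intro sum_le_sum_cover) auto
  have fm: "finite_measure ?\<mu>"
  proof -
    obtain A where A: "A \<ge> 1" "\<And>x. x \<in> D \<Longrightarrow> bdist D x \<le> A * g x" using bdist_comparable by blast
    have "\<exists>K\<ge>0. \<forall>F. finite F \<longrightarrow> F \<subseteq> I \<longrightarrow> (\<Sum>j\<in>F. g (z j) powr h) \<le> K" if I: "I \<in> \<I>" for I
    proof -
      obtain a where "a > 0" "\<And>i j. i \<in> I \<Longrightarrow> j \<in> I \<Longrightarrow> i \<noteq> j \<Longrightarrow> a \<le> kobayashi_dist D (z i) (z j)"
        by (rule uniformly_discreteD[OF ud[OF I] zD]) blast
      then show ?thesis by (rule summable_separated[OF _ zD h])
    qed
    then have "\<forall>I\<in>\<I>. \<exists>K. \<forall>F. finite F \<longrightarrow> F \<subseteq> I \<longrightarrow> (\<Sum>j\<in>F. g (z j) powr h) \<le> K" by blast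
    from bchoice[OF this] obtain K
      where "\<forall>I\<in>\<I>. \<forall>F. finite F \<longrightarrow> F \<subseteq> I \<longrightarrow> (\<Sum>j\<in>F. g (z j) powr h) \<le> K I" ..
    then have K: "(\<Sum>j\<in>F. g (z j) powr h) \<le> K I" if "I \<in> \<I>" "finite F" "F \<subseteq> I" for I F using that by blast
    have "(\<Sum>j\<in>F. bdist D (z j) powr h) \<le> A powr h * (\<Sum>I\<in>\<I>. K I)" if F: "finite F" for F
    proof -
      have "(\<Sum>j\<in>F. bdist D (z j) powr h) \<le> (\<Sum>j\<in>F. A powr h * g (z j) powr h)"
      proof (rule sum_mono)
        fix j
        have "bdist D (z j) powr h \<le> (A * g (z j)) powr h"
          using A(2)[OF zD] h0 by (intro powr_mono2) (auto simp: bdist_def infdist_nonneg)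
        also have "\<dots> = A powr h * g (z j) powr h" using A(1) g_pos[OF zD] less_imp_le by (intro powr_mult)
        finally show "bdist D (z j) powr h \<le> A powr h * g (z j) powr h" .
      qed
      also have "\<dots> = A powr h * (\<Sum>j\<in>F. g (z j) powr h)" by (simp add: sum_distrib_left)
      also have "\<dots> \<le> A powr h * (\<Sum>I\<in>\<I>. \<Sum>j\<in>F \<inter> I. g (z j) powr h)" using F by (intro mult_left_mono split) auto
      also have "\<dots> \<le> A powr h * (\<Sum>I\<in>\<I>. K I)" using F K by (intro mult_left_mono sum_mono) auto
      finally show ?thesis .
    qed
    then have "emeasure ?\<mu> UNIV \<le> ennreal (A powr h * (\<Sum>I\<in>\<I>. K I))" by (intro emeasure_dirac_sum_le) auto
    moreover have "space ?\<mu> = UNIV" using sets_eq_imp_space_eq[OF sets_dirac_sum] by simp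
    ultimately show ?thesis by (intro finite_measureI) (auto simp: top_unique)
  qed
  have "\<exists>C>0. \<forall>x\<in>D. measure ?\<mu> (kob_ball D x s) \<le> C * (measure lborel (kob_ball D x s)) powr \<theta>" if s: "0 < s" "s < 1" for s
  proof -
    define R where "R = artanh s"
    have R: "R > 0" using artanh_ge_self[of s] s by (simp add: R_def)
    obtain c Q where c: "c > 0" and Q: "Q \<ge> 1" and pos: "\<And>x. x \<in> D \<Longrightarrow> 0 < bdist D x"
      and vol: "\<And>x. x \<in> D \<Longrightarrow> c * bdist D x ^ (CARD('n) + 1) \<le> measure lborel (kball x R)"
      and cmp: "\<And>x y. x \<in> D \<Longrightarrow> y \<in> kball x R \<Longrightarrow> bdist D y \<le> Q * bdist D x"
      using bdist_kball[OF R] by metis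
    have "\<exists>N\<ge>0. \<forall>x\<in>D. \<forall>F. finite F \<longrightarrow> F \<subseteq> I \<longrightarrow> (\<forall>j\<in>F. z j \<in> kball x R) \<longrightarrow> real (card F) \<le> N" if I: "I \<in> \<I>" for I
    proof -
      obtain a where "a > 0" "\<And>i j. i \<in> I \<Longrightarrow> j \<in> I \<Longrightarrow> i \<noteq> j \<Longrightarrow> a \<le> kobayashi_dist D (z i) (z j)"
        by (rule uniformly_discreteD[OF ud[OF I] zD]) blast
      then show ?thesis by (rule packing_count[OF _ R zD])
    qed
    then have "\<forall>I\<in>\<I>. \<exists>N. N \<ge> 0 \<and> (\<forall>x\<in>D. \<forall>F. finite F \<longrightarrow> F \<subseteq> I \<longrightarrow> (\<forall>j\<in>F. z j \<in> kball x R) \<longrightarrow> real (card F) \<le> N)"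
      by blast
    from bchoice[OF this] obtain N where NN: "\<forall>I\<in>\<I>. N I \<ge> 0 \<and>
        (\<forall>x\<in>D. \<forall>F. finite F \<longrightarrow> F \<subseteq> I \<longrightarrow> (\<forall>j\<in>F. z j \<in> kball x R) \<longrightarrow> real (card F) \<le> N I)" ..
    then have N0: "N I \<ge> 0" if "I \<in> \<I>" for I using that by blast
    have N: "real (card F) \<le> N I" if "I \<in> \<I>" "x \<in> D" "finite F" "F \<subseteq> I" "\<forall>j\<in>F. z j \<in> kball x R" for I x F
      using NN that by blast
    define T where "T = (\<Sum>I\<in>\<I>. N I)"
    have T0: "T \<ge> 0" unfolding T_def using N0 by (rule sum_nonneg)
    define C where "C = T * Q powr h / c powr \<theta>"
    have C0: "C \<ge> 0" using T0 by (simp add: C_def)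
    \<comment> \<open>\<open>C\<close> may vanish, so \<open>C + 1\<close> supplies the required
      positive constant.\<close>
    have "measure ?\<mu> (kball x R) \<le> (C + 1) * (measure lborel (kball x R)) powr \<theta>" if x: "x \<in> D" for x
    proof -
      define \<delta> where "\<delta> = bdist D x"
      have \<delta>: "\<delta> > 0" using pos[OF x] by (simp add: \<delta>_def)
      have "emeasure ?\<mu> (kball x R) \<le> ennreal (T * (Q * \<delta>) powr h)"
      proof (rule emeasure_dirac_sum_le[OF kball_borel[OF x]])
        fix F :: "nat set" assume F: "finite F" "\<And>j. j \<in> F \<Longrightarrow> z j \<in> kball x R"
        have "real (card F) = (\<Sum>j\<in>F. 1)" by simp
        also have "\<dots> \<le> (\<Sum>I\<in>\<I>. \<Sum>j\<in>F \<inter> I. 1)" using F by (intro split) auto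
        also have "\<dots> \<le> T" unfolding T_def using F N[OF _ x] by (intro sum_mono) auto
        finally have cF: "real (card F) \<le> T" .
        have "(\<Sum>j\<in>F. bdist D (z j) powr h) \<le> (\<Sum>j\<in>F. (Q * \<delta>) powr h)"
          using cmp[OF x] F h0 by (intro sum_mono powr_mono2) (auto simp: \<delta>_def bdist_def infdist_nonneg)
        also have "\<dots> = real (card F) * (Q * \<delta>) powr h" by simp
        also have "\<dots> \<le> T * (Q * \<delta>) powr h" using cF by (intro mult_right_mono) auto
        finally show "(\<Sum>j\<in>F. bdist D (z j) powr h) \<le> T * (Q * \<delta>) powr h" .
      qed auto
      then have "measure ?\<mu> (kball x R) \<le> T * (Q * \<delta>) powr h"
        using T0 by (simp add: finite_measure.emeasure_eq_measure[OF fm])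
      also have "\<dots> = C * (c powr \<theta> * \<delta> powr h)" using Q \<delta> c by (simp add: C_def powr_mult)
      also have "c powr \<theta> * \<delta> powr h = (c * \<delta> ^ (CARD('n) + 1)) powr \<theta>"
        using c \<delta> power_powr[of \<delta> "CARD('n) + 1" \<theta>] by (simp add: powr_mult h_def add.commute)
      also have "C * (c * \<delta> ^ (CARD('n) + 1)) powr \<theta> \<le> (C + 1) * (measure lborel (kball x R)) powr \<theta>"
        using vol[OF x] \<theta>0 c \<delta> C0 by (intro mult_mono powr_mono2) (auto simp: \<delta>_def)
      finally show ?thesis .
    qed
    then show ?thesis unfolding kob_ball_eq R_def using C0 by (intro exI[of _ "C + 1"]) auto
  qed
  then show ?thesis unfolding theta_carleson_def h_def[symmetric]
    using fm by (intro conjI allI impI sets_dirac_sum) simp_all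
qed

text \<open>Every point in a ball about \<open>x\<close> has weight at least a multiple of
  \<open>\<delta> powr h\<close>, while the ball has mass at most a multiple of it; so the number of
  points, repetitions included, is bounded uniformly in \<open>x\<close>. Colouring the graph of
  close pairs then splits the indices.\<close>

lemma discrete_if_carleson:
  assumes zD: "\<And>j. z j \<in> D" and \<theta>: "1 - 1 / (real CARD('n) + 1) < \<theta>"
    and car: "theta_carleson D \<theta> (dirac_sum z (\<lambda>j. bdist D (z j) powr ((real CARD('n) + 1) * \<theta>)))"
  shows "finite_union_unif_discrete D z"
proof -
  define h where "h = (real CARD('n) + 1) * \<theta>"
  let ?\<mu> = "dirac_sum z (\<lambda>j. bdist D (z j) powr h)"
  have "1 / (real CARD('n) + 1) \<le> 1" by simp
  then have \<theta>0: "\<theta> > 0" using \<theta> by linarith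
  have h0: "h > 0" using \<theta>0 by (simp add: h_def)
  have fm: "finite_measure ?\<mu>" using car by (simp add: theta_carleson_def h_def)
  \<comment> \<open>The Carleson inequality is applied at the radius 1/2, and the same number
    becomes the separation constant of the colour classes.\<close>
  define R where "R = artanh (1 / 2 :: real)"
  have R: "R > 0" using artanh_ge_self[of "1 / 2"] by (simp add: R_def)
  have tR: "tanh R = 1 / 2" unfolding R_def by (rule tanh_artanh_real) auto
  have "\<exists>C>0. \<forall>x\<in>D. measure ?\<mu> (kob_ball D x (1 / 2)) \<le> C * (measure lborel (kob_ball D x (1 / 2))) powr \<theta>"
    using car unfolding theta_carleson_def h_def by (auto elim!: allE[of _ "1 / 2"])
  then obtain C where C: "C > 0" "\<And>x. x \<in> D \<Longrightarrow> measure ?\<mu> (kball x R) \<le> C * (measure lborel (kball x R)) powr \<theta>"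
    unfolding kob_ball_eq R_def by blast
  obtain B Q where B: "B > 0" and Q: "Q \<ge> 1" and pos: "\<And>x. x \<in> D \<Longrightarrow> 0 < bdist D x"
    and vol: "\<And>x. x \<in> D \<Longrightarrow> measure lborel (kball x R) \<le> B * bdist D x ^ (CARD('n) + 1)"
    and cmp: "\<And>x y. x \<in> D \<Longrightarrow> y \<in> kball x R \<Longrightarrow> bdist D x \<le> Q * bdist D y"
    using bdist_kball[OF R] by metis
  have count: "real (card F) \<le> C * B powr \<theta> * Q powr h"
    if x: "x \<in> D" and F: "finite F" "\<And>j. j \<in> F \<Longrightarrow> z j \<in> kball x R" for x F
  proof -
    define \<delta> where "\<delta> = bdist D x"
    have \<delta>: "\<delta> > 0" using pos[OF x] by (simp add: \<delta>_def)
    have "(\<Sum>j\<in>F. (\<delta> / Q) powr h) \<le> (\<Sum>j\<in>F. bdist D (z j) powr h)"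
    proof (intro sum_mono powr_mono2)
      fix j assume "j \<in> F"
      then show "\<delta> / Q \<le> bdist D (z j)" using cmp[OF x F(2)] Q by (simp add: \<delta>_def pos_divide_le_eq mult.commute)
    qed (use h0 \<delta> Q in auto)
    also have "\<dots> \<le> measure ?\<mu> (kball x R)"
      by (rule sum_le_measure_dirac_sum[OF kball_borel[OF x] _ fm F]) auto
    also have "\<dots> \<le> C * (measure lborel (kball x R)) powr \<theta>" by (rule C(2)[OF x])
    also have "\<dots> \<le> C * (B * \<delta> ^ (CARD('n) + 1)) powr \<theta>"
      using vol[OF x] C \<theta>0 by (intro mult_left_mono powr_mono2) (auto simp: \<delta>_def)
    also have "(B * \<delta> ^ (CARD('n) + 1)) powr \<theta> = B powr \<theta> * \<delta> powr h"
      using B \<delta> power_powr[of \<delta> "CARD('n) + 1" \<theta>] by (simp add: powr_mult h_def add.commute)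
    finally have "(real (card F) / Q powr h) * \<delta> powr h \<le> (C * B powr \<theta>) * \<delta> powr h"
      using Q \<delta> by (simp add: powr_divide mult.assoc)
    then have "real (card F) / Q powr h \<le> C * B powr \<theta>" by (rule mult_right_le_imp_le) (use \<delta> in simp)
    then show ?thesis using Q by (simp add: pos_divide_le_eq)
  qed
  define N where "N = nat \<lfloor>C * B powr \<theta> * Q powr h\<rfloor>"
  \<comment> \<open>Coinciding points at different indices are adjacent too, so they receive
    different colours.\<close>
  define E where "E = (\<lambda>i j. kobayashi_dist D (z i) (z j) < R)"
  have "card {i. i < j \<and> E i j} \<le> N" for j
  proof -
    have "real (card {i. i < j \<and> E i j}) \<le> C * B powr \<theta> * Q powr h"
    proof (rule count[OF zD[of j]])
      show "z i \<in> kball (z j) R" if "i \<in> {i. i < j \<and> E i j}" for i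
        using that zD[of i] unfolding kball_def E_def by (simp add: kobayashi_dist_commute[of D "z j" "z i"])
    qed simp
    then show ?thesis unfolding N_def by linarith
  qed
  from greedy_colouring[OF this] obtain col
    where "\<forall>j. col j \<le> N \<and> (\<forall>i<j. E i j \<longrightarrow> col i \<noteq> col j)" ..
  then have col: "\<And>j. col j \<le> N" "\<And>i j. i < j \<Longrightarrow> E i j \<Longrightarrow> col i \<noteq> col j" by simp_all
  have ud: "uniformly_discrete D z {j. col j = c}" for c
    unfolding uniformly_discrete_def
  proof (intro exI[of _ "1 / 2"] conjI ballI impI)
    fix i j assume ij: "i \<in> {j. col j = c}" "j \<in> {j. col j = c}" "i \<noteq> j"
    have "\<not> E i j"
    proof
      assume E: "E i j"
      then have "E j i" by (simp add: E_def kobayashi_dist_commute)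
      with E show False using col(2)[of i j] col(2)[of j i] ij by (auto simp: neq_iff)
    qed
    then have "tanh R \<le> tanh (kobayashi_dist D (z i) (z j))" by (simp add: E_def)
    then show "1 / 2 \<le> rho D (z i) (z j)" by (simp add: rho_def tR)
  qed auto
  show ?thesis unfolding finite_union_unif_discrete_def
    by (rule exI[of _ "(\<lambda>c. {j. col j = c}) ` {..N}"]) (use ud col(1) in auto)
qed

end

theorem theorem3p4:
  fixes D :: "(complex ^ 'n) set" and \<theta> :: real and z :: "nat \<Rightarrow> complex ^ 'n"
  assumes "strongly_pseudoconvex_domain D"
    and "1 - 1 / (real CARD('n) + 1) < \<theta>" and "\<theta> < 2"
    and "\<And>j. z j \<in> D"
  shows "finite_union_unif_discrete D z \<longleftrightarrow>
         theta_carleson D \<theta>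
           (dirac_sum z (\<lambda>j. bdist D (z j) powr ((real CARD('n) + 1) * \<theta>)))"
proof -
  obtain U r Dr D2r where sp: "spc D U r Dr D2r"
  proof -
    have "\<exists>U r Dr D2r. spc D U r Dr D2r"
      using assms(1) unfolding strongly_pseudoconvex_domain_def spc_def
      by (elim conjE exE) (rule exI, rule exI, rule exI, rule exI, intro conjI allI impI; (assumption | blast))
    then show ?thesis using that by (elim exE)
  qed
  interpret spc D U r Dr D2r by (rule sp)
  from bounds_exist obtain e M where eM: "e > 0" "M \<ge> 1"
    and t1: "\<forall>x\<in>closure D. \<forall>v. norm v \<le> e \<longrightarrow> x + v \<in> U \<and> \<bar>r (x + v) - r x - Dr x v\<bar> \<le> M * (norm v)\<^sup>2"
    and t2: "\<forall>\<epsilon>>0. \<exists>d>0. \<forall>x\<in>closure D. \<forall>v. norm v < d \<longrightarrow>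
      \<bar>r (x + v) - r x - Dr x v - D2r x v v / 2\<bar> \<le> \<epsilon> * (norm v)\<^sup>2"
    and b: "\<forall>x\<in>closure D. norm (Dr x) \<le> M \<and> norm (D2r x) \<le> M"
    and l: "\<forall>x\<in>closure D. \<forall>y\<in>closure D. norm (y - x) \<le> M \<and> \<bar>r y - r x\<bar> \<le> M * norm (y - x) \<and>
      norm (Dr y - Dr x) \<le> M * norm (y - x) \<and> \<bar>r y - r x - Dr x (y - x)\<bar> \<le> M * (norm (y - x))\<^sup>2"
    by (elim exE conjE)
  interpret spc_bounds D U r Dr D2r e M
  proof
    show "\<exists>d>0. \<forall>x\<in>closure D. \<forall>v. norm v < d \<longrightarrow>
      \<bar>r (x + v) - r x - Dr x v - D2r x v v / 2\<bar> \<le> \<epsilon> * (norm v)\<^sup>2" if "\<epsilon> > 0" for \<epsilon>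
      using t2[rule_format, OF that] .
  qed (use eM t1 b l in simp_all)
  show ?thesis
  proof
    assume "finite_union_unif_discrete D z"
    then obtain \<I> where "finite \<I>" "\<Union>\<I> = UNIV" "\<And>I. I \<in> \<I> \<Longrightarrow> uniformly_discrete D z I"
      unfolding finite_union_unif_discrete_def by auto
    then show "theta_carleson D \<theta> (dirac_sum z (\<lambda>j. bdist D (z j) powr ((real CARD('n) + 1) * \<theta>)))"
      by (rule carleson_if_discrete[OF assms(4,2)])
  qed (rule discrete_if_carleson[OF assms(4,2)])
qed

end
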